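(* Let $N\ge1$, let $F:\mathbb{T}^N\times\mathbb{R}^N\to\mathbb{C}$ be a continuous function and let $0<\gamma\le1/2$. Then, for any $\boldsymbol{\xi}\in(\overline{\mathbb{Q}}^{\times})^N$, we have $$\mathcal{E}(F,\boldsymbol{\xi})\le C(F)\,h_{\mathcal{D}}(\boldsymbol{\xi})^{\gamma},$$ with $$C(F):=2^{\gamma}L_\gamma(F)+24^{\gamma}\sum_{\boldsymbol{n}\in\mathbb{Z}^N}\big|\widehat{F_{\boldsymbol{0}}}(\boldsymbol{n})\big|\,\|\boldsymbol{n}\|_1^{\gamma},\qquad L_\gamma(F):=\sup_{\substack{(\boldsymbol{\theta},\boldsymbol{s})\in\mathbb{T}^N\times\mathbb{R}^N\\ \boldsymbol{s}\ne\boldsymbol{0}}}\frac{|F(\boldsymbol{\theta},\boldsymbol{s})-F(\boldsymbol{\theta},\boldsymbol{0})|}{|\boldsymbol{s}|^{\gamma}}.$$ Moreover, the exponent $\gamma$ is sharp in the following sense: there exist a continuous function $F:\mathbb{T}^N\times\mathbb{R}^N\to\mathbb{C}$ with $C(F)<\infty$ and a sequence $\{\boldsymbol{\xi}_k\}_{k\ge1}\subset(\overline{\mathbb{Q}}^{\times})^N$ with $\lim_{k\to\infty}h_{\mathcal{D}}(\boldsymbol{\xi}_k)=0$ for which, for every $k\geq 1$, $$\mathcal{E}(F,\boldsymbol{\xi}_k)\ge h_{\mathcal{D}}(\boldsymbol{\xi}_k)^{\gamma}.$$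
   Context: Fix $\overline{\mathbb{Q}}\subset\mathbb{C}$, the algebraic closure of $\mathbb{Q}$; $\overline{\mathbb{Q}}^\times$, $\mathbb{C}^\times$ are the multiplicative groups. Heights. For $\xi\in\overline{\mathbb{Q}}$ let $P_\xi(x)=c_d\prod_{j=1}^d(x-\alpha_j)\in\mathbb{Z}[x]$ be its minimal polynomial (primitive, with integer coefficients), $d=\deg(\xi)=[\mathbb{Q}(\xi):\mathbb{Q}]$. Its Weil height is $h(\xi)=\frac1d\big(\log|c_d|+\sum_{j=1}^d\log^+|\alpha_j|\big)$, where $\log^+x=\max\{0,\log x\}$ (and $\log^+0=0$). For $\boldsymbol{\xi}=(\xi_1,\dots,\xi_N)\in(\overline{\mathbb{Q}}^\times)^N$, $h(\boldsymbol{\xi}):=h(\xi_1)+\dots+h(\xi_N)$. For $\boldsymbol{n}\in\mathbb{Z}^N$, $\chi^{\boldsymbol{n}}(\boldsymbol{\xi}):=\xi_1^{n_1}\cdots\xi_N^{n_N}$. The generalized degree is $\mathcal{D}(\boldsymbol{\xi}):=\min_{\boldsymbol{n}\in\mathbb{Z}^N\setminus\{\boldsymbol{0}\}}\{\|\boldsymbol{n}\|_1\deg(\chi^{\boldsymbol{n}}(\boldsymbol{\xi}))\}$, and $h_{\mathcal{D}}(\boldsymbol{\xi}):=h(\boldsymbol{\xi})+\frac{\log(2\mathcal{D}(\boldsymbol{\xi}))}{3\mathcal{D}(\boldsymbol{\xi})}$. Here $\|\boldsymbol{n}\|_1=\sum_j|n_j|$ and $|\boldsymbol{s}|$ is the Euclidean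 norm. Equidistribution error. Let $\mathbb{T}=\mathbb{R}/\mathbb{Z}$. The space $\mathbb{T}^N\times\mathbb{R}^N$ is identified with $(\mathbb{C}^\times)^N$ via $(\boldsymbol{\theta},\boldsymbol{s})\mapsto(e^{2\pi i\theta_1+s_1},\dots,e^{2\pi i\theta_N+s_N})$, and test functions are viewed as functions $F(\boldsymbol{\theta},\boldsymbol{s})$ on $\mathbb{T}^N\times\mathbb{R}^N$. Let $S=\{(\sigma\xi_1,\dots,\sigma\xi_N):\sigma\in\mathrm{Gal}(\overline{\mathbb{Q}}/\mathbb{Q})\}$ be the (finite) Galois orbit of $\boldsymbol{\xi}$. For $\boldsymbol{\alpha}\in S$ let $(\boldsymbol{\theta}(\boldsymbol{\alpha}),\boldsymbol{s}(\boldsymbol{\alpha}))$ be the corresponding point of $\mathbb{T}^N\times\mathbb{R}^N$, i.e. $\boldsymbol{\theta}(\boldsymbol{\alpha})=(\arg(\alpha_j)/2\pi)_j$, $\boldsymbol{s}(\boldsymbol{\alpha})=(\log|\alpha_j|)_j$. Then $$\mathcal{E}(F,\boldsymbol{\xi}):=\Big|\frac1{|S|}\sum_{\boldsymbol{\alpha}\in S}F(\boldsymbol{\theta}(\boldsymbol{\alpha}),\boldsymbol{s}(\boldsymbol{\alpha}))-\int_{\mathbb{T}^N}F(\boldsymbol{\theta},\boldsymbol{0})\,d\boldsymbol{\theta}\Big|,$$ that is, the absolute difference of the integrals of $F$ against the uniform probability measure on $S$ and the Haar probability measure on the unit polycircle $(\mathbb{S}^1)^N$. Fourier coefficients. $F_{\boldsymbol{0}}(\boldsymbol{\theta}):=F(\boldsymbol{\theta},\boldsymbol{0})$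 and $\widehat{F_{\boldsymbol{0}}}(\boldsymbol{n})=\int_{\mathbb{T}^N}F_{\boldsymbol{0}}(\boldsymbol{\theta})e^{-2\pi i\boldsymbol{n}\cdot\boldsymbol{\theta}}\,d\boldsymbol{\theta}$ for $\boldsymbol{n}\in\mathbb{Z}^N$. Convention. If $C(F)=\infty$ the upper bound is trivially true. *)

theory Defs
  imports "HOL-Analysis.Analysis" "HOL-Computational_Algebra.Computational_Algebra"
begin

section \<open>Weil height and generalized degree\<close>

definition is_min_int_poly :: "complex \<Rightarrow> int poly \<Rightarrow> bool" where
  "is_min_int_poly x p \<longleftrightarrow>
     p \<noteq> 0 \<and> poly (map_poly of_int p) x = 0 \<and> content p = 1 \<and> lead_coeff p > 0 \<and>
     (\<forall>q. q \<noteq> 0 \<and> poly (map_poly of_int q) x = 0 \<longrightarrow> degree p \<le> degree q)"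

text \<open>For algebraic \<open>x\<close> there is exactly one such polynomial; the positive leading
  coefficient only fixes the sign.\<close>

definition min_int_poly :: "complex \<Rightarrow> int poly" where
  "min_int_poly x = (THE p. is_min_int_poly x p)"

definition alg_degree :: "complex \<Rightarrow> nat" where
  "alg_degree x = degree (min_int_poly x)"

text \<open>Since \<open>ln 0 = 0\<close> in the library, this gives \<open>log_plus 0 = 0\<close>.\<close>

definition log_plus :: "real \<Rightarrow> real" where
  "log_plus x = max 0 (ln x)"

definition weil_height :: "complex \<Rightarrow> real" where
  "weil_height x =
     (ln \<bar>real_of_int (lead_coeff (min_int_poly x))\<bar> +
      (\<Sum>\<alpha>\<in>#proots (map_poly of_int (min_int_poly x)). log_plus (cmod \<alpha>))) / real (alg_degree x)"

definition weil_height_vec :: "complex ^ 'n \<Rightarrow> real" where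
  "weil_height_vec \<xi> = (\<Sum>j\<in>UNIV. weil_height (\<xi> $ j))"

definition alg_torus :: "(complex ^ 'n) set" where
  "alg_torus = {\<xi>. \<forall>j. algebraic (\<xi> $ j) \<and> \<xi> $ j \<noteq> 0}"

definition monomial_char :: "int ^ 'n \<Rightarrow> complex ^ 'n \<Rightarrow> complex" where
  "monomial_char n \<xi> = (\<Prod>j\<in>UNIV. (\<xi> $ j) powi (n $ j))"

definition norm_l1 :: "int ^ 'n \<Rightarrow> nat" where
  "norm_l1 n = nat (\<Sum>j\<in>UNIV. \<bar>n $ j\<bar>)"

text \<open>The infimum of a nonempty set of natural numbers is its minimum.\<close>

definition gen_degree :: "complex ^ 'n \<Rightarrow> nat" where
  "gen_degree \<xi> = (INF n\<in>UNIV - {0}. norm_l1 n * alg_degree (monomial_char n \<xi>))"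

definition height_D :: "complex ^ 'n \<Rightarrow> real" where
  "height_D \<xi> = weil_height_vec \<xi> + ln (2 * real (gen_degree \<xi>)) / (3 * real (gen_degree \<xi>))"

section \<open>Galois orbits\<close>

text \<open>An element of the absolute Galois group is a field automorphism of the set of algebraic
  complex numbers; its values outside that set are irrelevant.\<close>

definition abs_galois :: "(complex \<Rightarrow> complex) set" where
  "abs_galois = {\<sigma>.
     bij_betw \<sigma> {x. algebraic x} {x. algebraic x} \<and>
     (\<forall>x y. algebraic x \<and> algebraic y \<longrightarrow> \<sigma> (x + y) = \<sigma> x + \<sigma> y \<and> \<sigma> (x * y) = \<sigma> x * \<sigma> y) \<and>
     (\<forall>q\<in>\<rat>. \<sigma> q = q)}"

definition galois_orbit :: "complex ^ 'n \<Rightarrow> (complex ^ 'n) set" where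
  "galois_orbit \<xi> = (\<lambda>\<sigma>. \<chi> j. \<sigma> (\<xi> $ j)) ` abs_galois"

section \<open>Test functions and the equidistribution error\<close>

text \<open>A continuous function on the product of the torus \<open>(\<real>/\<int>)\<^sup>N\<close> with \<open>\<real>\<^sup>N\<close> is a continuous
  function on \<open>\<real>\<^sup>N \<times> \<real>\<^sup>N\<close> that is \<open>\<int>\<^sup>N\<close>-periodic in its first argument. Integration over the torus
  is integration over the unit cube.\<close>

definition torus_continuous :: "(real ^ 'n \<Rightarrow> real ^ 'n \<Rightarrow> complex) \<Rightarrow> bool" where
  "torus_continuous F \<longleftrightarrow>
     continuous_on UNIV (\<lambda>(\<theta>, s). F \<theta> s) \<and>
     (\<forall>(m :: int ^ 'n) \<theta> s. F (\<theta> + (\<chi> j. real_of_int (m $ j))) s = F \<theta> s)"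

definition torus_integral :: "(real ^ 'n \<Rightarrow> complex) \<Rightarrow> complex" where
  "torus_integral f = (LINT \<theta>:cbox 0 1|lborel. f \<theta>)"

definition angle_coords :: "complex ^ 'n \<Rightarrow> real ^ 'n" where
  "angle_coords \<alpha> = (\<chi> j. Arg (\<alpha> $ j) / (2 * pi))"

definition log_coords :: "complex ^ 'n \<Rightarrow> real ^ 'n" where
  "log_coords \<alpha> = (\<chi> j. ln (cmod (\<alpha> $ j)))"

definition equi_error :: "(real ^ 'n \<Rightarrow> real ^ 'n \<Rightarrow> complex) \<Rightarrow> complex ^ 'n \<Rightarrow> real" where
  "equi_error F \<xi> =
     cmod ((\<Sum>\<alpha>\<in>galois_orbit \<xi>. F (angle_coords \<alpha>) (log_coords \<alpha>)) / of_nat (card (galois_orbit \<xi>))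
           - torus_integral (\<lambda>\<theta>. F \<theta> 0))"

section \<open>The constant of the bound\<close>

definition fourier_coeff :: "(real ^ 'n \<Rightarrow> complex) \<Rightarrow> int ^ 'n \<Rightarrow> complex" where
  "fourier_coeff f n =
     torus_integral (\<lambda>\<theta>. f \<theta> * exp (- 2 * pi * \<i> * (\<Sum>j\<in>UNIV. of_int (n $ j) * of_real (\<theta> $ j))))"

definition holder_const :: "real \<Rightarrow> (real ^ 'n \<Rightarrow> real ^ 'n \<Rightarrow> complex) \<Rightarrow> ennreal" where
  "holder_const \<gamma> F =
     (SUP (\<theta>, s)\<in>UNIV \<times> (UNIV - {0}). ennreal (cmod (F \<theta> s - F \<theta> 0) / norm s powr \<gamma>))"

definition bound_const :: "real \<Rightarrow> (real ^ 'n \<Rightarrow> real ^ 'n \<Rightarrow> complex) \<Rightarrow> ennreal" where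
  "bound_const \<gamma> F =
     ennreal (2 powr \<gamma>) * holder_const \<gamma> F +
     ennreal (24 powr \<gamma>) *
       (\<Sum>\<^sub>\<infinity>n\<in>UNIV. ennreal (cmod (fourier_coeff (\<lambda>\<theta>. F \<theta> 0) n) * real (norm_l1 n) powr \<gamma>))"

end

theory Submission
  imports Defs
begin

text \<open>The error is split at \<open>F_0(\<theta>) = F(\<theta>,0)\<close> into a radial and an angular part.

  The radial part is the mean of \<open>F(\<theta>,s) - F(\<theta>,0)\<close> over the Galois orbit. It is at most
  \<open>L_\<gamma>(F)\<close> times the mean of \<open>|s|^\<gamma>\<close>, hence by concavity at most \<open>L_\<gamma>(F)\<close> times the \<open>\<gamma>\<close>-th
  power of the mean of \<open>|s|\<close>. The mean of \<open>|log|\<alpha>||\<close> over the conjugates of a number is at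
  most twice its height, because \<open>log^+|\<alpha>|\<close> and \<open>log^+|1/\<alpha>|\<close> both average to at most the
  height. This gives \<open>L_\<gamma>(F)(2h(\<xi>))^\<gamma>\<close>.

  For the angular part \<open>F_0\<close> is smoothed to trigonometric polynomials, which reduces the
  problem to the mean \<open>m\<close> of \<open>\<eta>/|\<eta>|\<close> over the conjugates of \<open>\<eta> = \<chi>^n(\<xi>)\<close>. The discriminant
  of the minimal polynomial of \<open>\<eta>\<close> is a nonzero integer, so the conjugates cannot all be
  close to each other; on the other hand an expansion of \<open>-log|1-z|\<close> into positive definite
  kernels shows that they would have to be if the phases \<open>\<eta>/|\<eta>|\<close> had a large mean.
  Quantitatively (\<open>conjugate_angles_estimate\<close>) \<open>m^2 \<le> 8h(\<eta>) + 8log(2d)/d\<close> with \<open>d = deg \<eta>\<close>.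
  Subadditivity of the height (\<open>weil_height_monomial_le\<close>) and the definition of the
  generalized degree bound this by \<open>24|n|_1 h_D(\<xi>)\<close> (\<open>orbit_character_sum_le\<close>). As also \<open>m \<le>
  1\<close>, the exponent \<open>1/2\<close> may be lowered to any \<open>\<gamma> \<le> 1/2\<close>.

  Both the discriminant bound and the subadditivity rest on one fact about denominators: if
  \<open>c\<close> is the leading coefficient of an integer polynomial, then \<open>c\<close> times the product of any
  subfamily of its roots is an algebraic integer (\<open>integral_subproduct_of_roots\<close>).
  Rationality, and the passage between the orbit of \<open>\<xi>\<close> and the conjugates of \<open>\<eta>\<close>, come from
  the transitivity of the absolute Galois group on conjugates (\<open>galois_transitive\<close>).

  For sharpness take \<open>\<xi>_k = (q_1^(k/K), ..., q_N^(k/K))\<close> with distinct primes \<open>q_j\<close> and \<open>K =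
  k^2+1\<close>. All conjugates of a coordinate have the same modulus, and unique factorization
  forces the generalized degree to be at least \<open>K\<close>; so \<open>h_D(\<xi>_k)\<close> is comparable to \<open>|s|\<close> on
  the orbit, while the error of \<open>F(\<theta>,s) = A|s|^\<gamma>\<close> is exactly \<open>A|s|^\<gamma>\<close>.\<close>

section \<open>Algebraic integers\<close>

text \<open>The complex numbers are regarded as a module over the integers and as a vector space over
  the rationals. Both structures are local to this block, because their scaling laws rewrite
  products in the direction opposite to the ring laws.\<close>
context
begin

interpretation int_mod: module "\<lambda>(a::int) (x::complex). of_int a * x"
  by unfold_locales (auto simp: algebra_simps)

interpretation rat_vs: vector_space "\<lambda>(a::rat) (x::complex). of_rat a * x"
  by unfold_locales (auto simp: algebra_simps of_rat_add of_rat_mult)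

text \<open>A complex number is an algebraic integer iff multiplication by it preserves a nonzero
  finitely generated group of complex numbers. With this description as the definition,
  closure properties reduce to multiplying generating sets.\<close>
definition stabilizes :: "complex \<Rightarrow> complex set \<Rightarrow> bool" where
  "stabilizes x V \<longleftrightarrow> (\<forall>v\<in>V. x * v \<in> int_mod.span V)"

definition integral_elt :: "complex \<Rightarrow> bool" where
  "integral_elt x \<longleftrightarrow> (\<exists>V. finite V \<and> (\<exists>v\<in>V. v \<noteq> 0) \<and> stabilizes x V)"

lemma stabilizes_span:
  assumes "stabilizes x V" "y \<in> int_mod.span V"
  shows "x * y \<in> int_mod.span V"
  using assms(2)
proof (induction rule: int_mod.span_induct_alt)
  case base
  then show ?case by (simp add: int_mod.span_zero)
next
  case (step c v y)
  have "of_int c * (x * v) + x * y \<in> int_mod.span V"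
    using assms(1) step unfolding stabilizes_def
    by (intro int_mod.span_add int_mod.span_scale) auto
  then show ?case by (simp add: algebra_simps)
qed

lemma stabilizes_add: "stabilizes x V \<Longrightarrow> stabilizes y V \<Longrightarrow> stabilizes (x + y) V"
  unfolding stabilizes_def by (simp add: ring_distribs int_mod.span_add)

lemma stabilizes_mult: "stabilizes x V \<Longrightarrow> stabilizes y V \<Longrightarrow> stabilizes (x * y) V"
  using stabilizes_span[of x V] unfolding stabilizes_def by (simp add: mult.assoc)

lemma stabilizes_of_int: "stabilizes (of_int a) V"
  unfolding stabilizes_def by (auto intro: int_mod.span_scale int_mod.span_base)

lemma span_mult_right:
  assumes "x \<in> int_mod.span V" "\<And>v. v \<in> V \<Longrightarrow> v * w \<in> W"
  shows "x * w \<in> int_mod.span W"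
  using assms(1)
proof (induction rule: int_mod.span_induct_alt)
  case base
  then show ?case by (simp add: int_mod.span_zero)
next
  case (step c v y)
  have "v * w \<in> int_mod.span W" using step assms(2) int_mod.span_base by blast
  then have "of_int c * (v * w) + y * w \<in> int_mod.span W"
    using step by (intro int_mod.span_add int_mod.span_scale)
  then show ?case by (simp add: algebra_simps)
qed

text \<open>The products of two generating sets span a group that is stable under the multipliers of
  both; this is how groups belonging to different numbers are merged.\<close>
lemma stabilizes_set_times:
  assumes "stabilizes x V"
  shows "stabilizes x ((\<lambda>(v, w). v * w) ` (V \<times> W))"
  unfolding stabilizes_def
proof clarsimp
  fix v w assume "v \<in> V" "w \<in> W"
  then have "(x * v) * w \<in> int_mod.span ((\<lambda>(v, w). v * w) ` (V \<times> W))"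
    using assms unfolding stabilizes_def by (intro span_mult_right[of "x * v" V]) auto
  then show "x * (v * w) \<in> int_mod.span ((\<lambda>(v, w). v * w) ` (V \<times> W))"
    by (simp add: mult.assoc)
qed

lemma set_times_commute: "(\<lambda>(v, w). v * w :: complex) ` (V \<times> W) = (\<lambda>(v, w). v * w) ` (W \<times> V)"
  unfolding image_def by auto (metis mult.commute)+

lemma common_stable_set:
  assumes "finite X" "\<And>x. x \<in> X \<Longrightarrow> integral_elt x"
  shows "\<exists>V. finite V \<and> (\<exists>v\<in>V. v \<noteq> 0) \<and> (\<forall>x\<in>X. stabilizes x V)"
  using assms
proof (induction X rule: finite_induct)
  case empty
  show ?case by (rule exI[of _ "{1}"]) auto
next
  case (insert x X)
  then have "\<exists>V. finite V \<and> (\<exists>v\<in>V. v \<noteq> 0) \<and> (\<forall>x\<in>X. stabilizes x V)" by simp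
  then obtain V v where V: "finite V" "v \<in> V" "v \<noteq> 0" "\<forall>x\<in>X. stabilizes x V" by blast
  have "integral_elt x" using insert.prems by simp
  then obtain W w where W: "finite W" "w \<in> W" "w \<noteq> 0" "stabilizes x W"
    unfolding integral_elt_def by blast
  let ?U = "(\<lambda>(v, w). v * w) ` (V \<times> W)"
  have "v * w \<in> ?U" using V W by blast
  moreover have "stabilizes x ?U"
    using stabilizes_set_times[OF W(4), of V] by (subst set_times_commute)
  moreover have "\<forall>x\<in>X. stabilizes x ?U" using V(4) stabilizes_set_times by blast
  moreover have "finite ?U" "v * w \<noteq> 0" using V W by auto
  ultimately show ?case by (intro exI[of _ ?U]) blast
qed

lemma integral_add:
  assumes "integral_elt x" "integral_elt y"
  shows "integral_elt (x + y)"
proof -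
  obtain V where "finite V" "\<exists>v\<in>V. v \<noteq> 0" "stabilizes x V" "stabilizes y V"
    using common_stable_set[of "{x, y}"] assms by auto
  then show ?thesis unfolding integral_elt_def using stabilizes_add by blast
qed

lemma integral_mult:
  assumes "integral_elt x" "integral_elt y"
  shows "integral_elt (x * y)"
proof -
  obtain V where "finite V" "\<exists>v\<in>V. v \<noteq> 0" "stabilizes x V" "stabilizes y V"
    using common_stable_set[of "{x, y}"] assms by auto
  then show ?thesis unfolding integral_elt_def using stabilizes_mult by blast
qed

lemma integral_of_int [simp, intro]: "integral_elt (of_int a)"
  using stabilizes_of_int[of a "{1}"] unfolding integral_elt_def by (intro exI[of _ "{1}"]) auto

lemma integral_0 [simp, intro]: "integral_elt 0" and integral_1 [simp, intro]: "integral_elt 1"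
  using integral_of_int[of 0] integral_of_int[of 1] by simp_all

lemma integral_minus:
  assumes "integral_elt x" shows "integral_elt (- x)"
  using integral_mult[OF integral_of_int[of "-1"] assms] by simp

lemma integral_diff: "integral_elt x \<Longrightarrow> integral_elt y \<Longrightarrow> integral_elt (x - y)"
  using integral_add[OF _ integral_minus, of x y] by simp

lemma integral_power: "integral_elt x \<Longrightarrow> integral_elt (x ^ n)"
  by (induction n) (auto intro: integral_mult)

lemma integral_sum: "(\<And>i. i \<in> A \<Longrightarrow> integral_elt (f i)) \<Longrightarrow> integral_elt (sum f A)"
  by (induction A rule: infinite_finite_induct) (auto intro: integral_add)

lemma integral_prod: "(\<And>i. i \<in> A \<Longrightarrow> integral_elt (f i)) \<Longrightarrow> integral_elt (prod f A)"
  by (induction A rule: infinite_finite_induct) (auto intro: integral_mult)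

text \<open>Take a group that is stable under all coefficients and multiply its generators by \<open>1, a,
  ..., a^(m-1)\<close>: the relation returns \<open>a^m\<close> to the span of these.\<close>
lemma integral_of_monic_relation:
  fixes a :: complex and c :: "nat \<Rightarrow> complex"
  assumes c: "\<And>i. i < m \<Longrightarrow> integral_elt (c i)" and rel: "a ^ m = (\<Sum>i<m. c i * a ^ i)"
  shows "integral_elt a"
proof -
  obtain V v where V: "finite V" "v \<in> V" "v \<noteq> 0" "\<And>i. i < m \<Longrightarrow> stabilizes (c i) V"
  proof -
    have "\<exists>V. finite V \<and> (\<exists>v\<in>V. v \<noteq> 0) \<and> (\<forall>x\<in>c ` {..<m}. stabilizes x V)"
      by (rule common_stable_set) (auto intro: c)
    then show ?thesis using that by auto
  qed
  have m: "m > 0" using rel by (cases m) auto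
  let ?U = "(\<lambda>(v, w). v * w) ` (V \<times> (\<lambda>i. a ^ i) ` {..<m})"
  have "a * (u * a ^ i) \<in> int_mod.span ?U" if u: "u \<in> V" and i: "i < m" for u i
  proof (cases "Suc i < m")
    case True
    have "u * a ^ Suc i \<in> ?U" using u True by blast
    then have "u * a ^ Suc i \<in> int_mod.span ?U" by (rule int_mod.span_base)
    then show ?thesis by (simp add: mult_ac)
  next
    case False
    then have "Suc i = m" using i by simp
    then have "a * (u * a ^ i) = u * a ^ m" by (auto simp: mult_ac)
    also have "\<dots> = (\<Sum>i<m. (c i * u) * a ^ i)"
      by (simp add: rel sum_distrib_left mult_ac)
    also have "\<dots> \<in> int_mod.span ?U"
    proof (rule int_mod.span_sum)
      fix i assume "i \<in> {..<m}"
      then show "(c i * u) * a ^ i \<in> int_mod.span ?U"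
        using V(4) u unfolding stabilizes_def by (intro span_mult_right[of "c i * u" V]) auto
    qed
    finally show ?thesis .
  qed
  then have "stabilizes a ?U" unfolding stabilizes_def by auto
  moreover have "v \<in> ?U"
  proof -
    have "v * a ^ 0 \<in> ?U" using V m by blast
    then show ?thesis by simp
  qed
  ultimately show ?thesis unfolding integral_elt_def using V
    by (intro exI[of _ ?U]) auto
qed

text \<open>If \<open>f\<close> has degree \<open>n+1\<close> and leading coefficient \<open>c\<close>, then \<open>c^n f(a) = 0\<close> is a monic relation
  for \<open>ca\<close> with integral coefficients.\<close>
lemma integral_lead_coeff_times_root:
  fixes f :: "complex poly"
  assumes "\<And>i. integral_elt (coeff f i)" "poly f a = 0" 
  shows "integral_elt (lead_coeff f * a)"
proof (cases "degree f")
  case 0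
  then obtain c where "f = [:c:]" by (meson degree_eq_zeroE)
  with assms(2) show ?thesis by simp
next
  case (Suc n)
  define c where "c = lead_coeff f"
  have eq: "c * a ^ Suc n = - (\<Sum>i<Suc n. coeff f i * a ^ i)"
    using assms(2) Suc unfolding poly_altdef c_def
    by (simp add: lessThan_Suc_atMost [symmetric] eq_neg_iff_add_eq_0 add_ac del: sum.lessThan_Suc)
       (simp add: algebra_simps)
  have "(c * a) ^ Suc n = c ^ n * (c * a ^ Suc n)"
    by (simp add: power_mult_distrib mult_ac)
  also have "\<dots> = (\<Sum>i<Suc n. (- coeff f i * c ^ (n - i)) * (c * a) ^ i)"
    unfolding eq sum_distrib_left sum_negf [symmetric]
  proof (rule sum.cong[OF refl])
    fix i assume "i \<in> {..<Suc n}"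
    then have "c ^ n = c ^ (n - i) * c ^ i" by (simp flip: power_add)
    then show "c ^ n * - (coeff f i * a ^ i) = (- coeff f i * c ^ (n - i)) * (c * a) ^ i"
      by (simp add: power_mult_distrib mult_ac)
  qed
  finally have rel: "(c * a) ^ Suc n = (\<Sum>i<Suc n. (- coeff f i * c ^ (n - i)) * (c * a) ^ i)" .
  have "integral_elt (- coeff f i * c ^ (n - i))" for i
    unfolding c_def by (intro integral_mult integral_minus integral_power assms)
  then show ?thesis using integral_of_monic_relation[OF _ rel] by (simp add: c_def)
qed

text \<open>Synthetic division. The leading coefficient \<open>c\<close> of \<open>g\<close> is that of the product, and \<open>ca\<close> is
  integral because \<open>a\<close> is a root of the product; hence removing the leading term of \<open>g\<close>
  leads to the same situation in lower degree.\<close>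
lemma integral_coeffs_divide_linear:
  fixes g :: "complex poly"
  assumes "\<And>i. integral_elt (coeff ([:-a, 1:] * g) i)"
  shows "integral_elt (coeff g i)"
proof -
  have "\<forall>i\<ge>n. coeff g i = 0 \<Longrightarrow> \<forall>i. integral_elt (coeff ([:-a, 1:] * g) i) \<Longrightarrow>
      \<forall>i. integral_elt (coeff g i)" for n
  proof (induction n arbitrary: g)
    case 0
    then show ?case by simp
  next
    case (Suc n g)
    show ?case
    proof (cases "coeff g n = 0")
      case True
      then have "\<forall>i\<ge>n. coeff g i = 0" using Suc.prems(1) by (metis Suc_leI le_neq_implies_less)
      then show ?thesis using Suc by blast
    next
      case False
      have deg: "degree g = n"
        using Suc.prems(1) False by (intro antisym degree_le le_degree) auto
      let ?f = "[:-a, 1:] * g"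
      have lc: "lead_coeff ?f = coeff g n" unfolding lead_coeff_mult by (simp add: deg)
      have int: "integral_elt (coeff g n)" unfolding lc[symmetric] using Suc.prems(2) by blast
      have int_a: "integral_elt (coeff g n * a)"
        using integral_lead_coeff_times_root[of ?f a] Suc.prems(2) lc by auto
      define g' where "g' = g - monom (coeff g n) n"
      have f': "[:-a, 1:] * g' = ?f - monom (coeff g n) (Suc n) + monom (coeff g n * a) n"
        unfolding g'_def by (simp add: algebra_simps smult_monom monom_Suc minus_monom add_monom)
      have "\<forall>i. integral_elt (coeff ([:-a, 1:] * g') i)"
        unfolding f' coeff_add coeff_diff coeff_monom using Suc.prems(2) int int_a
        by (auto intro!: integral_add integral_diff simp del: mult_pCons_left)
      moreover have "\<forall>i\<ge>n. coeff g' i = 0"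
        using Suc.prems(1) by (auto simp: g'_def)
      ultimately have "\<forall>i. integral_elt (coeff g' i)" using Suc.IH by blast
      moreover have "g = g' + monom (coeff g n) n" by (simp add: g'_def)
      ultimately show ?thesis using int
        by (metis coeff_add coeff_monom integral_0 integral_add)
    qed
  qed
  from this[of "Suc (degree g)"] assms show ?thesis
    by (metis Suc_le_eq coeff_eq_0)
qed

text \<open>The source of all denominator estimates below. Dividing off the linear factors outside \<open>T\<close>
  keeps the coefficients integral, and the constant coefficient of what remains is \<open>c\<close> times
  the product of the roots in \<open>T\<close>, up to sign.\<close>
lemma integral_subproduct_of_roots:
  fixes y :: "'a \<Rightarrow> complex"
  assumes "finite I" "T \<subseteq> I"
    and "\<And>i. integral_elt (coeff (smult c (\<Prod>i\<in>I. [:- y i, 1:])) i)"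
  shows "integral_elt (c * (\<Prod>i\<in>T. y i))"
proof -
  have "\<forall>k. integral_elt (coeff (smult c (\<Prod>i\<in>T. [:- y i, 1:])) k)"
  proof -
    have "finite J \<Longrightarrow> J \<inter> T = {} \<Longrightarrow> finite T \<Longrightarrow>
       \<forall>k. integral_elt (coeff (smult c (\<Prod>i\<in>J \<union> T. [:- y i, 1:])) k) \<Longrightarrow>
       \<forall>k. integral_elt (coeff (smult c (\<Prod>i\<in>T. [:- y i, 1:])) k)" for J
    proof (induction J rule: finite_induct)
      case (insert j J)
      have "smult c (\<Prod>i\<in>insert j J \<union> T. [:- y i, 1:])
          = [:- y j, 1:] * smult c (\<Prod>i\<in>J \<union> T. [:- y i, 1:])"
        using insert.hyps insert.prems by (simp add: Int_insert_left split: if_splits)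
      then have "\<forall>k. integral_elt (coeff (smult c (\<Prod>i\<in>J \<union> T. [:- y i, 1:])) k)"
        using insert.prems integral_coeffs_divide_linear by metis
      then show ?case using insert by auto
    qed simp
    from this[of "I - T"] show ?thesis
      using assms finite_subset[OF assms(2,1)] by (auto simp: Un_absorb2)
  qed
  then have "integral_elt (poly (smult c (\<Prod>i\<in>T. [:- y i, 1:])) 0)"
    by (metis poly_0_coeff_0)
  then have "integral_elt ((-1) ^ card T * (c * (\<Prod>i\<in>T. - y i)))"
    by (intro integral_mult[OF integral_power]) (auto simp: poly_prod intro: integral_minus)
  moreover have "(-1) ^ card T * (c * (\<Prod>i\<in>T. - y i)) = c * (\<Prod>i\<in>T. y i)"
    by (simp add: prod_uminus mult_ac flip: power_mult_distrib)
  ultimately show ?thesis by simp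
qed

text \<open>Nakayama's lemma in matrix form: a matrix that is congruent to the identity modulo a
  non-unit \<open>q\<close> has trivial kernel. One step of division-free Gaussian elimination preserves
  the congruence, so the proof is by induction on the size.\<close>
lemma kernel_trivial_of_cong_identity:
  fixes A :: "'a \<Rightarrow> 'a \<Rightarrow> int" and x :: "'a \<Rightarrow> complex"
  assumes "finite V" "\<not> q dvd 1"
    and "\<And>i j. i \<in> V \<Longrightarrow> j \<in> V \<Longrightarrow> q dvd A i j - (if i = j then 1 else 0)"
    and "\<And>i. i \<in> V \<Longrightarrow> (\<Sum>j\<in>V. of_int (A i j) * x j) = 0"
    and "i \<in> V"
  shows "x i = 0"
  using assms
proof (induction V arbitrary: A i rule: finite_induct)
  case (insert k V)
  define B where "B i j = A k k * A i j - A i k * A k j" for i j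
  have rel: "of_int (A i k) * x k + (\<Sum>j\<in>V. of_int (A i j) * x j) = 0" if "i \<in> insert k V" for i
    using insert.prems(3)[OF that] insert.hyps by simp
  have B0: "(\<Sum>j\<in>V. of_int (B i j) * x j) = 0" if "i \<in> V" for i
  proof -
    have "(\<Sum>j\<in>V. of_int (B i j) * x j) = of_int (A k k) * (\<Sum>j\<in>V. of_int (A i j) * x j)
        - of_int (A i k) * (\<Sum>j\<in>V. of_int (A k j) * x j)"
      by (simp add: B_def sum_distrib_left sum_subtractf algebra_simps)
    also have "\<dots> = of_int (A k k) * (- of_int (A i k) * x k)
        - of_int (A i k) * (- of_int (A k k) * x k)"
    proof -
      have "(\<Sum>j\<in>V. of_int (A i j) * x j) = - of_int (A i k) * x k"
        using rel[of i] that by (simp add: eq_neg_iff_add_eq_0 add.commute)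
      moreover have "(\<Sum>j\<in>V. of_int (A k j) * x j) = - of_int (A k k) * x k"
        using rel[of k] by (simp add: eq_neg_iff_add_eq_0 add.commute)
      ultimately show ?thesis by simp
    qed
    finally show ?thesis by (simp add: mult_ac)
  qed
  have kk: "q dvd A k k - 1" using insert.prems(2)[of k k] by simp
  have Bq: "q dvd B i j - (if i = j then 1 else 0)" if ij: "i \<in> V" "j \<in> V" for i j
  proof -
    have "q dvd A i j - (if i = j then 1 else 0)" using insert.prems(2)[of i j] ij by auto
    moreover have "q dvd A i k" using insert.prems(2)[of i k] ij insert.hyps by (cases "i = k") auto
    moreover have "B i j - (if i = j then 1 else 0)
      = (A k k - 1) * A i j + (A i j - (if i = j then 1 else 0)) - A i k * A k j"
      by (simp add: B_def algebra_simps)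
    ultimately show ?thesis using kk by (metis dvd_add dvd_diff dvd_mult2)
  qed
  have V0: "x i = 0" if "i \<in> V" for i
    using insert.IH[OF insert.prems(1) Bq B0 that] by simp
  moreover have "x k = 0"
  proof -
    have "of_int (A k k) * x k = 0" using rel[of k] V0 by simp
    moreover have "A k k \<noteq> 0"
    proof
      assume "A k k = 0"
      then have "q dvd - 1" using kk by simp
      then show False using insert.prems(1) by simp
    qed
    ultimately show ?thesis by simp
  qed
  ultimately show ?case using insert.prems by auto
qed simp

text \<open>Let \<open>x = p/q\<close> in lowest terms preserve the group \<open>M\<close>. Then \<open>pM \<subseteq> qM\<close>, so \<open>M = qM\<close> by Bezout,
  and Nakayama's lemma leaves only \<open>q = 1\<close>.\<close>
lemma integral_rational_is_int:
  assumes "integral_elt x" "x \<in> \<rat>"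
  shows "x \<in> \<int>"
proof -
  obtain r where r: "x = of_rat r" using assms(2) by (auto elim: Rats_cases)
  obtain p q where pq: "quotient_of r = (p, q)" by force
  have q: "q > 0" and cop: "coprime p q" and rr: "r = of_int p / of_int q"
    using quotient_of_denom_pos[OF pq] quotient_of_coprime[OF pq] quotient_of_div[OF pq] by auto
  have xq: "of_int q * x = of_int p" using q by (simp add: r rr of_rat_divide)
  obtain V v where V: "finite V" "v \<in> V" "v \<noteq> 0" "stabilizes x V"
    using assms(1) unfolding integral_elt_def by blast
  have "\<exists>a. x * w = (\<Sum>u\<in>V. of_int (a u) * u)" if "w \<in> V" for w
    using V that unfolding stabilizes_def int_mod.span_finite[OF V(1)] by auto
  then obtain a where a: "\<And>w. w \<in> V \<Longrightarrow> x * w = (\<Sum>u\<in>V. of_int (a w u) * u)" by metis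
  obtain s t where "s * p + t * q = gcd p q" using bezout_int by blast
  then have st: "s * p + t * q = 1" using coprime_imp_gcd_eq_1[OF cop] by simp
  define A where "A w u = (if w = u then 1 else 0) - q * (s * a w u + t * (if w = u then 1 else 0))" for w u
  have "(\<Sum>u\<in>V. of_int (A w u) * u) = 0" if w: "w \<in> V" for w
  proof -
    have "of_int (A w u) * u = (if w = u then u else 0) - of_int (q * s) * (of_int (a w u) * u)
        - of_int (q * t) * (if w = u then u else 0)" for u :: complex
    proof (cases "w = u")
      case True
      then have "A w u = 1 - q * (s * a w u + t)" by (simp add: A_def)
      then have "of_int (A w u) = (1 - of_int (q * s) * of_int (a w u) - of_int (q * t) :: complex)"
        by (simp only: of_int_diff of_int_mult of_int_add of_int_1 distrib_left mult.assoc diff_diff_eq)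
      then have "of_int (A w u) * u = u - of_int (q * s) * (of_int (a w u) * u) - of_int (q * t) * u"
        by (simp only: left_diff_distrib mult_1_left mult.assoc)
      then show ?thesis by (simp only: True if_True simp_thms)
    next
      case False
      then have "A w u = - q * (s * a w u)" by (simp add: A_def)
      then have "of_int (A w u) = (- (of_int (q * s) * of_int (a w u)) :: complex)"
        by (simp only: of_int_mult of_int_minus mult.assoc mult_minus_left)
      then have "of_int (A w u) * u = - (of_int (q * s) * (of_int (a w u) * u))"
        by (simp only: mult_minus_left mult.assoc)
      then show ?thesis using False
        by (simp only: if_False mult_zero_right diff_zero diff_0)
    qed
    then have "(\<Sum>u\<in>V. of_int (A w u) * u)
      = (\<Sum>u\<in>V. if w = u then u else 0) - of_int (q * s) * (\<Sum>u\<in>V. of_int (a w u) * u)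
         - of_int (q * t) * (\<Sum>u\<in>V. if w = u then u else 0)"
      by (simp only: sum_subtractf sum_distrib_left)
    also have "\<dots> = w - of_int (q * s) * (x * w) - of_int (q * t) * w"
      using w V(1) by (simp only: a[OF w] sum.delta' if_True)
    also have "\<dots> = w - of_int s * (of_int q * x) * w - of_int q * of_int t * w"
      by (simp add: mult_ac)
    also have "\<dots> = w - of_int (s * p + t * q) * w" unfolding xq by (simp add: algebra_simps)
    finally show ?thesis by (simp add: st)
  qed
  then have ker: "\<And>w. w \<in> V \<Longrightarrow> (\<Sum>u\<in>V. of_int (A w u) * u) = 0" .
  have cong: "q dvd A w u - (if w = u then 1 else 0)" for w u by (simp add: A_def)
  have "q dvd 1"
  proof (rule ccontr)
    assume "\<not> q dvd 1"
    from kernel_trivial_of_cong_identity[OF V(1) this cong ker V(2)] V(3) show False by simp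
  qed
  then have "q = 1" using q by auto
  then show ?thesis using xq by simp
qed

section \<open>Algebraic numbers form a field\<close>

text \<open>The numbers \<open>x^i v\<close> lie in a rational vector space of finite dimension, so they satisfy a
  linear relation, from which \<open>v\<close> cancels.\<close>
lemma algebraic_of_finite_dim:
  assumes "finite V" "v \<in> V" "v \<noteq> 0" "\<And>w. w \<in> V \<Longrightarrow> x * w \<in> rat_vs.span V"
  shows "algebraic (x :: complex)"
proof (cases "inj_on (\<lambda>i. x ^ i * v) {..card V}")
  case False
  then obtain i j where ij: "i < j" "x ^ i = x ^ j"
    using assms(3) unfolding inj_on_def by (metis linorder_neqE_nat mult_right_cancel)
  show ?thesis
  proof (rule algebraicI')
    show "coeff (monom 1 j - monom 1 i) k \<in> \<rat>" for k :: nat by simp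
    have "coeff (monom 1 j - monom 1 i :: complex poly) j = 1" using ij by simp
    then show "monom 1 j - monom 1 i \<noteq> (0 :: complex poly)" by (metis coeff_0 zero_neq_one)
    show "poly (monom 1 j - monom 1 i) x = 0" using ij by (simp add: poly_monom)
  qed
next
  case True
  have stab: "x * y \<in> rat_vs.span V" if "y \<in> rat_vs.span V" for y
    using that
  proof (induction rule: rat_vs.span_induct_alt)
    case base
    then show ?case by (simp add: rat_vs.span_zero)
  next
    case (step c w y)
    have "of_rat c * (x * w) + x * y \<in> rat_vs.span V"
      using assms(4) step by (intro rat_vs.span_add rat_vs.span_scale) auto
    then show ?case by (simp add: algebra_simps)
  qed
  have pw: "x ^ i * v \<in> rat_vs.span V" for i
    using assms(2) by (induction i) (auto intro: rat_vs.span_base stab simp: mult.assoc)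
  let ?B = "(\<lambda>i. x ^ i * v) ` {..card V}"
  have "card ?B = Suc (card V)" using True by (simp add: card_image)
  moreover have "?B \<subseteq> rat_vs.span V" using pw by auto
  ultimately have "rat_vs.dependent ?B"
    using rat_vs.independent_span_bound[of V ?B] assms(1) by auto
  then obtain u b where u: "(\<Sum>b\<in>?B. of_rat (u b) * b) = 0" "b \<in> ?B" "u b \<noteq> 0"
    using rat_vs.dependent_finite[of ?B] by auto
  obtain k where k: "k \<le> card V" "u (x ^ k * v) \<noteq> 0" using u by auto
  define p where "p = (\<Sum>i\<le>card V. monom (of_rat (u (x ^ i * v)) :: complex) i)"
  have cf: "coeff p i = (if i \<le> card V then of_rat (u (x ^ i * v)) else 0)" for i
    unfolding p_def by (simp add: coeff_sum)
  show ?thesis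
  proof (rule algebraicI')
    show "coeff p i \<in> \<rat>" for i by (simp add: cf)
    show "p \<noteq> 0" using k cf[of k] by auto
    have "0 = (\<Sum>i\<le>card V. of_rat (u (x ^ i * v)) * (x ^ i * v))"
      using u(1) by (subst (asm) sum.reindex[OF True]) simp
    also have "\<dots> = poly p x * v"
      by (simp add: p_def poly_sum poly_monom sum_distrib_right mult.assoc)
    finally show "poly p x = 0" using assms(3) by simp
  qed
qed

lemma int_span_subset_rat_span: "int_mod.span V \<subseteq> rat_vs.span V"
proof
  fix x assume "x \<in> int_mod.span V"
  then show "x \<in> rat_vs.span V"
  proof (induction rule: int_mod.span_induct_alt)
    case base
    then show ?case by (simp add: rat_vs.span_zero)
  next
    case (step c v y)
    have "of_rat (of_int c) * v + y \<in> rat_vs.span V"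
      using step rat_vs.span_base by (intro rat_vs.span_add rat_vs.span_scale) blast+
    then show ?case by simp
  qed
qed

lemma integral_imp_algebraic: "integral_elt x \<Longrightarrow> algebraic x"
  using int_span_subset_rat_span algebraic_of_finite_dim
  unfolding integral_elt_def stabilizes_def by blast

end

lemma algebraic_integral_multiple:
  assumes "algebraic (x::complex)"
  obtains k :: int where "k \<noteq> 0" "integral_elt (of_int k * x)"
proof -
  obtain p where p: "p \<noteq> 0" "poly (map_poly of_int p) x = 0" using algebraicE'[OF assms] by blast
  have "integral_elt (lead_coeff (map_poly of_int p) * x)"
    by (rule integral_lead_coeff_times_root) (use p in \<open>auto simp: coeff_map_poly\<close>)
  with p(1) show ?thesis by (intro that[of "lead_coeff p"]) (auto simp: coeff_map_poly degree_map_poly)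
qed

lemma algebraic_cancel_of_int:
  assumes "algebraic (of_int k * x :: complex)" "k \<noteq> 0"
  shows "algebraic x"
proof -
  obtain p where p: "p \<noteq> 0" "poly (map_poly of_int p) (of_int k * x) = 0"
    using algebraicE'[OF assms(1)] by blast
  let ?P = "map_poly of_int p :: complex poly"
  define Q where "Q = (\<Sum>i\<le>degree p. monom (of_int (coeff p i * k ^ i)) i :: complex poly)"
  have coeff_Q: "coeff Q j = of_int (coeff p j * k ^ j)" for j
  proof -
    have "coeff Q j = (\<Sum>i\<le>degree p. if i = j then of_int (coeff p i * k ^ i) else 0)"
      unfolding Q_def coeff_sum coeff_monom ..
    also have "\<dots> = of_int (coeff p j * k ^ j)"
      using coeff_eq_0[of p j] by (subst sum.delta) auto
    finally show ?thesis .
  qed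
  have "Q \<noteq> 0"
    using coeff_Q[of "degree p"] assms(2) p(1) by auto
  moreover have "poly Q x = poly ?P (of_int k * x)"
    unfolding poly_altdef[of ?P] Q_def
    by (simp add: poly_sum poly_monom degree_map_poly coeff_map_poly power_mult_distrib mult_ac)
  ultimately show ?thesis using p(2) by (intro algebraicI[of Q]) (auto simp: coeff_Q)
qed

lemma algebraic_plus:
  assumes "algebraic (x::complex)" "algebraic y"
  shows "algebraic (x + y)"
proof -
  obtain k l where k: "k \<noteq> 0" "integral_elt (of_int k * x)" and l: "l \<noteq> 0" "integral_elt (of_int l * y)"
    using algebraic_integral_multiple[OF assms(1)] algebraic_integral_multiple[OF assms(2)] by metis
  have "integral_elt (of_int l * (of_int k * x) + of_int k * (of_int l * y))"
    by (rule integral_add; rule integral_mult; (rule integral_of_int k l)?)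
  then have "algebraic (of_int (k * l) * (x + y))"
    by (intro integral_imp_algebraic) (simp add: algebra_simps)
  then show ?thesis using k l algebraic_cancel_of_int[of "k * l"] by simp
qed

lemma algebraic_times:
  assumes "algebraic (x::complex)" "algebraic y"
  shows "algebraic (x * y)"
proof -
  obtain k l where k: "k \<noteq> 0" "integral_elt (of_int k * x)" and l: "l \<noteq> 0" "integral_elt (of_int l * y)"
    using algebraic_integral_multiple[OF assms(1)] algebraic_integral_multiple[OF assms(2)] by metis
  have "integral_elt ((of_int k * x) * (of_int l * y))" using k(2) l(2) by (rule integral_mult)
  then have "algebraic (of_int (k * l) * (x * y))"
    by (intro integral_imp_algebraic) (simp add: algebra_simps)
  then show ?thesis using k l algebraic_cancel_of_int[of "k * l"] by simp
qed

section \<open>Minimal polynomials and conjugates\<close>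

abbreviation cpoly :: "int poly \<Rightarrow> complex poly" where "cpoly p \<equiv> map_poly of_int p"

lemma coeff_cpoly [simp]: "coeff (cpoly p) i = of_int (coeff p i)" by (simp add: coeff_map_poly)

lemma degree_cpoly [simp]: "degree (cpoly p) = degree p" by (simp add: degree_map_poly)

lemma cpoly_eq_0_iff [simp]: "cpoly p = 0 \<longleftrightarrow> p = 0" by (simp add: poly_eq_iff)

lemma cpoly_add: "cpoly (p + q) = cpoly p + cpoly q" by (simp add: poly_eq_iff)
lemma cpoly_diff: "cpoly (p - q) = cpoly p - cpoly q" by (simp add: poly_eq_iff)
lemma cpoly_minus: "cpoly (- p) = - cpoly p" by (simp add: poly_eq_iff)
lemma cpoly_smult: "cpoly (smult c p) = smult (of_int c) (cpoly p)" by (simp add: poly_eq_iff)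
lemma cpoly_mult: "cpoly (p * q) = cpoly p * cpoly q" by (simp add: poly_eq_iff coeff_mult)
lemma cpoly_1: "cpoly 1 = 1" by (simp add: poly_eq_iff)
lemma cpoly_power: "cpoly (p ^ n) = cpoly p ^ n" by (induction n) (simp_all add: cpoly_mult cpoly_1)
lemma cpoly_pderiv: "cpoly (pderiv p) = pderiv (cpoly p)" by (simp add: poly_eq_iff coeff_pderiv)

text \<open>Cross-multiplication by the leading coefficients produces a difference of smaller degree
  that still vanishes at \<open>x\<close>, hence is zero. Content and sign determine the remaining
  factor.\<close>
lemma min_int_poly_unique:
  assumes "is_min_int_poly x p" "is_min_int_poly x q"
  shows "p = q"
proof -
  have p: "p \<noteq> 0" "poly (cpoly p) x = 0" "content p = 1" "lead_coeff p > 0"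
    and q: "q \<noteq> 0" "poly (cpoly q) x = 0" "content q = 1" "lead_coeff q > 0"
    and minp: "\<And>r. r \<noteq> 0 \<Longrightarrow> poly (cpoly r) x = 0 \<Longrightarrow> degree p \<le> degree r"
    and deg: "degree p = degree q"
    using assms unfolding is_min_int_poly_def by (auto intro: antisym)
  define r where "r = smult (lead_coeff q) p - smult (lead_coeff p) q"
  have root: "poly (cpoly r) x = 0" using p q by (simp add: r_def cpoly_diff cpoly_smult)
  have "degree r \<le> degree p" unfolding r_def
    by (intro degree_diff_le order_trans[OF degree_smult_le]) (auto simp: deg)
  moreover have "coeff r (degree p) = 0" by (simp add: r_def deg)
  ultimately have "r = 0 \<or> degree r < degree p"
    by (metis leading_coeff_0_iff le_neq_implies_less)
  then have "r = 0" using minp root by fastforce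
  then have eq: "smult (lead_coeff q) p = smult (lead_coeff p) q" by (simp add: r_def)
  then have "content (smult (lead_coeff q) p) = content (smult (lead_coeff p) q)" by simp
  then have "lead_coeff q = lead_coeff p" using p q by simp
  then show ?thesis using eq p by (metis smult_cancel less_irrefl)
qed

lemma min_int_poly_exists:
  assumes "algebraic x" shows "\<exists>p. is_min_int_poly x p"
proof -
  obtain p0 where "p0 \<noteq> 0 \<and> poly (cpoly p0) x = 0" using algebraicE'[OF assms] by blast
  then obtain q where q: "q \<noteq> 0" "poly (cpoly q) x = 0"
    and min: "\<And>r. r \<noteq> 0 \<Longrightarrow> poly (cpoly r) x = 0 \<Longrightarrow> degree q \<le> degree r"
    using ex_has_least_nat[of "\<lambda>p. p \<noteq> 0 \<and> poly (cpoly p) x = 0" p0 degree] by blast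
  define u where "u = primitive_part q"
  have qu: "q = smult (content q) u" by (simp add: u_def)
  have "of_int (content q) * poly (cpoly u) x = 0"
    using q(2) by (subst (asm) qu) (simp add: cpoly_smult)
  then have u: "u \<noteq> 0" "poly (cpoly u) x = 0" "content u = 1" "degree u = degree q"
    using q(1) by (auto simp: u_def)
  define p where "p = (if lead_coeff u > 0 then u else - u)"
  have "content (- u) = 1" using u(3) content_smult[of "-1" u] by simp
  have "lead_coeff u \<noteq> 0" using u(1) by (simp only: leading_coeff_0_iff not_False_eq_True)
  then have "lead_coeff p > 0" unfolding p_def by (auto simp: not_less less_le)
  moreover have "p \<noteq> 0" "poly (cpoly p) x = 0" "content p = 1" "degree p = degree q"
    using u \<open>content (- u) = 1\<close> by (auto simp: p_def cpoly_minus)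
  ultimately have "is_min_int_poly x p" unfolding is_min_int_poly_def using min by auto
  then show ?thesis ..
qed

lemma min_int_poly_is_min:
  assumes "algebraic x" shows "is_min_int_poly x (min_int_poly x)"
  unfolding min_int_poly_def
  by (rule theI') (use min_int_poly_exists[OF assms] min_int_poly_unique in blast)

lemma min_int_poly_eqI: "is_min_int_poly x p \<Longrightarrow> min_int_poly x = p"
  unfolding min_int_poly_def by (rule the_equality) (auto intro: min_int_poly_unique)

lemma
  assumes "algebraic x"
  shows min_int_poly_nonzero: "min_int_poly x \<noteq> 0"
    and min_int_poly_root: "poly (cpoly (min_int_poly x)) x = 0"
    and min_int_poly_content: "content (min_int_poly x) = 1"
    and min_int_poly_lead_pos: "lead_coeff (min_int_poly x) > 0"
    and min_int_poly_minimal: "\<And>q. q \<noteq> 0 \<Longrightarrow> poly (cpoly q) x = 0 \<Longrightarrow> alg_degree x \<le> degree q"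
  using min_int_poly_is_min[OF assms] unfolding is_min_int_poly_def alg_degree_def by auto

text \<open>Pseudo-division and minimality give divisibility up to an integer factor. By Gauss's lemma
  this factor cancels, because the minimal polynomial is primitive.\<close>
lemma min_int_poly_dvd:
  assumes "algebraic x" "poly (cpoly q) x = 0"
  shows "min_int_poly x dvd q"
proof -
  define p where "p = min_int_poly x"
  have p: "p \<noteq> 0" "poly (cpoly p) x = 0" "content p = 1"
    using min_int_poly_nonzero min_int_poly_root min_int_poly_content assms(1) by (auto simp: p_def)
  obtain a u where a: "a \<noteq> 0" and eq: "smult a q = p * u + pseudo_mod q p"
    using pseudo_mod(1)[OF p(1), of q] by blast
  define r where "r = pseudo_mod q p"
  have "r = smult a q - p * u" using eq by (simp add: r_def)
  then have "poly (cpoly r) x = 0"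
    using p assms(2) by (simp add: cpoly_diff cpoly_smult cpoly_mult)
  then have "r = 0"
    using pseudo_mod(2)[OF p(1), of q] min_int_poly_minimal[OF assms(1), of r]
    unfolding r_def[symmetric] alg_degree_def p_def[symmetric] by linarith
  then have eq': "smult a q = p * u" using eq by (simp add: r_def)
  then have "content (smult a q) = content (p * u)" by simp
  then have "content u = \<bar>a\<bar> * content q" using p(3) by (simp add: content_mult)
  then have "a dvd content u" by simp
  then obtain u' where "u = [:a:] * u'" using const_poly_dvd_iff_dvd_content[of a u] by (auto elim: dvdE)
  then have "smult a q = smult a (p * u')" using eq' by simp
  then have "q = p * u'" using a by (simp add: smult_cancel)
  then show ?thesis by (simp add: p_def)
qed

lemma alg_degree_pos:
  assumes "algebraic x" shows "alg_degree x > 0"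
proof (rule ccontr)
  assume "\<not> 0 < alg_degree x"
  then obtain c where c: "min_int_poly x = [:c:]" unfolding alg_degree_def by (auto elim: degree_eq_zeroE)
  then have "cpoly (min_int_poly x) = [:of_int c:]" by (simp add: map_poly_pCons)
  then show False using min_int_poly_root[OF assms] min_int_poly_nonzero[OF assms] c by simp
qed

definition conjugates :: "complex \<Rightarrow> complex set" where
  "conjugates x = {y. poly (cpoly (min_int_poly x)) y = 0}"

lemma conjugates_self: "algebraic x \<Longrightarrow> x \<in> conjugates x"
  by (simp add: conjugates_def min_int_poly_root)

lemma finite_conjugates: "algebraic x \<Longrightarrow> finite (conjugates x)"
  unfolding conjugates_def using min_int_poly_nonzero by (intro poly_roots_finite) auto

lemma conjugates_algebraic: "algebraic x \<Longrightarrow> y \<in> conjugates x \<Longrightarrow> algebraic y"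
  unfolding conjugates_def using min_int_poly_nonzero[of x]
  by (intro algebraicI[of "cpoly (min_int_poly x)"]) auto

text \<open>This is irreducibility: the minimal polynomial of \<open>y\<close> divides that of \<open>x\<close>, and \<open>x\<close> must be a
  root of that divisor, since the cofactor has too small a degree.\<close>
lemma min_int_poly_conjugate:
  assumes "algebraic x" "y \<in> conjugates x"
  shows "min_int_poly y = min_int_poly x"
proof -
  define p where "p = min_int_poly x"
  have y: "algebraic y" using conjugates_algebraic assms by blast
  have py: "poly (cpoly p) y = 0" using assms(2) by (simp add: conjugates_def p_def)
  have p: "p \<noteq> 0" "poly (cpoly p) x = 0" "content p = 1" "lead_coeff p > 0"
    using assms(1) min_int_poly_nonzero min_int_poly_root min_int_poly_content min_int_poly_lead_pos
    by (auto simp: p_def)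
  obtain v where v: "p = min_int_poly y * v" using min_int_poly_dvd[OF y py] by (auto elim: dvdE)
  have nz: "min_int_poly y \<noteq> 0" "v \<noteq> 0" using v p(1) by auto
  have degp: "degree p = alg_degree y + degree v" using v nz by (simp add: degree_mult_eq alg_degree_def)
  have minp: "\<And>r. r \<noteq> 0 \<Longrightarrow> poly (cpoly r) x = 0 \<Longrightarrow> degree p \<le> degree r"
    using min_int_poly_minimal[OF assms(1)] by (simp add: alg_degree_def p_def)
  have "poly (cpoly (min_int_poly y)) x = 0 \<or> poly (cpoly v) x = 0"
    using p(2) by (subst (asm) v) (simp add: cpoly_mult)
  then have "degree p \<le> alg_degree y"
  proof
    assume "poly (cpoly (min_int_poly y)) x = 0"
    then show ?thesis using minp nz by (simp add: alg_degree_def)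
  next
    assume "poly (cpoly v) x = 0"
    then have "degree p \<le> degree v" using minp nz by simp
    then show ?thesis using degp alg_degree_pos[OF y] by simp
  qed
  then have "is_min_int_poly y p"
    unfolding is_min_int_poly_def
  proof (intro conjI allI impI)
    fix q assume q: "q \<noteq> 0 \<and> poly (cpoly q) y = 0"
    have "alg_degree y \<le> degree q" using min_int_poly_minimal[OF y] q by blast
    then show "degree p \<le> degree q" using \<open>degree p \<le> alg_degree y\<close> by (rule order_trans[rotated])
  qed (use p py in auto)
  then show ?thesis using min_int_poly_eqI p_def by simp
qed

lemma conjugates_conjugate:
  "algebraic x \<Longrightarrow> y \<in> conjugates x \<Longrightarrow> conjugates y = conjugates x"
  unfolding conjugates_def[of y] conjugates_def[of x]
  by (subst min_int_poly_conjugate[of x y]) (simp_all add: conjugates_def)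

text \<open>A multiple root would be a root of the derivative, which contradicts minimality at that
  conjugate.\<close>
lemma rsquarefree_min_int_poly:
  assumes "algebraic x"
  shows "rsquarefree (cpoly (min_int_poly x))"
  unfolding rsquarefree_roots
proof (intro allI notI, elim conjE)
  fix y assume y: "poly (cpoly (min_int_poly x)) y = 0" "poly (pderiv (cpoly (min_int_poly x))) y = 0"
  then have yc: "y \<in> conjugates x" by (simp add: conjugates_def)
  have ya: "algebraic y" using conjugates_algebraic assms yc by blast
  have eq: "min_int_poly y = min_int_poly x" using min_int_poly_conjugate assms yc by blast
  have d: "degree (min_int_poly x) > 0" using alg_degree_pos[OF assms] by (simp add: alg_degree_def)
  then have "pderiv (min_int_poly x) \<noteq> 0" by (simp add: pderiv_eq_0_iff)
  moreover have "poly (cpoly (pderiv (min_int_poly x))) y = 0" using y by (simp add: cpoly_pderiv)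
  ultimately have "degree (min_int_poly x) \<le> degree (pderiv (min_int_poly x))"
    using min_int_poly_minimal[OF ya] by (simp add: alg_degree_def eq)
  then show False using d by (simp add: degree_pderiv)
qed

lemma proots_min_int_poly:
  assumes "algebraic x"
  shows "proots (cpoly (min_int_poly x)) = mset_set (conjugates x)"
proof (rule multiset_eqI)
  fix y
  have nz: "cpoly (min_int_poly x) \<noteq> 0" using min_int_poly_nonzero[OF assms] by simp
  show "count (proots (cpoly (min_int_poly x))) y = count (mset_set (conjugates x)) y"
  proof (cases "y \<in> conjugates x")
    case True
    then have "order y (cpoly (min_int_poly x)) = 1"
      using rsquarefree_min_int_poly[OF assms] nz order_root[of "cpoly (min_int_poly x)" y]
      unfolding rsquarefree_def conjugates_def by (metis One_nat_def mem_Collect_eq)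
    then show ?thesis using True nz finite_conjugates[OF assms] by simp
  next
    case False
    then show ?thesis using nz order_root[of "cpoly (min_int_poly x)" y]
      by (simp add: conjugates_def)
  qed
qed

lemma card_conjugates:
  assumes "algebraic x" shows "card (conjugates x) = alg_degree x"
  using size_proots_complex[of "cpoly (min_int_poly x)"] proots_min_int_poly[OF assms]
  by (simp add: alg_degree_def)

lemma min_int_poly_factorization:
  assumes "algebraic x"
  shows "cpoly (min_int_poly x)
    = smult (of_int (lead_coeff (min_int_poly x))) (\<Prod>y\<in>conjugates x. [:- y, 1:])"
proof -
  have "smult (lead_coeff (cpoly (min_int_poly x))) (\<Prod>y\<in>#proots (cpoly (min_int_poly x)). [:- y, 1:])
    = cpoly (min_int_poly x)" by (rule complex_poly_decompose_multiset)
  then show ?thesis unfolding proots_min_int_poly[OF assms] by (simp add: prod_unfold_prod_mset)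
qed

text \<open>By separability the multiset of roots may be replaced by the set of conjugates.\<close>
lemma weil_height_eq:
  assumes "algebraic x"
  shows "real (alg_degree x) * weil_height x
    = ln (real_of_int (lead_coeff (min_int_poly x))) + (\<Sum>y\<in>conjugates x. log_plus (cmod y))"
  using alg_degree_pos[OF assms] min_int_poly_lead_pos[OF assms]
  unfolding weil_height_def proots_min_int_poly[OF assms] by (simp add: sum_unfold_sum_mset)

section \<open>Extension of embeddings\<close>

lemma rational_poly_clear_denominators:
  fixes F :: "complex poly"
  assumes "\<And>i. coeff F i \<in> \<rat>"
  shows "\<exists>k q. k \<noteq> 0 \<and> smult (of_int k) F = cpoly q"
  using assms
proof (induction F rule: pCons_induct)
  case 0
  show ?case by (intro exI[of _ 1] exI[of _ 0]) simp
next
  case (pCons a F)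
  have "coeff F i \<in> \<rat>" for i using pCons.prems[of "Suc i"] by simp
  then obtain k q where kq: "k \<noteq> 0" "smult (of_int k) F = cpoly q" using pCons.IH by blast
  have "a \<in> \<rat>" using pCons.prems[of 0] by simp
  then obtain m n :: int where mn: "n \<noteq> 0" "a = of_int m / of_int n"
    by (metis Rats_cases' less_irrefl)
  have na: "of_int n * a = (of_int m :: complex)" using mn by simp
  have "of_int (k * n) * a = (of_int (k * m) :: complex)" by (simp only: of_int_mult mult.assoc na)
  then have "smult (of_int (k * n)) (pCons a F) = pCons (of_int (k * m)) (smult (of_int n) (smult (of_int k) F))"
    by (simp only: smult_pCons smult_smult of_int_mult mult.commute[of "of_int n :: complex"])
  also have "\<dots> = cpoly (pCons (k * m) (smult n q))"
    by (simp only: kq(2) map_poly_pCons cpoly_smult of_int_0)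
  finally show ?case using kq mn by (intro exI[of _ "k * n"]) auto
qed

text \<open>Graphs of homomorphisms between rational algebras of algebraic numbers. Graphs make unions
  of chains trivial in Zorn's lemma. Single-valuedness only has to be required at \<open>0\<close>, and
  closure under inverses is automatic, since the inverse of an algebraic number is a
  rational polynomial in it.\<close>
definition partial_embedding :: "(complex \<times> complex) set \<Rightarrow> bool" where
  "partial_embedding R \<longleftrightarrow>
     (\<forall>x y. (x, y) \<in> R \<longrightarrow> algebraic x \<and> algebraic y) \<and>
     (\<forall>q\<in>\<rat>. (q, q) \<in> R) \<and>
     (\<forall>x y x' y'. (x, y) \<in> R \<and> (x', y') \<in> R \<longrightarrow> (x + x', y + y') \<in> R \<and> (x * x', y * y') \<in> R) \<and>
     (\<forall>y. (0, y) \<in> R \<longrightarrow> y = 0)"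

lemma
  assumes "partial_embedding R"
  shows pe_algebraic1: "(x, y) \<in> R \<Longrightarrow> algebraic x"
    and pe_algebraic2: "(x, y) \<in> R \<Longrightarrow> algebraic y"
    and pe_rat: "q \<in> \<rat> \<Longrightarrow> (q, q) \<in> R"
    and pe_add: "(x, y) \<in> R \<Longrightarrow> (x', y') \<in> R \<Longrightarrow> (x + x', y + y') \<in> R"
    and pe_mult: "(x, y) \<in> R \<Longrightarrow> (x', y') \<in> R \<Longrightarrow> (x * x', y * y') \<in> R"
    and pe_zero: "(0, y) \<in> R \<Longrightarrow> y = 0"
  using assms unfolding partial_embedding_def by blast+

lemma pe_zero_pair: "partial_embedding R \<Longrightarrow> (0, 0) \<in> R"
  by (rule pe_rat) auto

lemma pe_minus: "partial_embedding R \<Longrightarrow> (x, y) \<in> R \<Longrightarrow> (- x, - y) \<in> R"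
  using pe_mult[of R "-1" "-1" x y] pe_rat[of R "-1"] by simp

lemma pe_diff: "partial_embedding R \<Longrightarrow> (x, y) \<in> R \<Longrightarrow> (x', y') \<in> R \<Longrightarrow> (x - x', y - y') \<in> R"
  using pe_add[of R x y "- x'" "- y'"] pe_minus by simp

lemma pe_functional: "partial_embedding R \<Longrightarrow> (x, y) \<in> R \<Longrightarrow> (x, y') \<in> R \<Longrightarrow> y = y'"
  using pe_diff[of R x y x y'] pe_zero[of R "y - y'"] by simp

lemma pe_sum:
  assumes "partial_embedding R" "\<And>i. i \<in> A \<Longrightarrow> (f i, g i) \<in> R"
  shows "(sum f A, sum g A) \<in> R"
  using assms by (induction A rule: infinite_finite_induct) (auto intro: pe_add pe_zero_pair)

text \<open>A polynomial over the domain of the embedding together with its image.\<close>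
definition poly_pair :: "(complex \<times> complex) set \<Rightarrow> complex poly \<Rightarrow> complex poly \<Rightarrow> bool" where
  "poly_pair R F G \<longleftrightarrow> (\<forall>i. (coeff F i, coeff G i) \<in> R)"

lemma poly_pair_cpoly: "partial_embedding R \<Longrightarrow> poly_pair R (cpoly p) (cpoly p)"
  unfolding poly_pair_def by (auto intro: pe_rat)

lemma poly_pair_add: "partial_embedding R \<Longrightarrow> poly_pair R F G \<Longrightarrow> poly_pair R F' G' \<Longrightarrow> poly_pair R (F + F') (G + G')"
  unfolding poly_pair_def by (auto intro: pe_add)

lemma poly_pair_diff: "partial_embedding R \<Longrightarrow> poly_pair R F G \<Longrightarrow> poly_pair R F' G' \<Longrightarrow> poly_pair R (F - F') (G - G')"
  unfolding poly_pair_def by (auto intro: pe_diff)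

lemma poly_pair_mult: "partial_embedding R \<Longrightarrow> poly_pair R F G \<Longrightarrow> poly_pair R F' G' \<Longrightarrow> poly_pair R (F * F') (G * G')"
  unfolding poly_pair_def by (auto simp: coeff_mult intro!: pe_sum pe_mult)

lemma poly_pair_monom: "partial_embedding R \<Longrightarrow> (c, c') \<in> R \<Longrightarrow> poly_pair R (monom c k) (monom c' k)"
  unfolding poly_pair_def by (auto intro: pe_zero_pair)

lemma pe_power: "partial_embedding R \<Longrightarrow> (x, y) \<in> R \<Longrightarrow> (x ^ n, y ^ n) \<in> R"
  by (induction n) (auto intro: pe_rat pe_mult)

lemma pe_poly:
  assumes R: "partial_embedding R" "(x, y) \<in> R"
  shows "(poly (cpoly p) x, poly (cpoly p) y) \<in> R"
  unfolding poly_altdef using R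
  by (auto intro!: pe_sum[OF R(1)] pe_mult[OF R(1)] pe_power pe_rat)

text \<open>An annihilating polynomial of \<open>x \<noteq> 0\<close> can be chosen with nonzero constant coefficient;
  solving it for \<open>1/x\<close> expresses the inverse as a polynomial in \<open>x\<close>.\<close>
lemma pe_inverse:
  assumes R: "partial_embedding R" and xy: "(x, y) \<in> R" and "x \<noteq> 0"
  obtains z where "(1 / x, z) \<in> R"
proof -
  have "algebraic x" using pe_algebraic1[OF R xy] .
  then obtain p where p: "poly (cpoly p) x = 0" "coeff p 0 \<noteq> 0" 
    using algebraicE'_nonzero[OF _ assms(3)] by metis
  obtain c q where q: "p = pCons c q" by (cases p) auto
  have c: "c \<noteq> 0" using p q by simp
  have "of_int c + x * poly (cpoly q) x = 0" using p by (simp add: q map_poly_pCons)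
  then have "1 / x = (- 1 / of_int c) * poly (cpoly q) x"
    using c assms(3) by (simp add: field_simps add_eq_0_iff)
  moreover have "((- 1 / of_int c) * poly (cpoly q) x, (- 1 / of_int c) * poly (cpoly q) y) \<in> R"
    using R xy by (intro pe_mult pe_poly pe_rat) auto
  ultimately show ?thesis using that by metis
qed

lemma pe_nonzero:
  assumes R: "partial_embedding R" and xy: "(x, y) \<in> R" and "x \<noteq> 0"
  shows "y \<noteq> 0"
proof -
  obtain z where "(1 / x, z) \<in> R" using pe_inverse[OF assms] .
  then have "(1 / x * x, z * y) \<in> R" using pe_mult R xy by blast
  moreover have "(1, 1) \<in> R" using pe_rat[OF R] by simp
  ultimately have "z * y = 1" using pe_functional[OF R] assms(3) by simp
  then show ?thesis by auto
qed

definition adjoin_pair :: "(complex \<times> complex) set \<Rightarrow> complex \<Rightarrow> complex \<Rightarrow> (complex \<times> complex) set" where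
  "adjoin_pair R x y = {(poly F x, poly G y) | F G. poly_pair R F G}"

lemma algebraic_sum: "(\<And>i. i \<in> A \<Longrightarrow> algebraic (f i :: complex)) \<Longrightarrow> algebraic (sum f A)"
  by (induction A rule: infinite_finite_induct) (auto intro: algebraic_plus)

lemma algebraic_prod: "(\<And>i. i \<in> A \<Longrightarrow> algebraic (f i :: complex)) \<Longrightarrow> algebraic (prod f A)"
  by (induction A rule: infinite_finite_induct) (auto intro: algebraic_times)

lemma algebraic_power: "algebraic (x::complex) \<Longrightarrow> algebraic (x ^ n)"
  by (induction n) (auto intro: algebraic_times)

text \<open>Sending \<open>x\<close> to \<open>y\<close> extends an embedding as soon as it is well defined, that is, as soon as
  every polynomial relation of \<open>x\<close> over the domain is carried to one of \<open>y\<close>.\<close>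
lemma partial_embedding_adjoin:
  assumes R: "partial_embedding R" and "algebraic x" "algebraic y"
    and comp: "\<And>F G. poly_pair R F G \<Longrightarrow> poly F x = 0 \<Longrightarrow> poly G y = 0"
  shows "partial_embedding (adjoin_pair R x y)" "R \<subseteq> adjoin_pair R x y" "(x, y) \<in> adjoin_pair R x y"
proof -
  show sub: "R \<subseteq> adjoin_pair R x y"
  proof clarify
    fix a b assume ab: "(a, b) \<in> R"
    have "poly (monom a 0) x = a" "poly (monom b 0) y = b" by (simp_all add: poly_monom)
    then show "(a, b) \<in> adjoin_pair R x y"
      unfolding adjoin_pair_def using poly_pair_monom[OF R ab, of 0]
      by (intro CollectI exI[of _ "monom a 0"] exI[of _ "monom b 0"]) simp
  qed
  have "poly (monom 1 1) x = x" "poly (monom 1 1) y = y" by (simp_all add: poly_monom)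
  then show "(x, y) \<in> adjoin_pair R x y"
    unfolding adjoin_pair_def using poly_pair_monom[OF R pe_rat[OF R, of 1], of 1]
    by (intro CollectI exI[of _ "monom 1 1"]) simp
  show "partial_embedding (adjoin_pair R x y)"
    unfolding partial_embedding_def
  proof (intro conjI allI ballI impI)
    fix a b assume "(a, b) \<in> adjoin_pair R x y"
    then obtain F G where FG: "a = poly F x" "b = poly G y" "poly_pair R F G"
      unfolding adjoin_pair_def by blast
    show "algebraic a" unfolding FG poly_altdef using FG(3) pe_algebraic1[OF R] assms(2)
      unfolding poly_pair_def by (intro algebraic_sum algebraic_times algebraic_power) auto
    show "algebraic b" unfolding FG poly_altdef using FG(3) pe_algebraic2[OF R] assms(3)
      unfolding poly_pair_def by (intro algebraic_sum algebraic_times algebraic_power) auto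
  next
    fix q :: complex assume "q \<in> \<rat>"
    then show "(q, q) \<in> adjoin_pair R x y" using pe_rat[OF R] sub by blast
  next
    fix a b a' b' assume "(a, b) \<in> adjoin_pair R x y \<and> (a', b') \<in> adjoin_pair R x y"
    then obtain F G F' G' where FG: "a = poly F x" "b = poly G y" "poly_pair R F G"
      "a' = poly F' x" "b' = poly G' y" "poly_pair R F' G'"
      unfolding adjoin_pair_def by blast
    show "(a + a', b + b') \<in> adjoin_pair R x y"
      unfolding adjoin_pair_def FG using poly_pair_add[OF R FG(3,6)] poly_add by (metis (mono_tags, lifting) mem_Collect_eq)
    show "(a * a', b * b') \<in> adjoin_pair R x y"
      unfolding adjoin_pair_def FG using poly_pair_mult[OF R FG(3,6)] poly_mult by (metis (mono_tags, lifting) mem_Collect_eq)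
  next
    fix b assume "(0, b) \<in> adjoin_pair R x y"
    then obtain F G where FG: "0 = poly F x" "b = poly G y" "poly_pair R F G"
      unfolding adjoin_pair_def by blast
    then show "b = 0" using comp[of F G] by simp
  qed
qed

text \<open>Let \<open>f\<close> be a polynomial of least degree over the domain that vanishes at \<open>x\<close>, and let \<open>y\<close> be
  any root of its image \<open>g\<close>. Repeated subtraction of multiples of \<open>f\<close> reduces every relation
  of \<open>x\<close> to \<open>0\<close>, and the same steps on the image side transfer it to \<open>y\<close>.\<close>
lemma compatible_root_exists:
  assumes R: "partial_embedding R" and x: "algebraic x"
  obtains y where "algebraic y" "\<And>F G. poly_pair R F G \<Longrightarrow> poly F x = 0 \<Longrightarrow> poly G y = 0"
proof -
  obtain p0 where p0: "p0 \<noteq> 0" "poly (cpoly p0) x = 0" using algebraicE'[OF x] by blast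
  let ?P = "\<lambda>(F, G). F \<noteq> 0 \<and> poly F x = 0 \<and> poly_pair R F G"
  have "?P (cpoly p0, cpoly p0)" using p0 poly_pair_cpoly[OF R] by simp
  then obtain fg where "?P fg" and "\<And>z. ?P z \<Longrightarrow> degree (fst fg) \<le> degree (fst z)"
    using ex_has_least_nat[of ?P _ "\<lambda>z. degree (fst z)"] by blast
  then obtain f g where f: "f \<noteq> 0" "poly f x = 0" and fg: "poly_pair R f g"
    and min: "\<And>F G. F \<noteq> 0 \<Longrightarrow> poly F x = 0 \<Longrightarrow> poly_pair R F G \<Longrightarrow> degree f \<le> degree F"
    by (cases fg) fastforce
  define m where "m = degree f"
  have lc: "(coeff f m, coeff g m) \<in> R" "coeff f m \<noteq> 0" using fg f by (auto simp: poly_pair_def m_def)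
  have gm: "coeff g m \<noteq> 0" using pe_nonzero[OF R lc] .
  have mpos: "m > 0"
  proof (rule ccontr)
    assume "\<not> m > 0"
    then obtain c where "f = [:c:]" unfolding m_def by (auto elim: degree_eq_zeroE)
    then show False using f by simp
  qed
  have "degree g \<ge> m" using gm by (rule le_degree)
  then have "\<not> constant (poly g)" using mpos by (simp add: constant_degree)
  then obtain y where y: "poly g y = 0" using fundamental_theorem_of_algebra by blast
  have comp: "poly G y = 0" if "poly_pair R F G" "poly F x = 0" for F G
  proof -
    have "poly_pair R F G \<Longrightarrow> \<forall>i\<ge>n. coeff F i = 0 \<Longrightarrow> poly F x = 0 \<Longrightarrow> poly G y = 0" for n
    proof (induction n arbitrary: F G)
      case 0
      then have "(0, coeff G i) \<in> R" for i using 0 unfolding poly_pair_def by (metis le0)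
      then have "G = 0" using pe_zero[OF R] by (simp add: poly_eq_iff)
      then show ?case by simp
    next
      case (Suc n)
      show ?case
      proof (cases "coeff F n = 0")
        case True
        then have "\<forall>i\<ge>n. coeff F i = 0" using Suc.prems(2) by (metis Suc_leI le_neq_implies_less)
        then show ?thesis using Suc by blast
      next
        case False
        have degF: "degree F = n"
          using Suc.prems(2) False by (intro antisym degree_le le_degree) auto
        have "F \<noteq> 0" using False by auto
        then have mn: "m \<le> n" using min[of F G] Suc.prems degF by (simp add: m_def)
        obtain z where z: "(1 / coeff f m, z) \<in> R" using pe_inverse[OF R lc] .
        define c c' where "c = coeff F n * (1 / coeff f m)" and "c' = coeff G n * z"
        have cc: "(c, c') \<in> R" unfolding c_def c'_def using Suc.prems(1) z
          by (intro pe_mult[OF R]) (auto simp: poly_pair_def)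
        define F' G' where "F' = F - monom c (n - m) * f" and "G' = G - monom c' (n - m) * g"
        have "poly_pair R F' G'" unfolding F'_def G'_def
          by (intro poly_pair_diff poly_pair_mult poly_pair_monom R cc fg Suc.prems(1))
        moreover have "\<forall>i\<ge>n. coeff F' i = 0"
        proof (intro allI impI)
          fix i assume i: "i \<ge> n"
          show "coeff F' i = 0"
          proof (cases "i = n")
            case True
            then show ?thesis using mn lc(2) by (simp add: F'_def coeff_monom_mult c_def)
          next
            case False
            then have "coeff F i = 0" "coeff f (i - (n - m)) = 0"
              using i mn Suc.prems(2) by (auto intro!: coeff_eq_0 simp: m_def[symmetric])
            then show ?thesis by (simp add: F'_def coeff_monom_mult)
          qed
        qed
        moreover have "poly F' x = 0" using Suc.prems(3) f by (simp add: F'_def)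
        ultimately have "poly G' y = 0" using Suc.IH by blast
        then show ?thesis using y by (simp add: G'_def)
      qed
    qed
    from this[of "Suc (degree F)"] that show ?thesis by (simp add: coeff_eq_0)
  qed
  have "poly (cpoly p0) y = 0" using comp[OF poly_pair_cpoly[OF R] p0(2)] .
  then have "algebraic y" using p0(1) by (intro algebraicI[of "cpoly p0"]) auto
  with comp show ?thesis using that by blast
qed

section \<open>The absolute Galois group\<close>

text \<open>Conjugate numbers satisfy the same integer polynomials, so \<open>x \<mapsto> y\<close> is a partial embedding. A
  maximal extension of it is defined on all algebraic numbers, since otherwise another
  number could be adjoined, and it is surjective because it permutes each finite set of
  conjugates.\<close>
lemma galois_transitive:
  assumes x: "algebraic x" and y: "y \<in> conjugates x"
  obtains \<sigma> where "\<sigma> \<in> abs_galois" "\<sigma> x = y"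
proof -
  define R0 :: "(complex \<times> complex) set" where "R0 = {(q, q) | q. q \<in> \<rat>}"
  have R0: "partial_embedding R0"
    unfolding partial_embedding_def R0_def by (auto intro: rat_imp_algebraic)
  have ya: "algebraic y" using conjugates_algebraic x y by blast
  have comp0: "poly G y = 0" if FG: "poly_pair R0 F G" "poly F x = 0" for F G
  proof -
    have "F = G" "\<And>i. coeff F i \<in> \<rat>" using FG(1) unfolding poly_pair_def R0_def by (auto simp: poly_eq_iff)
    then obtain k q where k: "k \<noteq> 0" "smult (of_int k) F = cpoly q"
      using rational_poly_clear_denominators by blast
    have "poly (cpoly q) x = 0" using FG(2) by (simp flip: k(2))
    then obtain v where "q = min_int_poly x * v" using min_int_poly_dvd[OF x] by (auto elim: dvdE)
    then have "poly (cpoly q) y = 0" using y by (simp add: conjugates_def cpoly_mult)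
    then show ?thesis using k(1) \<open>F = G\<close> by (simp flip: k(2))
  qed
  have R1: "partial_embedding (adjoin_pair R0 x y)" "R0 \<subseteq> adjoin_pair R0 x y"
      "(x, y) \<in> adjoin_pair R0 x y"
    by (rule partial_embedding_adjoin[OF R0 x ya], erule (1) comp0)+
  define R1 where "R1 = adjoin_pair R0 x y"
  define \<A> where "\<A> = {R. partial_embedding R \<and> R1 \<subseteq> R}"
  have "\<exists>M\<in>\<A>. \<forall>X\<in>\<A>. M \<subseteq> X \<longrightarrow> X = M"
  proof (rule subset_Zorn_nonempty)
    have "R1 \<in> \<A>" using R1(1) by (simp add: \<A>_def R1_def)
    then show "\<A> \<noteq> {}" by blast
  next
    fix C assume C: "C \<noteq> {}" "subset.chain \<A> C"
    have pe: "partial_embedding R" if "R \<in> C" for R using C(2) that by (auto simp: subset.chain_def \<A>_def)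
    have dir: "\<exists>R\<in>C. a \<in> R \<and> b \<in> R" if "a \<in> \<Union>C" "b \<in> \<Union>C" for a b
      using C(2) that unfolding subset.chain_def by blast
    obtain R' where R': "R' \<in> C" using C(1) by blast
    have "partial_embedding (\<Union>C)"
      unfolding partial_embedding_def
    proof (intro conjI allI ballI impI)
      fix a b assume "(a, b) \<in> \<Union>C"
      then show "algebraic a" "algebraic b" using pe pe_algebraic1 pe_algebraic2 by blast+
    next
      fix q :: complex assume "q \<in> \<rat>"
      then show "(q, q) \<in> \<Union>C" using pe_rat[OF pe[OF R']] R' by blast
    next
      fix a b a' b' assume "(a, b) \<in> \<Union>C \<and> (a', b') \<in> \<Union>C"
      then obtain R where R: "R \<in> C" "(a, b) \<in> R" "(a', b') \<in> R" using dir by meson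
      show "(a + a', b + b') \<in> \<Union>C" using pe_add[OF pe[OF R(1)] R(2,3)] R(1) by blast
      show "(a * a', b * b') \<in> \<Union>C" using pe_mult[OF pe[OF R(1)] R(2,3)] R(1) by blast
    next
      fix b assume "(0, b) \<in> \<Union>C"
      then show "b = 0" using pe pe_zero by blast
    qed
    moreover have "R1 \<subseteq> \<Union>C" using C(2) R' by (auto simp: subset.chain_def \<A>_def)
    ultimately show "\<Union>C \<in> \<A>" by (simp add: \<A>_def)
  qed
  then obtain M where M\<A>: "M \<in> \<A>" and max\<A>: "\<forall>X\<in>\<A>. M \<subseteq> X \<longrightarrow> X = M" ..
  have M: "partial_embedding M" "R1 \<subseteq> M" using M\<A> by (simp_all add: \<A>_def)
  have max: "X = M" if "partial_embedding X" "R1 \<subseteq> X" "M \<subseteq> X" for X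
    using max\<A> that by (simp add: \<A>_def)
  have dom: "\<exists>b. (a, b) \<in> M" if a: "algebraic a" for a
  proof -
    obtain b where b: "algebraic b" "\<And>F G. poly_pair M F G \<Longrightarrow> poly F a = 0 \<Longrightarrow> poly G b = 0"
      using compatible_root_exists[OF M(1) a] by blast
    have E: "partial_embedding (adjoin_pair M a b)" "M \<subseteq> adjoin_pair M a b"
        "(a, b) \<in> adjoin_pair M a b"
      by (rule partial_embedding_adjoin[OF M(1) a b(1)], erule (1) b(2))+
    have "adjoin_pair M a b = M" using max[OF E(1)] E(2) M(2) by blast
    then show ?thesis using E(3) by blast
  qed
  define \<sigma> where "\<sigma> a = (SOME b. (a, b) \<in> M)" for a
  have \<sigma>M: "(a, \<sigma> a) \<in> M" if "algebraic a" for a unfolding \<sigma>_def using dom[OF that] by (rule someI_ex)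
  have \<sigma>_eq: "\<sigma> a = b" if "(a, b) \<in> M" for a b
    using pe_functional[OF M(1) \<sigma>M[OF pe_algebraic1[OF M(1) that]] that] .
  have inj: "inj_on \<sigma> {a. algebraic a}"
  proof (rule inj_onI, clarsimp)
    fix a b assume ab: "algebraic a" "algebraic b" "\<sigma> a = \<sigma> b"
    have "(a - b, \<sigma> a - \<sigma> b) \<in> M" using \<sigma>M ab by (intro pe_diff[OF M(1)])
    then show "a = b" using pe_nonzero[OF M(1), of "a - b" "\<sigma> a - \<sigma> b"] ab(3) by auto
  qed
  have conj: "\<sigma> b \<in> conjugates a" if "algebraic a" "b \<in> conjugates a" for a b
  proof -
    have b: "algebraic b" using conjugates_algebraic that by blast
    have "(0, poly (cpoly (min_int_poly a)) (\<sigma> b)) \<in> M"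
      using pe_poly[OF M(1) \<sigma>M[OF b], of "min_int_poly a"] that(2) by (simp add: conjugates_def)
    then show ?thesis using pe_zero[OF M(1)] by (simp add: conjugates_def)
  qed
  have surj: "\<exists>b. algebraic b \<and> \<sigma> b = a" if a: "algebraic a" for a
  proof -
    have sub: "conjugates a \<subseteq> {a. algebraic a}" using conjugates_algebraic[OF a] by blast
    have "\<sigma> ` conjugates a = conjugates a"
      using conj[OF a] inj_on_subset[OF inj sub] finite_conjugates[OF a]
      by (intro endo_inj_surj) auto
    then show ?thesis using conjugates_self[OF a] sub by (metis (no_types, lifting) imageE mem_Collect_eq subsetD)
  qed
  have "bij_betw \<sigma> {a. algebraic a} {a. algebraic a}"
    unfolding bij_betw_def using inj surj pe_algebraic2[OF M(1) \<sigma>M] by auto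
  moreover have "\<sigma> (a + b) = \<sigma> a + \<sigma> b \<and> \<sigma> (a * b) = \<sigma> a * \<sigma> b" if "algebraic a" "algebraic b" for a b
    using \<sigma>M[OF that(1)] \<sigma>M[OF that(2)] pe_add[OF M(1)] pe_mult[OF M(1)] \<sigma>_eq by blast
  moreover have "\<sigma> q = q" if "q \<in> \<rat>" for q using pe_rat[OF M(1) that] \<sigma>_eq by blast
  ultimately have "\<sigma> \<in> abs_galois" unfolding abs_galois_def by blast
  moreover have "\<sigma> x = y" using R1(3) M(2) \<sigma>_eq unfolding R1_def by blast
  ultimately show ?thesis using that by blast
qed

lemma
  assumes "\<sigma> \<in> abs_galois"
  shows gal_algebraic: "algebraic x \<Longrightarrow> algebraic (\<sigma> x)"
    and gal_add: "algebraic x \<Longrightarrow> algebraic y \<Longrightarrow> \<sigma> (x + y) = \<sigma> x + \<sigma> y"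
    and gal_mult: "algebraic x \<Longrightarrow> algebraic y \<Longrightarrow> \<sigma> (x * y) = \<sigma> x * \<sigma> y"
    and gal_rat: "q \<in> \<rat> \<Longrightarrow> \<sigma> q = q"
    and gal_inj: "algebraic x \<Longrightarrow> algebraic y \<Longrightarrow> \<sigma> x = \<sigma> y \<Longrightarrow> x = y"
  using assms unfolding abs_galois_def bij_betw_def inj_on_def by auto

lemma gal_0: "\<sigma> \<in> abs_galois \<Longrightarrow> \<sigma> 0 = 0" and gal_1: "\<sigma> \<in> abs_galois \<Longrightarrow> \<sigma> 1 = 1"
  by (rule gal_rat; simp)+

lemma gal_nonzero: "\<sigma> \<in> abs_galois \<Longrightarrow> algebraic x \<Longrightarrow> x \<noteq> 0 \<Longrightarrow> \<sigma> x \<noteq> 0"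
  using gal_inj[of \<sigma> x 0] gal_0[of \<sigma>] by auto

lemma gal_power: "\<sigma> \<in> abs_galois \<Longrightarrow> algebraic x \<Longrightarrow> \<sigma> (x ^ n) = \<sigma> x ^ n"
  by (induction n) (auto simp: gal_1 gal_mult algebraic_power)

lemma gal_inverse: 
  assumes "\<sigma> \<in> abs_galois" "algebraic x" shows "\<sigma> (inverse x) = inverse (\<sigma> x)"
proof (cases "x = 0")
  case False
  have "\<sigma> (x * inverse x) = \<sigma> x * \<sigma> (inverse x)"
    using assms by (intro gal_mult algebraic_inverse)
  then show ?thesis using False gal_1[OF assms(1)] by (simp add: inverse_unique)
qed (use gal_0[OF assms(1)] in simp)

lemma gal_diff:
  assumes "\<sigma> \<in> abs_galois" "algebraic x" "algebraic y"
  shows "\<sigma> (x - y) = \<sigma> x - \<sigma> y"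
proof -
  have "\<sigma> (-1 * y) = \<sigma> (-1) * \<sigma> y" using assms by (intro gal_mult) auto
  moreover have "\<sigma> (-1) = -1" using gal_rat[OF assms(1), of "-1"] by simp
  ultimately have "\<sigma> (- y) = - \<sigma> y" by simp
  then show ?thesis using gal_add[OF assms(1,2), of "- y"] assms(3) by simp
qed

lemma gal_sum:
  assumes "\<sigma> \<in> abs_galois" "\<And>i. i \<in> A \<Longrightarrow> algebraic (f i)"
  shows "\<sigma> (sum f A) = (\<Sum>i\<in>A. \<sigma> (f i))"
  using assms(2) by (induction A rule: infinite_finite_induct)
    (auto simp: gal_0[OF assms(1)] gal_add[OF assms(1)] algebraic_sum)

lemma gal_prod:
  assumes "\<sigma> \<in> abs_galois" "\<And>i. i \<in> A \<Longrightarrow> algebraic (f i)"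
  shows "\<sigma> (prod f A) = (\<Prod>i\<in>A. \<sigma> (f i))"
  using assms(2) by (induction A rule: infinite_finite_induct)
    (auto simp: gal_1[OF assms(1)] gal_mult[OF assms(1)] algebraic_prod)

lemma gal_poly:
  assumes "\<sigma> \<in> abs_galois" "algebraic x"
  shows "\<sigma> (poly (cpoly p) x) = poly (cpoly p) (\<sigma> x)"
  unfolding poly_altdef using assms
  by (subst gal_sum)
     (auto simp: gal_mult gal_power gal_rat algebraic_times algebraic_power intro!: algebraic_times)

lemma gal_conjugates:
  assumes "\<sigma> \<in> abs_galois" "algebraic x" "y \<in> conjugates x"
  shows "\<sigma> y \<in> conjugates x"
  using gal_poly[OF assms(1) conjugates_algebraic[OF assms(2,3)], of "min_int_poly x"] assms(3)
    gal_0[OF assms(1)] by (simp add: conjugates_def)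

lemma gal_conjugates_bij:
  assumes "\<sigma> \<in> abs_galois" "algebraic x"
  shows "bij_betw \<sigma> (conjugates x) (conjugates x)"
proof -
  have inj: "inj_on \<sigma> (conjugates x)"
    using gal_inj[OF assms(1)] conjugates_algebraic[OF assms(2)] by (auto intro!: inj_onI)
  moreover have "\<sigma> ` conjugates x \<subseteq> conjugates x" using gal_conjugates[OF assms] by blast
  ultimately show ?thesis using endo_inj_surj[OF finite_conjugates[OF assms(2)]]
    by (simp add: bij_betw_def)
qed

lemma gal_comp:
  assumes "\<sigma> \<in> abs_galois" "\<tau> \<in> abs_galois" shows "\<tau> \<circ> \<sigma> \<in> abs_galois"
proof -
  have "bij_betw (\<tau> \<circ> \<sigma>) {x. algebraic x} {x. algebraic x}"
    using assms unfolding abs_galois_def by (auto intro: bij_betw_trans)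
  then show ?thesis unfolding abs_galois_def
    using assms by (auto simp: gal_add gal_mult gal_rat gal_algebraic)
qed

lemma id_abs_galois: "id \<in> abs_galois"
  unfolding abs_galois_def by auto

text \<open>By transitivity a fixed number is its only conjugate, so its degree is one.\<close>
lemma fixed_field_rational:
  assumes "algebraic x" "\<And>\<sigma>. \<sigma> \<in> abs_galois \<Longrightarrow> \<sigma> x = x"
  shows "x \<in> \<rat>"
proof -
  have "conjugates x = {x}"
    using galois_transitive[OF assms(1)] assms conjugates_self by blast
  then have d: "degree (min_int_poly x) = 1"
    using card_conjugates[OF assms(1)] by (simp add: alg_degree_def)
  obtain c0 c1 where c: "min_int_poly x = [:c0, c1:]" "c1 \<noteq> 0"
  proof -
    obtain c0 q where q: "min_int_poly x = pCons c0 q" by (cases "min_int_poly x") auto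
    then have "degree q = 0" using d by (simp split: if_splits)
    then obtain c1 where "q = [:c1:]" by (auto elim: degree_eq_zeroE)
    then show ?thesis using q d that[of c0 c1] by (auto split: if_splits)
  qed
  then have "of_int c0 + of_int c1 * x = 0"
    using min_int_poly_root[OF assms(1)] by (simp add: map_poly_pCons mult.commute)
  then have "x = - of_int c0 / of_int c1" using c(2) by (simp add: field_simps add_eq_0_iff)
  then show ?thesis by simp
qed

section \<open>Galois orbits of points of the torus\<close>

definition gal_act :: "(complex \<Rightarrow> complex) \<Rightarrow> complex ^ 'n \<Rightarrow> complex ^ 'n" where
  "gal_act \<sigma> \<xi> = (\<chi> j. \<sigma> (\<xi> $ j))"

lemma gal_act_nth [simp]: "gal_act \<sigma> \<xi> $ j = \<sigma> (\<xi> $ j)" by (simp add: gal_act_def)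

lemma galois_orbit_eq: "galois_orbit \<xi> = (\<lambda>\<sigma>. gal_act \<sigma> \<xi>) ` abs_galois"
  by (simp add: galois_orbit_def gal_act_def)

lemma alg_torusD: "\<xi> \<in> alg_torus \<Longrightarrow> algebraic (\<xi> $ j)" "\<xi> \<in> alg_torus \<Longrightarrow> \<xi> $ j \<noteq> 0"
  by (simp_all add: alg_torus_def)

lemma galois_orbit_self: "\<xi> \<in> galois_orbit \<xi>"
  unfolding galois_orbit_eq using id_abs_galois by (intro image_eqI[of _ _ id]) (auto simp: vec_eq_iff)

lemma galois_orbit_alg_torus: "\<xi> \<in> alg_torus \<Longrightarrow> \<alpha> \<in> galois_orbit \<xi> \<Longrightarrow> \<alpha> \<in> alg_torus"
  unfolding galois_orbit_eq alg_torus_def by (auto simp: gal_algebraic gal_nonzero)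

lemma galois_orbit_conjugates: "\<xi> \<in> alg_torus \<Longrightarrow> \<alpha> \<in> galois_orbit \<xi> \<Longrightarrow> \<alpha> $ j \<in> conjugates (\<xi> $ j)"
  unfolding galois_orbit_eq using gal_conjugates[OF _ alg_torusD(1) conjugates_self[OF alg_torusD(1)]]
  by (metis (no_types, lifting) gal_act_nth imageE)

lemma finite_galois_orbit:
  assumes "\<xi> \<in> alg_torus" shows "finite (galois_orbit \<xi>)"
proof (rule finite_subset)
  show "galois_orbit \<xi> \<subseteq> (\<lambda>f. \<chi> j. f j) ` (\<Pi>\<^sub>E j\<in>UNIV. conjugates (\<xi> $ j))"
  proof
    fix \<alpha> assume "\<alpha> \<in> galois_orbit \<xi>"
    then show "\<alpha> \<in> (\<lambda>f. \<chi> j. f j) ` (\<Pi>\<^sub>E j\<in>UNIV. conjugates (\<xi> $ j))"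
      using galois_orbit_conjugates[OF assms] by (intro image_eqI[of _ _ "\<lambda>j. \<alpha> $ j"]) auto
  qed
  show "finite ((\<lambda>f. \<chi> j. f j) ` (\<Pi>\<^sub>E j\<in>UNIV. conjugates (\<xi> $ j)))"
    using assms by (intro finite_imageI finite_PiE finite_conjugates) (auto simp: alg_torusD)
qed

lemma card_galois_orbit_pos: "\<xi> \<in> alg_torus \<Longrightarrow> card (galois_orbit \<xi>) > 0"
  using finite_galois_orbit galois_orbit_self by (auto simp: card_gt_0_iff)

lemma gal_act_galois_orbit:
  "\<tau> \<in> abs_galois \<Longrightarrow> \<alpha> \<in> galois_orbit \<xi> \<Longrightarrow> gal_act \<tau> \<alpha> \<in> galois_orbit \<xi>"
proof -
  assume \<tau>: "\<tau> \<in> abs_galois" and "\<alpha> \<in> galois_orbit \<xi>"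
  then obtain \<sigma> where \<sigma>: "\<sigma> \<in> abs_galois" "\<alpha> = gal_act \<sigma> \<xi>" unfolding galois_orbit_eq by blast
  then have "gal_act \<tau> \<alpha> = gal_act (\<tau> \<circ> \<sigma>) \<xi>" by (simp add: gal_act_def)
  then show ?thesis unfolding galois_orbit_eq using gal_comp[OF \<sigma>(1) \<tau>] by blast
qed

lemma algebraic_powi: "algebraic (x::complex) \<Longrightarrow> algebraic (x powi k)"
  unfolding power_int_def by (auto intro: algebraic_power)

lemma gal_powi: "\<sigma> \<in> abs_galois \<Longrightarrow> algebraic x \<Longrightarrow> \<sigma> (x powi k) = \<sigma> x powi k"
  unfolding power_int_def by (auto simp: gal_power gal_inverse algebraic_inverse)

lemma monomial_char_algebraic: "\<xi> \<in> alg_torus \<Longrightarrow> algebraic (monomial_char n \<xi>)"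
  unfolding monomial_char_def by (intro algebraic_prod algebraic_powi alg_torusD)

lemma monomial_char_nonzero: "\<xi> \<in> alg_torus \<Longrightarrow> monomial_char n \<xi> \<noteq> 0"
  unfolding monomial_char_def by (simp add: alg_torusD power_int_eq_0_iff)

lemma monomial_char_gal_act:
  "\<sigma> \<in> abs_galois \<Longrightarrow> \<xi> \<in> alg_torus \<Longrightarrow> monomial_char n (gal_act \<sigma> \<xi>) = \<sigma> (monomial_char n \<xi>)"
  unfolding monomial_char_def
  by (subst gal_prod) (auto simp: gal_powi alg_torusD algebraic_powi)

lemma monomial_char_axis: "monomial_char (axis j 1) \<xi> = \<xi> $ j"
proof -
  have "monomial_char (axis j 1) \<xi> = (\<Prod>i\<in>UNIV. if i = j then \<xi> $ j else 1)"
    unfolding monomial_char_def by (intro prod.cong refl) (auto simp: axis_def)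
  then show ?thesis by simp
qed

text \<open>The number of points of the orbit over a single conjugate of the character value; it does
  not depend on the conjugate.\<close>
definition fibre_size :: "complex ^ 'n \<Rightarrow> int ^ 'n \<Rightarrow> nat" where
  "fibre_size \<xi> n = card (galois_orbit \<xi>) div alg_degree (monomial_char n \<xi>)"

text \<open>An automorphism that moves one conjugate to another maps the fibre over the first
  injectively into the fibre over the second, so all fibres have the same size. This turns
  sums over the orbit into sums over conjugates.\<close>
lemma
  fixes \<xi> :: "complex ^ 'n" and n :: "int ^ 'n"
  assumes \<xi>: "\<xi> \<in> alg_torus"
  defines "\<eta> \<equiv> monomial_char n \<xi>"
  shows monomial_char_orbit: "monomial_char n ` galois_orbit \<xi> = conjugates \<eta>"
    and card_orbit_fibre: "\<And>\<beta>. \<beta> \<in> conjugates \<eta> \<Longrightarrow>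
        card {\<alpha> \<in> galois_orbit \<xi>. monomial_char n \<alpha> = \<beta>} = fibre_size \<xi> n"
    and card_orbit_eq: "card (galois_orbit \<xi>) = fibre_size \<xi> n * alg_degree \<eta>"
proof -
  let ?S = "galois_orbit \<xi>"
  have fin: "finite ?S" using finite_galois_orbit[OF \<xi>] .
  have \<eta>: "algebraic \<eta>" unfolding \<eta>_def using monomial_char_algebraic[OF \<xi>] .
  show img: "monomial_char n ` ?S = conjugates \<eta>"
  proof
    show "monomial_char n ` ?S \<subseteq> conjugates \<eta>"
      unfolding galois_orbit_eq using monomial_char_gal_act[OF _ \<xi>] gal_conjugates[OF _ \<eta> conjugates_self[OF \<eta>]]
      by (auto simp: \<eta>_def)
    show "conjugates \<eta> \<subseteq> monomial_char n ` ?S"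
    proof
      fix \<beta> assume "\<beta> \<in> conjugates \<eta>"
      then obtain \<sigma> where "\<sigma> \<in> abs_galois" "\<sigma> \<eta> = \<beta>" using galois_transitive[OF \<eta>] by blast
      then show "\<beta> \<in> monomial_char n ` ?S"
        unfolding galois_orbit_eq image_image using monomial_char_gal_act[OF _ \<xi>, of \<sigma> n]
        by (intro image_eqI[of _ _ \<sigma>]) (simp_all add: \<eta>_def)
    qed
  qed
  define fib where "fib \<beta> = {\<alpha> \<in> ?S. monomial_char n \<alpha> = \<beta>}" for \<beta>
  have finfib: "finite (fib \<beta>)" for \<beta> using fin by (simp add: fib_def)
  have le: "card (fib \<beta>) \<le> card (fib \<beta>')" if "\<beta> \<in> conjugates \<eta>" "\<beta>' \<in> conjugates \<eta>" for \<beta> \<beta>'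
  proof -
    have \<beta>: "algebraic \<beta>" using conjugates_algebraic[OF \<eta> that(1)] .
    have "\<beta>' \<in> conjugates \<beta>" using conjugates_conjugate[OF \<eta> that(1)] that(2) by simp
    then obtain \<tau> where \<tau>: "\<tau> \<in> abs_galois" "\<tau> \<beta> = \<beta>'" using galois_transitive[OF \<beta>] by blast
    show ?thesis
    proof (rule card_inj_on_le[of "gal_act \<tau>"])
      show "inj_on (gal_act \<tau>) (fib \<beta>)"
      proof (rule inj_onI)
        fix a b assume ab: "a \<in> fib \<beta>" "b \<in> fib \<beta>" "gal_act \<tau> a = gal_act \<tau> b"
        then have "a \<in> alg_torus" "b \<in> alg_torus" using galois_orbit_alg_torus[OF \<xi>] by (auto simp: fib_def)
        moreover have "\<tau> (a $ j) = \<tau> (b $ j)" for j using ab(3) by (metis gal_act_nth)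
        ultimately show "a = b" using gal_inj[OF \<tau>(1)] alg_torusD by (metis vec_eq_iff)
      qed
      show "gal_act \<tau> ` fib \<beta> \<subseteq> fib \<beta>'"
      proof
        fix b assume "b \<in> gal_act \<tau> ` fib \<beta>"
        then obtain a where a: "b = gal_act \<tau> a" "a \<in> ?S" "monomial_char n a = \<beta>" by (auto simp: fib_def)
        have "monomial_char n b = \<tau> (monomial_char n a)"
          unfolding a(1) by (rule monomial_char_gal_act[OF \<tau>(1) galois_orbit_alg_torus[OF \<xi> a(2)]])
        then show "b \<in> fib \<beta>'"
          using gal_act_galois_orbit[OF \<tau>(1) a(2)] a \<tau>(2) by (simp add: fib_def)
      qed
    qed (rule finfib)
  qed
  then have eq: "card (fib \<beta>) = card (fib \<eta>)" if "\<beta> \<in> conjugates \<eta>" for \<beta>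
    using that conjugates_self[OF \<eta>] by (simp add: le_antisym)
  have "card ?S = (\<Sum>\<beta>\<in>monomial_char n ` ?S. card (fib \<beta>))"
    using sum.image_gen[OF fin, of "\<lambda>_. 1::nat" "monomial_char n"] by (simp add: fib_def)
  also have "\<dots> = card (conjugates \<eta>) * card (fib \<eta>)" unfolding img by (simp add: eq)
  finally have c: "card ?S = alg_degree \<eta> * card (fib \<eta>)" by (simp add: card_conjugates[OF \<eta>])
  then have "fibre_size \<xi> n = card (fib \<eta>)"
    using alg_degree_pos[OF \<eta>] by (simp add: fibre_size_def \<eta>_def)
  then show "card {\<alpha> \<in> ?S. monomial_char n \<alpha> = \<beta>} = fibre_size \<xi> n" if "\<beta> \<in> conjugates \<eta>" for \<beta>
    using eq[OF that] by (simp add: fib_def)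
  show "card ?S = fibre_size \<xi> n * alg_degree \<eta>"
    using c \<open>fibre_size \<xi> n = card (fib \<eta>)\<close> by simp
qed

lemma sum_over_orbit:
  fixes g :: "complex \<Rightarrow> 'b :: semiring_1"
  assumes "\<xi> \<in> alg_torus"
  shows "(\<Sum>\<alpha>\<in>galois_orbit \<xi>. g (monomial_char n \<alpha>))
    = of_nat (fibre_size \<xi> n) * (\<Sum>\<beta>\<in>conjugates (monomial_char n \<xi>). g \<beta>)"
proof -
  have "(\<Sum>\<alpha>\<in>galois_orbit \<xi>. g (monomial_char n \<alpha>))
    = (\<Sum>\<beta>\<in>monomial_char n ` galois_orbit \<xi>. \<Sum>\<alpha>\<in>{\<alpha> \<in> galois_orbit \<xi>. monomial_char n \<alpha> = \<beta>}. g (monomial_char n \<alpha>))"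
    by (rule sum.image_gen[OF finite_galois_orbit[OF assms]])
  also have "\<dots> = (\<Sum>\<beta>\<in>conjugates (monomial_char n \<xi>). of_nat (fibre_size \<xi> n) * g \<beta>)"
    unfolding monomial_char_orbit[OF assms]
  proof (rule sum.cong[OF refl])
    fix \<beta> assume \<beta>: "\<beta> \<in> conjugates (monomial_char n \<xi>)"
    have "(\<Sum>\<alpha>\<in>{\<alpha> \<in> galois_orbit \<xi>. monomial_char n \<alpha> = \<beta>}. g (monomial_char n \<alpha>))
      = (\<Sum>\<alpha>\<in>{\<alpha> \<in> galois_orbit \<xi>. monomial_char n \<alpha> = \<beta>}. g \<beta>)"
      by (intro sum.cong) auto
    then show "(\<Sum>\<alpha>\<in>{\<alpha> \<in> galois_orbit \<xi>. monomial_char n \<alpha> = \<beta>}. g (monomial_char n \<alpha>))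
      = of_nat (fibre_size \<xi> n) * g \<beta>"
      using card_orbit_fibre[OF assms \<beta>] by simp
  qed
  finally show ?thesis by (simp add: sum_distrib_left)
qed

lemma prod_over_orbit:
  fixes g :: "complex \<Rightarrow> 'b :: comm_semiring_1"
  assumes "\<xi> \<in> alg_torus"
  shows "(\<Prod>\<alpha>\<in>galois_orbit \<xi>. g (monomial_char n \<alpha>))
    = (\<Prod>\<beta>\<in>conjugates (monomial_char n \<xi>). g \<beta>) ^ fibre_size \<xi> n"
proof -
  have "(\<Prod>\<alpha>\<in>galois_orbit \<xi>. g (monomial_char n \<alpha>))
    = (\<Prod>\<beta>\<in>monomial_char n ` galois_orbit \<xi>. \<Prod>\<alpha>\<in>{\<alpha> \<in> galois_orbit \<xi>. monomial_char n \<alpha> = \<beta>}. g (monomial_char n \<alpha>))"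
    by (rule prod.image_gen[OF finite_galois_orbit[OF assms]])
  also have "\<dots> = (\<Prod>\<beta>\<in>conjugates (monomial_char n \<xi>). g \<beta> ^ fibre_size \<xi> n)"
    unfolding monomial_char_orbit[OF assms]
  proof (rule prod.cong[OF refl])
    fix \<beta> assume \<beta>: "\<beta> \<in> conjugates (monomial_char n \<xi>)"
    have "(\<Prod>\<alpha>\<in>{\<alpha> \<in> galois_orbit \<xi>. monomial_char n \<alpha> = \<beta>}. g (monomial_char n \<alpha>))
      = (\<Prod>\<alpha>\<in>{\<alpha> \<in> galois_orbit \<xi>. monomial_char n \<alpha> = \<beta>}. g \<beta>)"
      by (intro prod.cong) auto
    then show "(\<Prod>\<alpha>\<in>{\<alpha> \<in> galois_orbit \<xi>. monomial_char n \<alpha> = \<beta>}. g (monomial_char n \<alpha>))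
      = g \<beta> ^ fibre_size \<xi> n"
      using card_orbit_fibre[OF assms \<beta>] by simp
  qed
  finally show ?thesis by (simp add: prod_power_distrib)
qed

section \<open>Heights\<close>

lemma min_int_poly_const_coeff:
  assumes "algebraic x" "x \<noteq> 0" shows "coeff (min_int_poly x) 0 \<noteq> 0"
proof
  assume z: "coeff (min_int_poly x) 0 = 0"
  obtain c q where q: "min_int_poly x = pCons c q" by (cases "min_int_poly x") auto
  then have q0: "min_int_poly x = pCons 0 q" using z by simp
  then have "q \<noteq> 0" "poly (cpoly q) x = 0"
    using min_int_poly_nonzero[OF assms(1)] min_int_poly_root[OF assms(1)] assms(2)
    by (auto simp: map_poly_pCons)
  then have "degree (min_int_poly x) \<le> degree q"
    using min_int_poly_minimal[OF assms(1)] by (simp add: alg_degree_def)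
  then show False using q0 \<open>q \<noteq> 0\<close> by simp
qed

lemma conjugates_nonzero:
  assumes "algebraic x" "x \<noteq> 0" "y \<in> conjugates x" shows "y \<noteq> 0"
  using min_int_poly_const_coeff[OF assms(1,2)] assms(3)
  by (auto simp: conjugates_def poly_0_coeff_0)

lemma const_coeff_eq_prod:
  assumes "algebraic x"
  shows "complex_of_int (coeff (min_int_poly x) 0)
    = of_int (lead_coeff (min_int_poly x)) * (\<Prod>y\<in>conjugates x. - y)"
proof -
  have "poly (cpoly (min_int_poly x)) 0 = of_int (lead_coeff (min_int_poly x)) * (\<Prod>y\<in>conjugates x. - y)"
    by (subst min_int_poly_factorization[OF assms]) (simp add: poly_prod)
  then show ?thesis by (simp add: poly_0_coeff_0)
qed

lemma log_plus_inverse: "t > 0 \<Longrightarrow> log_plus (inverse t) = log_plus t - ln t"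
  unfolding log_plus_def by (simp add: ln_inverse)

lemma log_plus_nonneg: "log_plus t \<ge> 0" by (simp add: log_plus_def)

text \<open>Up to sign, the constant coefficient is the leading coefficient of the minimal polynomial of
  \<open>1/x\<close>; the formula expresses \<open>h(1/x) = h(x)\<close>.\<close>
lemma weil_height_eq_const_coeff:
  assumes "algebraic x" "x \<noteq> 0"
  shows "real (alg_degree x) * weil_height x
    = ln \<bar>real_of_int (coeff (min_int_poly x) 0)\<bar> + (\<Sum>y\<in>conjugates x. log_plus (inverse (cmod y)))"
proof -
  have nz: "y \<in> conjugates x \<Longrightarrow> cmod y > 0" for y using conjugates_nonzero[OF assms] by simp
  have "\<bar>real_of_int (coeff (min_int_poly x) 0)\<bar> = cmod (of_int (coeff (min_int_poly x) 0))"
    by simp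
  also have "\<dots> = real_of_int (lead_coeff (min_int_poly x)) * (\<Prod>y\<in>conjugates x. cmod y)"
    unfolding const_coeff_eq_prod[OF assms(1)] norm_mult
    using min_int_poly_lead_pos[OF assms(1)] by (simp add: norm_mult flip: prod_norm)
  finally have "ln \<bar>real_of_int (coeff (min_int_poly x) 0)\<bar>
      = ln (real_of_int (lead_coeff (min_int_poly x))) + (\<Sum>y\<in>conjugates x. ln (cmod y))"
    using min_int_poly_lead_pos[OF assms(1)] nz finite_conjugates[OF assms(1)]
    by (simp only: ln_mult_pos prod_pos of_int_0_less_iff) (subst ln_prod, auto)
  moreover have "(\<Sum>y\<in>conjugates x. log_plus (inverse (cmod y)))
    = (\<Sum>y\<in>conjugates x. log_plus (cmod y)) - (\<Sum>y\<in>conjugates x. ln (cmod y))"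
    unfolding sum_subtractf[symmetric] by (intro sum.cong refl log_plus_inverse nz)
  ultimately show ?thesis using weil_height_eq[OF assms(1)] by simp
qed

lemma ln_abs_int_nonneg: "k \<noteq> 0 \<Longrightarrow> ln \<bar>real_of_int k\<bar> \<ge> 0"
  by (rule ln_ge_zero) linarith

lemma weil_height_nonneg: "algebraic x \<Longrightarrow> weil_height x \<ge> 0"
proof -
  assume x: "algebraic x"
  have "0 \<le> ln (real_of_int (lead_coeff (min_int_poly x))) + (\<Sum>y\<in>conjugates x. log_plus (cmod y))"
    using min_int_poly_lead_pos[OF x]
    by (intro add_nonneg_nonneg sum_nonneg log_plus_nonneg ln_ge_zero) linarith
  then have "0 \<le> real (alg_degree x) * weil_height x" unfolding weil_height_eq[OF x] .
  then show ?thesis using alg_degree_pos[OF x] by (simp add: zero_le_mult_iff)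
qed

text \<open>\<open>|log t|\<close> is the sum of \<open>log^+ t\<close> and \<open>log^+ (1/t)\<close>, and by the two formulas for the height
  each of them contributes at most \<open>d h(x)\<close>.\<close>
lemma sum_abs_ln_conjugates_le:
  assumes "algebraic x" "x \<noteq> 0"
  shows "(\<Sum>y\<in>conjugates x. \<bar>ln (cmod y)\<bar>) \<le> 2 * (real (alg_degree x) * weil_height x)"
proof -
  have "(\<Sum>y\<in>conjugates x. \<bar>ln (cmod y)\<bar>)
    = (\<Sum>y\<in>conjugates x. log_plus (cmod y)) + (\<Sum>y\<in>conjugates x. log_plus (inverse (cmod y)))"
    unfolding sum.distrib[symmetric]
    by (intro sum.cong refl) (use conjugates_nonzero[OF assms] in \<open>auto simp: log_plus_def ln_inverse\<close>)
  moreover have "ln \<bar>real_of_int (coeff (min_int_poly x) 0)\<bar> \<ge> 0"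
    using min_int_poly_const_coeff[OF assms] by (rule ln_abs_int_nonneg)
  moreover have "ln (real_of_int (lead_coeff (min_int_poly x))) \<ge> 0"
    using min_int_poly_lead_pos[OF assms(1)] by (intro ln_ge_zero) linarith
  ultimately show ?thesis
    using weil_height_eq[OF assms(1)] weil_height_eq_const_coeff[OF assms] by linarith
qed

text \<open>The product over the orbit is a power of the product over the conjugates.\<close>
lemma smult_prod_orbit:
  fixes \<xi> :: "complex ^ 'n" and n :: "int ^ 'n"
  assumes "\<xi> \<in> alg_torus"
  defines "\<eta> \<equiv> monomial_char n \<xi>"
  shows "smult (of_int (lead_coeff (min_int_poly \<eta>)) ^ fibre_size \<xi> n)
      (\<Prod>\<alpha>\<in>galois_orbit \<xi>. [:- monomial_char n \<alpha>, 1:]) = cpoly (min_int_poly \<eta> ^ fibre_size \<xi> n)"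
proof -
  have "(\<Prod>\<alpha>\<in>galois_orbit \<xi>. [:- monomial_char n \<alpha>, 1:])
      = (\<Prod>\<beta>\<in>conjugates \<eta>. [:- \<beta>, 1:]) ^ fibre_size \<xi> n"
    unfolding \<eta>_def by (rule prod_over_orbit[OF assms(1)])
  moreover have "cpoly (min_int_poly \<eta>)
      = smult (of_int (lead_coeff (min_int_poly \<eta>))) (\<Prod>\<beta>\<in>conjugates \<eta>. [:- \<beta>, 1:])"
    unfolding \<eta>_def by (rule min_int_poly_factorization[OF monomial_char_algebraic[OF assms(1)]])
  ultimately show ?thesis
    unfolding cpoly_power by (simp only: smult_power)
qed

lemma integral_orbit_coordinate:
  fixes \<xi> :: "complex ^ 'n"
  assumes \<xi>: "\<xi> \<in> alg_torus" and T: "T \<subseteq> galois_orbit \<xi>"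
  shows "integral_elt (of_int (lead_coeff (min_int_poly (\<xi> $ j))) ^ fibre_size \<xi> (axis j 1) * (\<Prod>\<alpha>\<in>T. \<alpha> $ j))"
  using smult_prod_orbit[OF \<xi>, of "axis j 1"]
  by (intro integral_subproduct_of_roots[OF finite_galois_orbit[OF \<xi>] T])
     (simp add: monomial_char_axis)

text \<open>The constant coefficient is the leading coefficient times the product of all conjugates, up
  to sign. Dividing it by the coordinates over \<open>T\<close> therefore leaves those over the
  complement of \<open>T\<close>.\<close>
lemma integral_orbit_coordinate_inverse:
  fixes \<xi> :: "complex ^ 'n"
  assumes \<xi>: "\<xi> \<in> alg_torus" and T: "T \<subseteq> galois_orbit \<xi>"
  shows "integral_elt (of_int (coeff (min_int_poly (\<xi> $ j)) 0) ^ fibre_size \<xi> (axis j 1)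
           * (\<Prod>\<alpha>\<in>T. inverse (\<alpha> $ j)))"
proof -
  let ?S = "galois_orbit \<xi>" and ?N = "fibre_size \<xi> (axis j 1)" and ?x = "\<xi> $ j"
  let ?a = "complex_of_int (lead_coeff (min_int_poly ?x))" and ?c = "complex_of_int (coeff (min_int_poly ?x) 0)"
  have fin: "finite ?S" using finite_galois_orbit[OF \<xi>] .
  have x: "algebraic ?x" using \<xi> by (rule alg_torusD)
  have "?c ^ ?N = ?a ^ ?N * (\<Prod>y\<in>conjugates ?x. - y) ^ ?N"
    unfolding const_coeff_eq_prod[OF x] by (rule power_mult_distrib)
  also have "(\<Prod>y\<in>conjugates ?x. - y) ^ ?N = (\<Prod>\<alpha>\<in>?S. - (\<alpha> $ j))"
    using prod_over_orbit[OF \<xi>, of uminus "axis j 1"] by (simp add: monomial_char_axis)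
  also have "(\<Prod>\<alpha>\<in>?S. - (\<alpha> $ j)) = (\<Prod>\<alpha>\<in>T. - (\<alpha> $ j)) * (\<Prod>\<alpha>\<in>?S - T. - (\<alpha> $ j))"
    using prod.subset_diff[OF T fin] by (simp add: mult.commute)
  finally have "?c ^ ?N * (\<Prod>\<alpha>\<in>T. inverse (\<alpha> $ j))
    = ?a ^ ?N * ((\<Prod>\<alpha>\<in>T. - (\<alpha> $ j)) * (\<Prod>\<alpha>\<in>T. inverse (\<alpha> $ j))) * (\<Prod>\<alpha>\<in>?S - T. - (\<alpha> $ j))"
    by (simp add: mult_ac)
  also have "(\<Prod>\<alpha>\<in>T. - (\<alpha> $ j)) * (\<Prod>\<alpha>\<in>T. inverse (\<alpha> $ j)) = (\<Prod>\<alpha>\<in>T. - 1)"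
    unfolding prod.distrib[symmetric]
    using galois_orbit_alg_torus[OF \<xi>] T by (intro prod.cong refl) (auto simp: alg_torusD)
  also have "(\<Prod>\<alpha>\<in>?S - T. - (\<alpha> $ j)) = (- 1) ^ card (?S - T) * (\<Prod>\<alpha>\<in>?S - T. \<alpha> $ j)"
    by (rule prod_uminus)
  finally have "?c ^ ?N * (\<Prod>\<alpha>\<in>T. inverse (\<alpha> $ j))
    = ((-1) ^ card T * (- 1) ^ card (?S - T)) * (?a ^ ?N * (\<Prod>\<alpha>\<in>?S - T. \<alpha> $ j))"
    by (simp add: mult_ac)
  then show ?thesis
    using integral_orbit_coordinate[OF \<xi>, of "?S - T" j]
    by (auto intro!: integral_mult integral_power integral_minus)
qed

text \<open>The coefficient that clears the denominators of subproducts of conjugates of \<open>x\<close> for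
  exponents \<open>k \<ge> 0\<close>, and of \<open>1/x\<close> for \<open>k < 0\<close>.\<close>
definition denom_coeff :: "complex \<Rightarrow> int \<Rightarrow> int" where
  "denom_coeff x k = (if k \<ge> 0 then lead_coeff (min_int_poly x) else coeff (min_int_poly x) 0)"

lemma denom_coeff_nonzero: "algebraic x \<Longrightarrow> x \<noteq> 0 \<Longrightarrow> denom_coeff x k \<noteq> 0"
  using min_int_poly_nonzero min_int_poly_const_coeff by (simp add: denom_coeff_def)

lemma integral_orbit_powi:
  fixes \<xi> :: "complex ^ 'n"
  assumes \<xi>: "\<xi> \<in> alg_torus" and T: "T \<subseteq> galois_orbit \<xi>"
  shows "integral_elt (of_int (denom_coeff (\<xi> $ j) k ^ (fibre_size \<xi> (axis j 1) * nat \<bar>k\<bar>))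
           * (\<Prod>\<alpha>\<in>T. \<alpha> $ j powi k))"
proof (cases "k \<ge> 0")
  case True
  have "integral_elt ((of_int (lead_coeff (min_int_poly (\<xi> $ j))) ^ fibre_size \<xi> (axis j 1)
      * (\<Prod>\<alpha>\<in>T. \<alpha> $ j)) ^ nat k)"
    by (intro integral_power integral_orbit_coordinate[OF assms])
  then show ?thesis using True
    by (simp add: denom_coeff_def power_int_def power_mult_distrib power_mult prod_power_distrib)
next
  case False
  have "integral_elt ((of_int (coeff (min_int_poly (\<xi> $ j)) 0) ^ fibre_size \<xi> (axis j 1)
      * (\<Prod>\<alpha>\<in>T. inverse (\<alpha> $ j))) ^ nat (- k))"
    by (intro integral_power integral_orbit_coordinate_inverse[OF assms])
  then show ?thesis using False
    by (simp add: denom_coeff_def power_int_def power_mult_distrib power_mult prod_power_distrib abs_if)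
qed

text \<open>Expanding the product writes every coefficient as a sum of subproducts with signs.\<close>
lemma integral_coeffs_of_subproducts:
  fixes y :: "'a \<Rightarrow> complex"
  assumes "finite I" "\<And>T. T \<subseteq> I \<Longrightarrow> integral_elt (c * (\<Prod>i\<in>T. y i))"
  shows "integral_elt (coeff (smult c (\<Prod>i\<in>I. [:- y i, 1:])) k)"
proof -
  have "(\<Prod>i\<in>I. [:- y i, 1:]) = (\<Prod>i\<in>I. monom 1 1 + [:- y i:])"
    by (intro prod.cong refl) (simp add: monom_Suc monom_0 One_nat_def)
  also have "\<dots> = (\<Sum>X\<in>Pow I. (\<Prod>i\<in>X. monom 1 1) * (\<Prod>i\<in>I - X. [:- y i:]))"
    by (rule prod_add[OF assms(1)])
  finally have "coeff (smult c (\<Prod>i\<in>I. [:- y i, 1:])) k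
    = (\<Sum>X\<in>Pow I. c * coeff ((\<Prod>i\<in>X. monom 1 1) * (\<Prod>i\<in>I - X. [:- y i:])) k)"
    by (simp only: coeff_smult coeff_sum sum_distrib_left)
  also have "integral_elt \<dots>"
  proof (rule integral_sum)
    fix X assume X: "X \<in> Pow I"
    have const: "(\<Prod>i\<in>A. [:- y i:]) = [:\<Prod>i\<in>A. - y i:]" for A
      by (induction A rule: infinite_finite_induct) (simp_all add: one_pCons)
    have "(\<Prod>i\<in>X. monom 1 1) * (\<Prod>i\<in>I - X. [:- y i:]) = monom (\<Prod>i\<in>I - X. - y i) (card X)"
      unfolding const by (simp add: monom_power smult_monom mult.commute)
    moreover have "integral_elt ((-1) ^ card (I - X) * (c * (\<Prod>i\<in>I - X. y i)))"
      by (rule integral_mult[OF integral_power[OF integral_minus[OF integral_1]] assms(2)]) auto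
    ultimately show "integral_elt (c * coeff ((\<Prod>i\<in>X. monom 1 1) * (\<Prod>i\<in>I - X. [:- y i:])) k)"
      by (simp add: prod_uminus mult_ac)
  qed
  finally show ?thesis .
qed

lemma content_power: "content (p ^ n :: int poly) = content p ^ n"
  by (induction n) (simp_all add: content_mult)

text \<open>The contribution of the finite places to the subadditivity of heights. The integer \<open>K\<close> on
  the right clears the denominators of all subproducts of the values \<open>\<chi>^n(\<alpha>)\<close>, so \<open>K\<close> times
  the orbit polynomial has integral coefficients; being rational, they are integers. On the
  other hand this polynomial is a multiple of a power of the primitive minimal polynomial of
  \<open>\<eta>\<close>, and comparing contents shows that the power of the leading coefficient divides \<open>K\<close>.\<close>
lemma lead_coeff_monomial_le:
  fixes \<xi> :: "complex ^ 'n" and n :: "int ^ 'n"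
  assumes \<xi>: "\<xi> \<in> alg_torus"
  defines "\<eta> \<equiv> monomial_char n \<xi>"
  shows "lead_coeff (min_int_poly \<eta>) ^ fibre_size \<xi> n
    \<le> \<bar>\<Prod>j\<in>UNIV. denom_coeff (\<xi> $ j) (n $ j) ^ (fibre_size \<xi> (axis j 1) * nat \<bar>n $ j\<bar>)\<bar>"
proof -
  let ?S = "galois_orbit \<xi>" and ?N = "fibre_size \<xi> n"
  let ?e = "\<lambda>j. fibre_size \<xi> (axis j 1) * nat \<bar>n $ j\<bar>"
  define K where "K = (\<Prod>j\<in>UNIV. denom_coeff (\<xi> $ j) (n $ j) ^ ?e j)"
  define f where "f = (\<Prod>\<alpha>\<in>?S. [:- monomial_char n \<alpha>, 1:])"
  define p where "p = min_int_poly \<eta>"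
  define l where "l = lead_coeff p"
  have \<eta>: "algebraic \<eta>" unfolding \<eta>_def using \<xi> by (rule monomial_char_algebraic)
  have l: "l > 0" using min_int_poly_lead_pos[OF \<eta>] by (simp add: l_def p_def)
  have K: "K \<noteq> 0" using \<xi> by (simp add: K_def denom_coeff_nonzero alg_torusD)
  have fp: "smult (of_int l ^ ?N) f = cpoly (p ^ ?N)"
    using smult_prod_orbit[OF \<xi>, of n] by (simp add: f_def l_def p_def \<eta>_def)
  have int: "integral_elt (coeff (smult (of_int K) f) k)" for k
    unfolding f_def
  proof (rule integral_coeffs_of_subproducts[OF finite_galois_orbit[OF \<xi>]])
    fix T assume T: "T \<subseteq> ?S"
    have "of_int K * (\<Prod>\<alpha>\<in>T. monomial_char n \<alpha>)
      = (\<Prod>j\<in>UNIV. of_int (denom_coeff (\<xi> $ j) (n $ j) ^ ?e j) * (\<Prod>\<alpha>\<in>T. \<alpha> $ j powi (n $ j)))"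
      unfolding K_def monomial_char_def prod.distrib of_int_prod
      by (subst prod.swap) simp
    also have "integral_elt \<dots>" by (intro integral_prod integral_orbit_powi \<xi> T)
    finally show "integral_elt (of_int K * (\<Prod>\<alpha>\<in>T. monomial_char n \<alpha>))" .
  qed
  have "\<exists>z. coeff (smult (of_int K) f) k = of_int z" for k
  proof -
    have "of_int l ^ ?N * coeff f k = of_int (coeff (p ^ ?N) k)"
      using arg_cong[OF fp, of "\<lambda>q. coeff q k"] by simp
    then have "coeff f k = of_int (coeff (p ^ ?N) k) / of_int l ^ ?N"
      using l by (simp add: field_simps)
    then have "coeff (smult (of_int K) f) k \<in> \<rat>" by simp
    then have "coeff (smult (of_int K) f) k \<in> \<int>" by (rule integral_rational_is_int[OF int])
    then show ?thesis by (auto elim: Ints_cases)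
  qed
  then obtain z where z: "\<And>k. coeff (smult (of_int K) f) k = of_int (z k)" by metis
  define Q where "Q = (\<Sum>k\<le>degree f. monom (z k) k)"
  have zf: "z k = 0" if "k > degree f" for k
    using z[of k] that by (simp add: coeff_eq_0)
  have cQ: "coeff Q k = z k" for k
    using zf[of k] unfolding Q_def coeff_sum coeff_monom by (cases "k \<le> degree f") auto
  have Q: "cpoly Q = smult (of_int K) f" by (rule poly_eqI) (simp only: z coeff_cpoly cQ)
  have "cpoly (smult (l ^ ?N) Q) = smult (of_int K) (smult (of_int l ^ ?N) f)"
    unfolding cpoly_smult Q by (simp add: mult.commute)
  also have "\<dots> = cpoly (smult K (p ^ ?N))" unfolding fp cpoly_smult ..
  finally have "cpoly (smult (l ^ ?N) Q - smult K (p ^ ?N)) = 0"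
    by (simp only: cpoly_diff diff_self)
  then have "smult (l ^ ?N) Q = smult K (p ^ ?N)"
    by (simp only: cpoly_eq_0_iff right_minus_eq)
  then have "content (smult (l ^ ?N) Q) = content (smult K (p ^ ?N))" by simp
  then have "l ^ ?N * content Q = \<bar>K\<bar>"
    using l min_int_poly_content[OF \<eta>] by (simp add: content_power p_def)
  then have "l ^ ?N dvd \<bar>K\<bar>" by (metis dvd_triv_left)
  then have "l ^ ?N \<le> \<bar>K\<bar>" using K by (intro zdvd_imp_le) auto
  then show ?thesis by (simp add: l_def p_def K_def)
qed

lemma log_plus_mult: "s > 0 \<Longrightarrow> t > 0 \<Longrightarrow> log_plus (s * t) \<le> log_plus s + log_plus t"
  unfolding log_plus_def by (simp add: ln_mult)

lemma log_plus_prod: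
  "(\<And>i. i \<in> A \<Longrightarrow> f i > 0) \<Longrightarrow> log_plus (prod f A) \<le> (\<Sum>i\<in>A. log_plus (f i))"
proof (induction A rule: infinite_finite_induct)
  case (insert i A)
  have "log_plus (f i * prod f A) \<le> log_plus (f i) + log_plus (prod f A)"
    using insert by (intro log_plus_mult prod_pos) auto
  then show ?case using insert by simp
qed (auto simp: log_plus_def)

lemma log_plus_power: "t > 0 \<Longrightarrow> log_plus (t ^ n) = real n * log_plus t"
  unfolding log_plus_def by (simp add: ln_realpow max_mult_distrib_left)

lemma log_plus_powi:
  "t > 0 \<Longrightarrow> log_plus (t powi k) = real (nat \<bar>k\<bar>) * log_plus (if k \<ge> 0 then t else inverse t)"
  unfolding power_int_def by (simp add: log_plus_power abs_if)

text \<open>At the infinite places \<open>log^+\<close> is subadditive at each point of the orbit; the finite places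
  are \<open>lead_coeff_monomial_le\<close>. Coordinates with a negative exponent enter through \<open>1/\<xi>_j\<close>,
  which has the same height as \<open>\<xi>_j\<close>.\<close>
theorem weil_height_monomial_le:
  fixes \<xi> :: "complex ^ 'n" and n :: "int ^ 'n"
  assumes \<xi>: "\<xi> \<in> alg_torus"
  shows "weil_height (monomial_char n \<xi>) \<le> (\<Sum>j\<in>UNIV. real (nat \<bar>n $ j\<bar>) * weil_height (\<xi> $ j))"
proof -
  let ?S = "galois_orbit \<xi>" and ?N = "fibre_size \<xi> n"
  let ?M = "\<lambda>j. fibre_size \<xi> (axis j 1)" and ?m = "\<lambda>j. nat \<bar>n $ j\<bar>" and ?b = "\<lambda>j. denom_coeff (\<xi> $ j) (n $ j)"
  define \<eta> where "\<eta> = monomial_char n \<xi>"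
  define l where "l = lead_coeff (min_int_poly \<eta>)"
  have \<eta>: "algebraic \<eta>" unfolding \<eta>_def using \<xi> by (rule monomial_char_algebraic)
  have l: "l > 0" using min_int_poly_lead_pos[OF \<eta>] by (simp add: l_def)
  have bnz: "?b j \<noteq> 0" for j using \<xi> by (simp add: denom_coeff_nonzero alg_torusD)
  define g where "g j t = log_plus (if n $ j \<ge> 0 then t else inverse t)" for j t
  have loc: "ln \<bar>real_of_int (?b j)\<bar> + (\<Sum>y\<in>conjugates (\<xi> $ j). g j (cmod y))
      = real (alg_degree (\<xi> $ j)) * weil_height (\<xi> $ j)" for j
    using weil_height_eq[of "\<xi> $ j"] weil_height_eq_const_coeff[of "\<xi> $ j"] alg_torusD[OF \<xi>, of j]
      min_int_poly_lead_pos[of "\<xi> $ j"]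
    by (cases "n $ j \<ge> 0") (simp_all add: denom_coeff_def g_def)
  have "real_of_int (l ^ ?N) \<le> real_of_int \<bar>\<Prod>j\<in>UNIV. ?b j ^ (?M j * ?m j)\<bar>"
    using lead_coeff_monomial_le[OF \<xi>, of n] unfolding l_def \<eta>_def of_int_le_iff .
  then have "ln (real_of_int (l ^ ?N)) \<le> ln (real_of_int \<bar>\<Prod>j\<in>UNIV. ?b j ^ (?M j * ?m j)\<bar>)"
    using l by (intro ln_mono) auto
  also have "real_of_int \<bar>\<Prod>j\<in>UNIV. ?b j ^ (?M j * ?m j)\<bar> = (\<Prod>j\<in>UNIV. \<bar>real_of_int (?b j)\<bar> ^ (?M j * ?m j))"
    by (simp add: abs_prod power_abs)
  also have "ln \<dots> = (\<Sum>j\<in>UNIV. real (?M j * ?m j) * ln \<bar>real_of_int (?b j)\<bar>)"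
    using bnz by (subst ln_prod) (auto simp: ln_realpow)
  finally have fin_part: "real ?N * ln (real_of_int l) \<le> (\<Sum>j\<in>UNIV. real (?M j * ?m j) * ln \<bar>real_of_int (?b j)\<bar>)"
    using l by (simp add: ln_realpow)
  have "real ?N * (\<Sum>\<beta>\<in>conjugates \<eta>. log_plus (cmod \<beta>)) = (\<Sum>\<alpha>\<in>?S. log_plus (cmod (monomial_char n \<alpha>)))"
    unfolding \<eta>_def by (rule sum_over_orbit[OF \<xi>, symmetric])
  also have "\<dots> \<le> (\<Sum>\<alpha>\<in>?S. \<Sum>j\<in>UNIV. real (?m j) * g j (cmod (\<alpha> $ j)))"
  proof (rule sum_mono)
    fix \<alpha> assume "\<alpha> \<in> ?S"
    then have "\<alpha> \<in> alg_torus" by (rule galois_orbit_alg_torus[OF \<xi>])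
    then have pos: "cmod (\<alpha> $ j) > 0" for j using alg_torusD(2)[of \<alpha> j] by simp
    have "log_plus (cmod (monomial_char n \<alpha>)) = log_plus (\<Prod>j\<in>UNIV. cmod (\<alpha> $ j) powi (n $ j))"
      unfolding monomial_char_def by (simp add: norm_power_int flip: prod_norm)
    also have "\<dots> \<le> (\<Sum>j\<in>UNIV. log_plus (cmod (\<alpha> $ j) powi (n $ j)))"
      by (intro log_plus_prod zero_less_power_int pos)
    also have "\<dots> = (\<Sum>j\<in>UNIV. real (?m j) * g j (cmod (\<alpha> $ j)))"
      unfolding g_def using pos by (intro sum.cong refl log_plus_powi)
    finally show "log_plus (cmod (monomial_char n \<alpha>)) \<le> (\<Sum>j\<in>UNIV. real (?m j) * g j (cmod (\<alpha> $ j)))" .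
  qed
  also have "\<dots> = (\<Sum>j\<in>UNIV. real (?m j) * (\<Sum>\<alpha>\<in>?S. g j (cmod (\<alpha> $ j))))"
    by (subst sum.swap) (simp add: sum_distrib_left)
  also have "\<dots> = (\<Sum>j\<in>UNIV. real (?M j * ?m j) * (\<Sum>y\<in>conjugates (\<xi> $ j). g j (cmod y)))"
  proof (rule sum.cong[OF refl])
    fix j
    have "(\<Sum>\<alpha>\<in>?S. g j (cmod (\<alpha> $ j))) = real (?M j) * (\<Sum>y\<in>conjugates (\<xi> $ j). g j (cmod y))"
      using sum_over_orbit[OF \<xi>, of "\<lambda>y. g j (cmod y)" "axis j 1"] by (simp add: monomial_char_axis)
    then show "real (?m j) * (\<Sum>\<alpha>\<in>?S. g j (cmod (\<alpha> $ j))) = real (?M j * ?m j) * (\<Sum>y\<in>conjugates (\<xi> $ j). g j (cmod y))"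
      by simp
  qed
  finally have "real ?N * (real (alg_degree \<eta>) * weil_height \<eta>)
    \<le> (\<Sum>j\<in>UNIV. real (?M j * ?m j) * ln \<bar>real_of_int (?b j)\<bar>)
      + (\<Sum>j\<in>UNIV. real (?M j * ?m j) * (\<Sum>y\<in>conjugates (\<xi> $ j). g j (cmod y)))"
    using fin_part unfolding weil_height_eq[OF \<eta>] l_def by (simp add: distrib_left)
  also have "\<dots> = (\<Sum>j\<in>UNIV. real (?M j * ?m j) * (real (alg_degree (\<xi> $ j)) * weil_height (\<xi> $ j)))"
    unfolding sum.distrib[symmetric] distrib_left[symmetric] loc ..
  also have "\<dots> = (\<Sum>j\<in>UNIV. real (card ?S) * (real (?m j) * weil_height (\<xi> $ j)))"
  proof (rule sum.cong[OF refl])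
    fix j
    have "card ?S = ?M j * alg_degree (\<xi> $ j)"
      using card_orbit_eq[OF \<xi>, of "axis j 1"] by (simp add: monomial_char_axis)
    then show "real (?M j * ?m j) * (real (alg_degree (\<xi> $ j)) * weil_height (\<xi> $ j))
        = real (card ?S) * (real (?m j) * weil_height (\<xi> $ j))" by simp
  qed
  also have "\<dots> = real (card ?S) * (\<Sum>j\<in>UNIV. real (?m j) * weil_height (\<xi> $ j))"
    by (simp add: sum_distrib_left)
  finally have "real (card ?S) * weil_height \<eta> \<le> real (card ?S) * (\<Sum>j\<in>UNIV. real (?m j) * weil_height (\<xi> $ j))"
    using card_orbit_eq[OF \<xi>, of n] by (simp add: \<eta>_def mult_ac)
  then show ?thesis using card_galois_orbit_pos[OF \<xi>] by (simp add: \<eta>_def)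
qed

section \<open>The discriminant\<close>

text \<open>Grouping the pairs by one component splits the product of the other component into \<open>d\<close>
  subproducts of distinct conjugates.\<close>
lemma integral_pair_product:
  fixes f h :: "complex \<times> complex \<Rightarrow> complex"
  assumes x: "algebraic x"
    and X: "X \<subseteq> conjugates x \<times> conjugates x"
    and fh: "(f, h) \<in> {(fst, snd), (snd, fst)}"
  shows "integral_elt (of_int (lead_coeff (min_int_poly x)) ^ alg_degree x * (\<Prod>p\<in>X. f p))"
proof -
  let ?C = "conjugates x" and ?l = "complex_of_int (lead_coeff (min_int_poly x))"
  have finC: "finite ?C" using finite_conjugates[OF x] .
  have finX: "finite X" using X finC by (meson finite_SigmaI finite_subset)
  have "(\<Prod>z\<in>?C. \<Prod>p\<in>{p\<in>X. h p = z}. f p) = (\<Prod>p\<in>X. f p)"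
    using X fh by (intro prod.group finX finC) auto
  then have "?l ^ alg_degree x * (\<Prod>p\<in>X. f p) = (\<Prod>z\<in>?C. ?l * (\<Prod>p\<in>{p\<in>X. h p = z}. f p))"
    by (simp add: prod.distrib card_conjugates[OF x])
  also have "integral_elt \<dots>"
  proof (rule integral_prod)
    fix z
    have "inj_on f {p\<in>X. h p = z}" using fh by (auto simp: inj_on_def)
    then have "(\<Prod>p\<in>{p\<in>X. h p = z}. f p) = (\<Prod>y\<in>f ` {p\<in>X. h p = z}. y)"
      by (simp add: prod.reindex)
    moreover have "integral_elt (?l * (\<Prod>y\<in>f ` {p\<in>X. h p = z}. y))"
      using X fh min_int_poly_factorization[OF x, symmetric]
      by (intro integral_subproduct_of_roots[OF finC]) auto
    ultimately show "integral_elt (?l * (\<Prod>p\<in>{p\<in>X. h p = z}. f p))" by simp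
  qed
  finally show ?thesis .
qed

text \<open>The product of \<open>y - z\<close> over ordered pairs is invariant under the Galois group, hence
  rational. Its expansion into monomials shows that \<open>2d\<close> copies of the leading coefficient
  clear the denominators, and a nonzero integer has absolute value at least one.\<close>
theorem discriminant_lower_bound:
  assumes x: "algebraic x"
  shows "1 \<le> real_of_int (lead_coeff (min_int_poly x)) ^ (2 * alg_degree x)
      * (\<Prod>(y, z)\<in>{(y, z) \<in> conjugates x \<times> conjugates x. y \<noteq> z}. cmod (y - z))"
proof -
  let ?C = "conjugates x" and ?l = "lead_coeff (min_int_poly x)" and ?d = "alg_degree x"
  define P where "P = {(y, z) \<in> ?C \<times> ?C. y \<noteq> z}"
  define D where "D = (\<Prod>p\<in>P. fst p - snd p)"
  have finC: "finite ?C" using finite_conjugates[OF x] .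
  have P: "P \<subseteq> ?C \<times> ?C" "finite P" using finC by (auto simp: P_def intro: finite_subset[of _ "?C \<times> ?C"])
  have algP: "algebraic (fst p)" "algebraic (snd p)" if "p \<in> P" for p
    using that P(1) conjugates_algebraic[OF x] by (auto simp: P_def)
  have algd: "algebraic (fst p - snd p)" if "p \<in> P" for p
    using algebraic_plus[of "fst p" "- snd p"] algP[OF that] by simp
  have D0: "D \<noteq> 0" using P(2) by (auto simp: D_def P_def)
  have "D \<in> \<rat>"
  proof (rule fixed_field_rational)
    show "algebraic D" unfolding D_def by (intro algebraic_prod algd)
    fix \<sigma> assume \<sigma>: "\<sigma> \<in> abs_galois"
    have bij: "bij_betw \<sigma> ?C ?C" using gal_conjugates_bij[OF \<sigma> x] .
    then have inj: "inj_on \<sigma> ?C" and img: "\<sigma> ` ?C = ?C" by (auto simp: bij_betw_def)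
    have "\<sigma> D = (\<Prod>p\<in>P. \<sigma> (fst p) - \<sigma> (snd p))"
      unfolding D_def using algP gal_diff[OF \<sigma>] by (subst gal_prod[OF \<sigma> algd]) simp_all
    also have "\<dots> = D" unfolding D_def
    proof (rule prod.reindex_bij_betw[of "\<lambda>p. (\<sigma> (fst p), \<sigma> (snd p))" P P "\<lambda>p. fst p - snd p", simplified])
      show "bij_betw (\<lambda>p. (\<sigma> (fst p), \<sigma> (snd p))) P P"
      proof -
        have inj2: "inj_on (\<lambda>p. (\<sigma> (fst p), \<sigma> (snd p))) P"
          using inj unfolding inj_on_def P_def by auto
        have "(\<lambda>p. (\<sigma> (fst p), \<sigma> (snd p))) ` P \<subseteq> P"
          using inj img unfolding P_def inj_on_def by auto
        then show ?thesis using endo_inj_surj[OF P(2) _ inj2] inj2 by (simp add: bij_betw_def)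
      qed
    qed
    finally show "\<sigma> D = D" .
  qed
  then have rat: "of_int ?l ^ (2 * ?d) * D \<in> \<rat>" by simp
  have "D = (\<Prod>p\<in>P. fst p + - snd p)" by (simp add: D_def)
  also have "\<dots> = (\<Sum>X\<in>Pow P. (\<Prod>p\<in>X. fst p) * (\<Prod>p\<in>P - X. - snd p))"
    by (rule prod_add[OF P(2)])
  finally have D_sum: "D = (\<Sum>X\<in>Pow P. (\<Prod>p\<in>X. fst p) * (\<Prod>p\<in>P - X. - snd p))" .
  have "(of_int ?l :: complex) ^ (2 * ?d) = of_int ?l ^ ?d * of_int ?l ^ ?d"
    by (simp only: mult_2 power_add)
  then have "of_int ?l ^ (2 * ?d) * D
     = (\<Sum>X\<in>Pow P. (-1) ^ card (P - X) * ((of_int ?l ^ ?d * (\<Prod>p\<in>X. fst p)) * (of_int ?l ^ ?d * (\<Prod>p\<in>P - X. snd p))))"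
    unfolding D_sum by (simp only: sum_distrib_left prod_uminus mult_ac)
  also have "integral_elt \<dots>"
  proof (intro integral_sum integral_mult[OF _ integral_mult])
    fix X assume "X \<in> Pow P"
    then have X: "X \<subseteq> ?C \<times> ?C" "P - X \<subseteq> ?C \<times> ?C" using P(1) by auto
    show "integral_elt ((-1) ^ card (P - X))" by (intro integral_power integral_minus) auto
    show "integral_elt (of_int ?l ^ ?d * (\<Prod>p\<in>X. fst p))"
      by (rule integral_pair_product[OF x X(1), of fst snd]) simp
    show "integral_elt (of_int ?l ^ ?d * (\<Prod>p\<in>P - X. snd p))"
      by (rule integral_pair_product[OF x X(2), of snd fst]) simp
  qed
  finally have "of_int ?l ^ (2 * ?d) * D \<in> \<int>" using integral_rational_is_int rat by blast
  then obtain k where k: "of_int ?l ^ (2 * ?d) * D = of_int k" by (auto elim: Ints_cases)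
  have "k \<noteq> 0" using k D0 min_int_poly_nonzero[OF x] by auto
  then have "1 \<le> cmod (of_int k)" by simp
  also have "\<dots> = real_of_int ?l ^ (2 * ?d) * (\<Prod>p\<in>P. cmod (fst p - snd p))"
    unfolding k[symmetric] D_def norm_mult norm_power
    using min_int_poly_lead_pos[OF x] by (simp flip: prod_norm)
  finally show ?thesis by (simp add: P_def case_prod_unfold)
qed

section \<open>A logarithmic energy estimate for angles\<close>

text \<open>The kernel \<open>min(t_i, t_j)\<close> is a superposition of products of indicator functions. The
  induction mirrors this: subtracting the smallest value \<open>t_k\<close> splits off \<open>t_k |sum c_i|^2\<close>
  and makes all terms with index \<open>k\<close> vanish.\<close>
lemma min_kernel_nonneg:
  fixes c :: "'a \<Rightarrow> complex" and t :: "'a \<Rightarrow> real"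
  assumes "finite I" "\<And>i. i \<in> I \<Longrightarrow> t i \<ge> 0"
  shows "0 \<le> Re (\<Sum>i\<in>I. \<Sum>j\<in>I. c i * cnj (c j) * of_real (min (t i) (t j)))"
proof -
  have "\<forall>t. (\<forall>i\<in>I. t i \<ge> 0) \<longrightarrow> 0 \<le> Re (\<Sum>i\<in>I. \<Sum>j\<in>I. c i * cnj (c j) * of_real (min (t i) (t j)))"
    using assms(1)
  proof (induction I rule: finite_remove_induct)
    case empty
    then show ?case by simp
  next
    case (remove A)
    show ?case
    proof (intro allI impI)
      fix t :: "'a \<Rightarrow> real" assume t: "\<forall>i\<in>A. t i \<ge> 0"
      obtain k where k: "k \<in> A" "\<And>i. i \<in> A \<Longrightarrow> t k \<le> t i"
        using arg_min_if_finite[OF remove.hyps(1,2), of t] by (metis not_le)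
      define s where "s i = t i - t k" for i
      have m: "min (t i) (t j) = t k + min (s i) (s j)" for i j by (simp add: s_def min_def)
      have min0: "min (s k) (s j) = 0" "min (s j) (s k) = 0" if "j \<in> A" for j
        using k(2)[OF that] by (auto simp: s_def)
      have "(\<Sum>i\<in>A. \<Sum>j\<in>A. c i * cnj (c j) * of_real (min (t i) (t j)))
        = of_real (t k) * (\<Sum>i\<in>A. \<Sum>j\<in>A. c i * cnj (c j)) + (\<Sum>i\<in>A. \<Sum>j\<in>A. c i * cnj (c j) * of_real (min (s i) (s j)))"
        unfolding m by (simp add: ring_distribs sum.distrib sum_distrib_left mult_ac)
      also have "(\<Sum>i\<in>A. \<Sum>j\<in>A. c i * cnj (c j)) = sum c A * cnj (sum c A)"
        by (simp add: sum_product)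
      also have "(\<Sum>i\<in>A. \<Sum>j\<in>A. c i * cnj (c j) * of_real (min (s i) (s j)))
        = (\<Sum>i\<in>A - {k}. \<Sum>j\<in>A - {k}. c i * cnj (c j) * of_real (min (s i) (s j)))"
      proof -
        have inner: "(\<Sum>j\<in>A. c i * cnj (c j) * of_real (min (s i) (s j)))
          = (\<Sum>j\<in>A - {k}. c i * cnj (c j) * of_real (min (s i) (s j)))" if "i \<in> A" for i
          using min0(2)[OF that] by (subst sum.remove[OF remove.hyps(1) k(1)]) simp
        have "(\<Sum>i\<in>A. \<Sum>j\<in>A. c i * cnj (c j) * of_real (min (s i) (s j)))
          = (\<Sum>i\<in>A. \<Sum>j\<in>A - {k}. c i * cnj (c j) * of_real (min (s i) (s j)))"
          by (intro sum.cong refl inner)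
        also have "\<dots> = (\<Sum>j\<in>A - {k}. c k * cnj (c j) * of_real (min (s k) (s j)))
           + (\<Sum>i\<in>A - {k}. \<Sum>j\<in>A - {k}. c i * cnj (c j) * of_real (min (s i) (s j)))"
          by (rule sum.remove[OF remove.hyps(1) k(1)])
        also have "(\<Sum>j\<in>A - {k}. c k * cnj (c j) * of_real (min (s k) (s j))) = 0"
          by (intro sum.neutral ballI) (use min0(1) in auto)
        finally show ?thesis by simp
      qed
      finally have eq: "Re (\<Sum>i\<in>A. \<Sum>j\<in>A. c i * cnj (c j) * of_real (min (t i) (t j)))
        = t k * (cmod (sum c A))\<^sup>2 + Re (\<Sum>i\<in>A - {k}. \<Sum>j\<in>A - {k}. c i * cnj (c j) * of_real (min (s i) (s j)))"
        by (simp add: complex_mult_cnj cmod_power2 del: cnj_sum flip: of_real_power of_real_add)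
      have "\<forall>i\<in>A - {k}. s i \<ge> 0" using k by (simp add: s_def)
      then have "0 \<le> Re (\<Sum>i\<in>A - {k}. \<Sum>j\<in>A - {k}. c i * cnj (c j) * of_real (min (s i) (s j)))"
        using remove.IH[OF k(1)] by blast
      then show "0 \<le> Re (\<Sum>i\<in>A. \<Sum>j\<in>A. c i * cnj (c j) * of_real (min (t i) (t j)))"
        unfolding eq using t k(1) by simp
    qed
  qed
  then show ?thesis using assms(2) by blast
qed

lemma minus_ln_norm_series:
  assumes "cmod w < 1"
  shows "(\<lambda>n. Re (w ^ n) / real n) sums (- ln (cmod (1 - w)))"
proof -
  have "1 - w \<noteq> 0" using assms by auto
  have "(\<lambda>n. - (- (w ^ n) / of_nat n)) sums - ln (1 + - w)"
    using Ln_series'[of "- w"] assms by (intro sums_minus) simp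
  then have "(\<lambda>n. Re (w ^ n / of_nat n)) sums Re (- ln (1 - w))"
    by (intro sums_Re) simp
  then show ?thesis using \<open>1 - w \<noteq> 0\<close> by (simp add: Re_divide_of_nat)
qed

text \<open>The quotient of the number of smaller modulus by the other one, up to complex conjugation.
  It is chosen so that \<open>|x - y| = max(|x|,|y|) |1 - z|\<close> for \<open>z\<close> the polar quotient, while
  all powers of \<open>z\<close> are positive definite kernels.\<close>
definition polar_quotient :: "complex \<Rightarrow> complex \<Rightarrow> complex" where
  "polar_quotient x y = of_real (min (cmod x) (cmod y) / max (cmod x) (cmod y)) * (sgn x * cnj (sgn y))"

lemma sgn_times_cnj_sgn:
  "sgn x * cnj (sgn y) = x * cnj y / of_real (cmod x * cmod y)"
  by (simp add: sgn_div_norm scaleR_conv_of_real field_simps)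

lemma polar_quotient_le:
  assumes "x \<noteq> 0" "cmod x \<le> cmod y"
  shows "polar_quotient x y = x / y"
proof -
  have "polar_quotient x y = x * cnj y / of_real ((cmod y)\<^sup>2)"
    using assms unfolding polar_quotient_def sgn_times_cnj_sgn
    by (simp add: min_absorb1 max_absorb2 power2_eq_square)
  then show ?thesis using complex_div_cnj[of x y] by simp
qed

lemma polar_quotient_ge:
  assumes "y \<noteq> 0" "cmod y \<le> cmod x"
  shows "polar_quotient x y = cnj (y / x)"
proof -
  have "polar_quotient x y = cnj (y * cnj x / of_real ((cmod x)\<^sup>2))"
    using assms unfolding polar_quotient_def sgn_times_cnj_sgn
    by (simp add: min_absorb2 max_absorb1 power2_eq_square mult_ac)
  then show ?thesis using complex_div_cnj[of y x] by simp
qed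

lemma norm_diff_eq_polar:
  assumes "x \<noteq> 0" "y \<noteq> 0"
  shows "cmod (x - y) = max (cmod x) (cmod y) * cmod (1 - polar_quotient x y)"
proof (cases "cmod x \<le> cmod y")
  case True
  have "cmod y * cmod (1 - x / y) = cmod (y * (1 - x / y))" by (simp add: norm_mult)
  also have "\<dots> = cmod (y - x)" using assms by (simp add: right_diff_distrib)
  finally show ?thesis using True assms by (simp add: polar_quotient_le max_absorb2 norm_minus_commute)
next
  case False
  have "cmod (1 - cnj (y / x)) = cmod (cnj (1 - y / x))" by simp
  also have "\<dots> = cmod (1 - y / x)" by (rule complex_mod_cnj)
  finally have "cmod x * cmod (1 - cnj (y / x)) = cmod (x * (1 - y / x))" by (simp add: norm_mult)
  also have "\<dots> = cmod (x - y)" using assms by (simp add: right_diff_distrib)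
  finally show ?thesis using False assms by (simp add: polar_quotient_ge max_absorb1)
qed

lemma norm_polar_quotient_le:
  assumes "x \<noteq> 0" "y \<noteq> 0" shows "cmod (polar_quotient x y) \<le> 1"
  using assms by (cases "cmod x \<le> cmod y") (auto simp: polar_quotient_le polar_quotient_ge norm_divide)

lemma polar_quotient_self: "x \<noteq> 0 \<Longrightarrow> polar_quotient x x = 1"
  by (simp add: polar_quotient_le)

text \<open>Since \<open>min * max = |x||y|\<close>, the modulus of the \<open>k\<close>-th power is \<open>min(|x|^(2k),|y|^(2k))\<close>
  divided by \<open>|x|^k |y|^k\<close>. So the power is a minimum kernel with modified coefficients.\<close>
lemma polar_quotient_power_positive_definite:
  assumes "finite R" "0 \<notin> R"
  shows "0 \<le> Re (\<Sum>x\<in>R. \<Sum>y\<in>R. polar_quotient x y ^ k)"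
proof -
  define c where "c x = sgn x ^ k / of_real (cmod x ^ k)" for x :: complex
  have "polar_quotient x y ^ k = c x * cnj (c y) * of_real (min (cmod x ^ (2 * k)) (cmod y ^ (2 * k)))"
    if "x \<in> R" "y \<in> R" for x y
  proof -
    have pos: "cmod x > 0" "cmod y > 0" using that assms(2) by (auto simp: zero_less_norm_iff)
    define m M where "m = min (cmod x) (cmod y)" and "M = max (cmod x) (cmod y)"
    have mM: "m * M = cmod x * cmod y" unfolding m_def M_def by (simp add: min_def max_def)
    have "M > 0" using pos by (simp add: M_def less_max_iff_disj)
    then have "m / M = m ^ 2 / (cmod x * cmod y)"
      unfolding mM[symmetric] using pos by (simp add: power2_eq_square field_simps)
    then have q: "polar_quotient x y = of_real (m ^ 2 / (cmod x * cmod y)) * (sgn x * cnj (sgn y))"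
      unfolding polar_quotient_def m_def M_def by simp
    have "min (cmod x ^ (2 * k)) (cmod y ^ (2 * k)) = m ^ (2 * k)"
    proof (cases "cmod x \<le> cmod y")
      case True
      then show ?thesis by (simp add: m_def min_absorb1 power_mono)
    next
      case False
      then show ?thesis by (simp add: m_def min_absorb2 power_mono)
    qed
    then show ?thesis unfolding q c_def
      by (simp add: power_mult_distrib power_divide power_mult field_simps)
         (simp add: mult.commute flip: power_mult)
  qed
  then have "(\<Sum>x\<in>R. \<Sum>y\<in>R. polar_quotient x y ^ k)
    = (\<Sum>x\<in>R. \<Sum>y\<in>R. c x * cnj (c y) * of_real (min (cmod x ^ (2 * k)) (cmod y ^ (2 * k))))"
    by (intro sum.cong refl) auto
  then show ?thesis using min_kernel_nonneg[OF assms(1), of "\<lambda>x. cmod x ^ (2 * k)" c] by simp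
qed

text \<open>This allows the singular kernel \<open>-log|1-z|\<close> to be replaced by \<open>-log|1-rz|\<close> off the diagonal.\<close>
lemma norm_one_minus_scaled:
  assumes "0 \<le> r" "r \<le> 1" "cmod z \<le> 1"
  shows "sqrt r * cmod (1 - z) \<le> cmod (1 - of_real r * z)"
proof -
  have "(cmod (1 - of_real r * z))\<^sup>2 - r * (cmod (1 - z))\<^sup>2 = (1 - r) * (1 - r * (cmod z)\<^sup>2)"
    unfolding cmod_power2 by (simp add: power2_eq_square algebra_simps)
  moreover have "r * (cmod z)\<^sup>2 \<le> 1 * 1"
    using assms by (intro mult_mono) (auto simp: power_le_one)
  ultimately have "r * (cmod (1 - z))\<^sup>2 \<le> (cmod (1 - of_real r * z))\<^sup>2"
    using assms by (smt (verit) mult_nonneg_nonneg)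
  then have "sqrt (r * (cmod (1 - z))\<^sup>2) \<le> cmod (1 - of_real r * z)"
    by (simp add: real_le_lsqrt)
  then show ?thesis by (simp add: real_sqrt_mult)
qed

text \<open>In the power series of \<open>-log|1-rz|\<close>, summed over all pairs, every term is nonnegative; the
  left-hand side is the term of degree one.\<close>
lemma polar_energy_bound:
  fixes R :: "complex set"
  assumes fin: "finite R" and nz: "0 \<notin> R" and r: "0 < r" "r < 1"
  shows "r * Re (\<Sum>x\<in>R. \<Sum>y\<in>R. polar_quotient x y)
    \<le> (\<Sum>x\<in>R. \<Sum>y\<in>R. - ln (cmod (1 - of_real r * polar_quotient x y)))"
proof -
  let ?f = "\<lambda>n. \<Sum>x\<in>R. \<Sum>y\<in>R. Re ((of_real r * polar_quotient x y) ^ n) / real n"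
  have lt: "cmod (of_real r * polar_quotient x y) < 1" if "x \<in> R" "y \<in> R" for x y
  proof -
    have "r * cmod (polar_quotient x y) \<le> r * 1"
      using that nz r by (intro mult_left_mono norm_polar_quotient_le) auto
    then have "r * cmod (polar_quotient x y) < 1" using r(2) by linarith
    then show ?thesis using r(1) by (simp add: norm_mult)
  qed
  have sums: "?f sums (\<Sum>x\<in>R. \<Sum>y\<in>R. - ln (cmod (1 - of_real r * polar_quotient x y)))"
    by (intro sums_sum minus_ln_norm_series lt)
  have f: "?f n = r ^ n / real n * Re (\<Sum>x\<in>R. \<Sum>y\<in>R. polar_quotient x y ^ n)" for n
    by (simp add: power_mult_distrib sum_distrib_left flip: of_real_power)
  have nonneg: "0 \<le> ?f n" for n
    unfolding f using r polar_quotient_power_positive_definite[OF fin nz, of n] by simp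
  have "sum ?f {1} \<le> suminf ?f"
    using sums nonneg by (intro sum_le_suminf) (auto simp: sums_iff)
  moreover have "sum ?f {1} = r * Re (\<Sum>x\<in>R. \<Sum>y\<in>R. polar_quotient x y)"
    using f[of 1] by simp
  ultimately show ?thesis using sums by (simp add: sums_iff)
qed

lemma Re_complex_of_real_times: "Re (of_real t * z) = t * Re z" by simp

text \<open>In place of \<open>sgn x * cnj (sgn y)\<close>, the polar quotient carries an additional factor \<open>t =
  min/max\<close>, and \<open>1 - t \<le> -log t = |log|x| - log|y||\<close>.\<close>
lemma sgn_sum_le_polar_sum:
  fixes R :: "complex set"
  assumes fin: "finite R" and nz: "0 \<notin> R"
  shows "(cmod (\<Sum>x\<in>R. sgn x))\<^sup>2 \<le> Re (\<Sum>x\<in>R. \<Sum>y\<in>R. polar_quotient x y)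
      + 2 * real (card R) * (\<Sum>x\<in>R. \<bar>ln (cmod x)\<bar>)"
proof -
  have trm: "Re (sgn x * cnj (sgn y)) - Re (polar_quotient x y) \<le> \<bar>ln (cmod x)\<bar> + \<bar>ln (cmod y)\<bar>"
    if "x \<in> R" "y \<in> R" for x y
  proof -
    have pos: "cmod x > 0" "cmod y > 0" using that nz by (auto simp: zero_less_norm_iff)
    define t where "t = min (cmod x) (cmod y) / max (cmod x) (cmod y)"
    have t: "0 < t" "t \<le> 1" using pos by (auto simp: t_def min_def max_def)
    have "ln t = ln (min (cmod x) (cmod y)) - ln (max (cmod x) (cmod y))"
      unfolding t_def using pos by (intro ln_divide_pos) (auto simp: less_max_iff_disj)
    also have "\<dots> = - \<bar>ln (cmod x) - ln (cmod y)\<bar>"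
      using pos by (auto simp: min_def max_def abs_if)
    finally have lnt: "- ln t \<le> \<bar>ln (cmod x)\<bar> + \<bar>ln (cmod y)\<bar>" by linarith
    have "Re (sgn x * cnj (sgn y)) - Re (polar_quotient x y) = (1 - t) * Re (sgn x * cnj (sgn y))"
      unfolding polar_quotient_def t_def[symmetric] by (subst Re_complex_of_real_times) (simp only: left_diff_distrib mult_1_left)
    also have "\<dots> \<le> (1 - t) * cmod (sgn x * cnj (sgn y))"
      using t by (intro mult_left_mono complex_Re_le_cmod) auto
    also have "\<dots> = 1 - t" using pos by (simp add: norm_mult norm_sgn)
    also have "\<dots> \<le> - ln t" using ln_le_minus_one[OF t(1)] by simp
    finally show ?thesis using lnt by simp
  qed
  have "(cmod (\<Sum>x\<in>R. sgn x))\<^sup>2 = Re ((\<Sum>x\<in>R. sgn x) * cnj (\<Sum>x\<in>R. sgn x))"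
    unfolding complex_mult_cnj cmod_power2 by simp
  also have "\<dots> = (\<Sum>x\<in>R. \<Sum>y\<in>R. Re (sgn x * cnj (sgn y)))"
    unfolding cnj_sum sum_product by (simp only: Re_sum)
  also have "\<dots> \<le> (\<Sum>x\<in>R. \<Sum>y\<in>R. Re (polar_quotient x y) + (\<bar>ln (cmod x)\<bar> + \<bar>ln (cmod y)\<bar>))"
    using trm by (intro sum_mono) (smt (verit))
  also have "\<dots> = Re (\<Sum>x\<in>R. \<Sum>y\<in>R. polar_quotient x y) + 2 * real (card R) * (\<Sum>x\<in>R. \<bar>ln (cmod x)\<bar>)"
    by (simp add: sum.distrib flip: sum_distrib_left)
  finally show ?thesis .
qed

text \<open>Numbers whose mutual distances are bounded below on average have spread-out arguments. The
  energy of the regularized kernel is compared with the hypothesis on \<open>log|x-y|\<close> off the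
  diagonal, and the diagonal contributes \<open>-dlog(1-r) = dlog d\<close> for \<open>r = 1 - 1/d\<close>.\<close>
lemma angular_estimate:
  fixes R :: "complex set"
  assumes fin: "finite R" and nz: "0 \<notin> R" and d: "card R \<ge> 2"
    and disc: "0 \<le> 2 * real (card R) * l + (\<Sum>(x, y)\<in>{(x, y) \<in> R \<times> R. x \<noteq> y}. ln (cmod (x - y)))"
    and l: "l \<ge> 0"
  shows "(cmod (\<Sum>x\<in>R. sgn x))\<^sup>2 \<le> 2 * real (card R) * ln (real (card R)) + 2 * real (card R)
    + 4 * real (card R) * (l + (\<Sum>x\<in>R. log_plus (cmod x))) + 2 * real (card R) * (\<Sum>x\<in>R. \<bar>ln (cmod x)\<bar>)"
proof -
  define D where "D = real (card R)"
  have D: "D \<ge> 2" using d by (simp add: D_def)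
  \<comment> \<open>\<open>1 - r = 1 / d\<close> makes the diagonal contribute \<open>d log d\<close>, while the regularization costs only \<open>- (d\<^sup>2 / 2) log r\<close>, at most \<open>d\<close>.\<close>
  define r where "r = 1 - 1 / D"
  have r: "0 < r" "r < 1" "1 / 2 \<le> r" "1 - r = 1 / D" using D by (auto simp: r_def field_simps)
  define P where "P = {(x, y) \<in> R \<times> R. x \<noteq> y}"
  define E where "E x y = - ln (cmod (1 - of_real r * polar_quotient x y))" for x y
  define H where "H = (\<Sum>x\<in>R. log_plus (cmod x))"
  have PR: "P \<subseteq> R \<times> R" by (auto simp: P_def)
  have H0: "H \<ge> 0" unfolding H_def by (intro sum_nonneg log_plus_nonneg)
  have lnr: "- ln r / 2 \<le> 1 / D"
  proof -
    have "- ln r = ln (1 / r)" using r by (simp add: ln_div)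
    also have "\<dots> \<le> 1 / r - 1" using r by (intro ln_le_minus_one) simp
    also have "\<dots> = (1 / D) / r" using r D by (simp add: r_def field_simps)
    also have "\<dots> \<le> (1 / D) / (1 / 2)" using r D by (intro divide_left_mono) auto
    finally show ?thesis by simp
  qed
  have lnr0: "ln r \<le> 0" using r by simp
  have diag: "E x x = ln D" if "x \<in> R" for x
  proof -
    have "cmod (1 - of_real r * polar_quotient x x) = 1 / D"
      using that nz r polar_quotient_self[of x] by (metis (no_types, lifting) mult.right_neutral norm_of_real of_real_1 of_real_diff abs_of_pos diff_gt_0_iff_gt)
    then show ?thesis using D by (simp add: E_def ln_div)
  qed
  have off: "E x y \<le> 1 / D + log_plus (cmod x) + log_plus (cmod y) - ln (cmod (x - y))"
    if "(x, y) \<in> P" for x y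
  proof -
    have xy: "x \<in> R" "y \<in> R" "x \<noteq> y" "x \<noteq> 0" "y \<noteq> 0" using that nz by (auto simp: P_def)
    define M where "M = max (cmod x) (cmod y)"
    have M: "M > 0" using xy by (simp add: M_def less_max_iff_disj)
    have dist: "cmod (x - y) = M * cmod (1 - polar_quotient x y)"
      unfolding M_def using norm_diff_eq_polar xy by blast
    have "cmod (x - y) > 0" using xy by simp
    then have pz: "cmod (1 - polar_quotient x y) > 0" using dist M by (simp add: zero_less_mult_iff)
    have "ln (sqrt r * cmod (1 - polar_quotient x y)) \<le> ln (cmod (1 - of_real r * polar_quotient x y))"
      using r xy pz norm_polar_quotient_le[of x y] by (intro ln_mono norm_one_minus_scaled) auto
    moreover have "ln (sqrt r * cmod (1 - polar_quotient x y)) = ln r / 2 + ln (cmod (1 - polar_quotient x y))"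
      using r pz by (simp add: ln_mult ln_sqrt)
    moreover have "ln (cmod (x - y)) = ln M + ln (cmod (1 - polar_quotient x y))"
      unfolding dist using M pz by (simp add: ln_mult)
    moreover have "ln M \<le> log_plus (cmod x) + log_plus (cmod y)"
      unfolding M_def log_plus_def by (auto simp: max_def)
    ultimately show ?thesis using lnr unfolding E_def by linarith
  qed
  have split: "R \<times> R = P \<union> (\<lambda>x. (x, x)) ` R" by (auto simp: P_def)
  have "(\<Sum>x\<in>R. \<Sum>y\<in>R. E x y) = (\<Sum>(x, y)\<in>R \<times> R. E x y)" by (rule sum.cartesian_product)
  also have "\<dots> = (\<Sum>(x, y)\<in>P. E x y) + (\<Sum>(x, y)\<in>(\<lambda>x. (x, x)) ` R. E x y)"
    unfolding split
  proof (rule sum.union_disjoint)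
    show "finite P" using PR fin by (meson finite_SigmaI finite_subset)
    show "finite ((\<lambda>x. (x, x)) ` R)" using fin by simp
    show "P \<inter> (\<lambda>x. (x, x)) ` R = {}" by (auto simp: P_def)
  qed
  also have "(\<Sum>(x, y)\<in>(\<lambda>x. (x, x)) ` R. E x y) = (\<Sum>x\<in>R. E x x)"
    by (subst sum.reindex) (auto simp: inj_on_def)
  also have "(\<Sum>x\<in>R. E x x) = D * ln D" using diag by (simp add: D_def)
  also have "(\<Sum>(x, y)\<in>P. E x y)
    \<le> (\<Sum>(x, y)\<in>P. 1 / D + log_plus (cmod x) + log_plus (cmod y)) - (\<Sum>(x, y)\<in>P. ln (cmod (x - y)))"
    unfolding sum_subtractf[symmetric] using off by (intro sum_mono) (auto simp: case_prod_unfold)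
  also have "(\<Sum>(x, y)\<in>P. 1 / D + log_plus (cmod x) + log_plus (cmod y))
    \<le> (\<Sum>(x, y)\<in>R \<times> R. 1 / D + log_plus (cmod x) + log_plus (cmod y))"
  proof (rule sum_mono2[OF _ PR])
    show "finite (R \<times> R)" using fin by simp
  next
    fix b assume "b \<in> R \<times> R - P"
    show "0 \<le> (case b of (x, y) \<Rightarrow> 1 / D + log_plus (cmod x) + log_plus (cmod y))"
      using D by (auto simp: case_prod_unfold log_plus_nonneg intro!: add_nonneg_nonneg)
  qed
  also have "(\<Sum>(x, y)\<in>R \<times> R. 1 / D + log_plus (cmod x) + log_plus (cmod y)) = D + 2 * D * H"
  proof -
    have "(\<Sum>(x, y)\<in>R \<times> R. 1 / D + log_plus (cmod x) + log_plus (cmod y))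
      = (\<Sum>x\<in>R. \<Sum>y\<in>R. 1 / D + log_plus (cmod x) + log_plus (cmod y))"
      by (rule sum.cartesian_product[symmetric])
    also have "\<dots> = D * (D * (1 / D)) + D * H + D * H"
      unfolding H_def D_def sum.distrib by (simp add: sum_distrib_left)
    finally show ?thesis using D by simp
  qed
  finally have "(\<Sum>x\<in>R. \<Sum>y\<in>R. E x y) \<le> D + 2 * D * H + 2 * D * l + D * ln D"
    using disc unfolding P_def[symmetric] D_def[symmetric] by linarith
  then have main: "r * Re (\<Sum>x\<in>R. \<Sum>y\<in>R. polar_quotient x y) \<le> D + 2 * D * H + 2 * D * l + D * ln D"
    using polar_energy_bound[OF fin nz r(1,2)] unfolding E_def by linarith
  define B where "B = D + 2 * D * H + 2 * D * l + D * ln D"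
  have B0: "B \<ge> 0" unfolding B_def using D H0 l by (intro add_nonneg_nonneg mult_nonneg_nonneg) auto
  have "Re (\<Sum>x\<in>R. \<Sum>y\<in>R. polar_quotient x y) \<le> 2 * B"
  proof (cases "Re (\<Sum>x\<in>R. \<Sum>y\<in>R. polar_quotient x y) \<le> 0")
    case False
    then have "1 / 2 * Re (\<Sum>x\<in>R. \<Sum>y\<in>R. polar_quotient x y) \<le> r * Re (\<Sum>x\<in>R. \<Sum>y\<in>R. polar_quotient x y)"
      using r by (intro mult_right_mono) auto
    then show ?thesis using main[folded B_def] by linarith
  qed (use B0 in linarith)
  then show ?thesis using sgn_sum_le_polar_sum[OF fin nz]
    unfolding B_def D_def[symmetric] H_def[symmetric] by (simp add: algebra_simps)
qed

text \<open>For \<open>d \<ge> 2\<close> the discriminant bound is the distance hypothesis of the preceding estimate,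
  with \<open>l\<close> the logarithm of the leading coefficient; for \<open>d = 1\<close> the right-hand side exceeds
  one.\<close>
theorem conjugate_angles_estimate:
  assumes x: "algebraic x" "x \<noteq> 0"
  shows "(cmod (\<Sum>y\<in>conjugates x. sgn y) / real (alg_degree x))\<^sup>2
    \<le> 8 * weil_height x + 8 * ln (2 * real (alg_degree x)) / real (alg_degree x)"
proof -
  let ?C = "conjugates x"
  define d where "d = real (alg_degree x)"
  have d1: "d \<ge> 1" using alg_degree_pos[OF x(1)] by (simp add: d_def)
  have nz: "0 \<notin> ?C" using conjugates_nonzero[OF x] by blast
  have h0: "weil_height x \<ge> 0" using weil_height_nonneg[OF x(1)] .
  have ln2: "ln (2::real) \<ge> 1 / 2" using ln2_ge_two_thirds by simp
  have fin: "finite ?C" using finite_conjugates[OF x(1)] .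
  have card: "real (card ?C) = d" by (simp add: card_conjugates[OF x(1)] d_def)
  have "(cmod (\<Sum>y\<in>?C. sgn y))\<^sup>2 \<le> 8 * d\<^sup>2 * weil_height x + 8 * d * ln (2 * d)"
  proof (cases "alg_degree x \<ge> 2")
    case True
    define l where "l = ln (real_of_int (lead_coeff (min_int_poly x)))"
    let ?P = "{(y, z) \<in> ?C \<times> ?C. y \<noteq> z}"
    have lc: "real_of_int (lead_coeff (min_int_poly x)) \<ge> 1" using min_int_poly_lead_pos[OF x(1)] by linarith
    have finP: "finite ?P" by (rule finite_subset[of _ "?C \<times> ?C"]) (use fin in auto)
    have "0 \<le> ln (real_of_int (lead_coeff (min_int_poly x)) ^ (2 * alg_degree x) * (\<Prod>(y, z)\<in>?P. cmod (y - z)))"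
      using discriminant_lower_bound[OF x(1)] by (rule ln_ge_zero)
    also have "\<dots> = ln (real_of_int (lead_coeff (min_int_poly x)) ^ (2 * alg_degree x)) + ln (\<Prod>(y, z)\<in>?P. cmod (y - z))"
      using lc finP by (intro ln_mult_pos prod_pos) auto
    also have "ln (\<Prod>(y, z)\<in>?P. cmod (y - z)) = (\<Sum>p\<in>?P. ln (case p of (y, z) \<Rightarrow> cmod (y - z)))"
      using finP by (intro ln_prod) auto
    also have "ln (real_of_int (lead_coeff (min_int_poly x)) ^ (2 * alg_degree x)) = 2 * real (card ?C) * l"
      using lc by (simp add: l_def ln_realpow card_conjugates[OF x(1)])
    finally have disc: "0 \<le> 2 * real (card ?C) * l + (\<Sum>(y, z)\<in>?P. ln (cmod (y - z)))"
      by (simp add: case_prod_unfold)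
    have l0: "l \<ge> 0" using lc by (simp add: l_def)
    have "(cmod (\<Sum>y\<in>?C. sgn y))\<^sup>2 \<le> 2 * d * ln d + 2 * d + 4 * d * (l + (\<Sum>y\<in>?C. log_plus (cmod y)))
        + 2 * d * (\<Sum>y\<in>?C. \<bar>ln (cmod y)\<bar>)"
      using angular_estimate[OF fin nz _ disc l0] True card_conjugates[OF x(1)] by (simp add: card d_def)
    also have "l + (\<Sum>y\<in>?C. log_plus (cmod y)) = d * weil_height x"
      using weil_height_eq[OF x(1)] by (simp add: l_def d_def)
    also have "2 * d * (\<Sum>y\<in>?C. \<bar>ln (cmod y)\<bar>) \<le> 2 * d * (2 * (d * weil_height x))"
      using sum_abs_ln_conjugates_le[OF x] d1 by (intro mult_left_mono) (auto simp: d_def)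
    also have "2 * d * ln d + 2 * d \<le> 8 * d * ln (2 * d)"
    proof -
      have "2 * ln d + 2 \<le> 8 * ln 2 + 8 * ln d" using ln2 d1 ln_ge_zero[OF d1] by linarith
      then have "d * (2 * ln d + 2) \<le> d * (8 * ln 2 + 8 * ln d)" using d1 by (intro mult_left_mono) auto
      then show ?thesis using d1 by (simp add: ln_mult algebra_simps)
    qed
    finally show ?thesis by (simp add: power2_eq_square algebra_simps)
  next
    case False
    then have "d = 1" using alg_degree_pos[OF x(1)] by (simp add: d_def)
    have "cmod (\<Sum>y\<in>?C. sgn y) \<le> (\<Sum>y\<in>?C. cmod (sgn y))" by (rule norm_sum)
    also have "\<dots> \<le> (\<Sum>y\<in>?C. 1)" by (intro sum_mono) (simp add: norm_sgn)
    also have "\<dots> = 1" using card \<open>d = 1\<close> by simp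
    finally have "(cmod (\<Sum>y\<in>?C. sgn y))\<^sup>2 \<le> 1" by (simp add: power_le_one)
    also have "1 \<le> 8 * d\<^sup>2 * weil_height x + 8 * d * ln (2 * d)" using \<open>d = 1\<close> ln2 h0 by simp
    finally show ?thesis .
  qed
  then have "(cmod (\<Sum>y\<in>?C. sgn y))\<^sup>2 / d\<^sup>2 \<le> (8 * d\<^sup>2 * weil_height x + 8 * d * ln (2 * d)) / d\<^sup>2"
    by (intro divide_right_mono) auto
  also have "\<dots> = 8 * weil_height x + 8 * ln (2 * d) / d"
    using d1 by (simp add: add_divide_distrib power2_eq_square)
  finally show ?thesis by (simp add: power_divide d_def)
qed

section \<open>Character sums over Galois orbits\<close>

text \<open>\<open>log(2x)/x\<close> decreases for \<open>x \<ge> e/2\<close> and takes the same value at \<open>1\<close> and \<open>2\<close>, so it is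
  antitone on the positive integers.\<close>
lemma ln_double_div_antimono:
  assumes "1 \<le> m" "m \<le> n"
  shows "ln (2 * real n) / real n \<le> ln (2 * real m) / real m"
  using assms(2,1)
proof (induction n rule: dec_induct)
  case (step n)
  have n: "n \<ge> 1" using step by simp
  have le: "real n * ln (1 + 1 / real n) \<le> ln (2 * real n)"
  proof (cases "n = 1")
    case False
    have "ln (1 + 1 / real n) \<le> 1 / real n" using n by (intro ln_add_one_self_le_self) auto
    then have "real n * ln (1 + 1 / real n) \<le> real n * (1 / real n)" by (intro mult_left_mono) auto
    also have "\<dots> = 1" using n by simp
    also have "1 \<le> ln 2 + ln (2::real)" using ln2_ge_two_thirds by linarith
    also have "\<dots> \<le> ln 2 + ln (real n)" using False n by (intro add_left_mono ln_mono) auto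
    also have "\<dots> = ln (2 * real n)" using n by (simp add: ln_mult)
    finally show ?thesis .
  qed simp
  have "2 * real (Suc n) = 2 * real n * (1 + 1 / real n)" using n by (simp add: field_simps)
  then have "real n * ln (2 * real (Suc n)) = real n * (ln (2 * real n) + ln (1 + 1 / real n))"
    using n by (simp only: ln_mult_pos[of "2 * real n" "1 + 1 / real n"] add_pos_nonneg
        zero_less_one mult_pos_pos zero_less_numeral of_nat_0_less_iff divide_nonneg_nonneg
        of_nat_0_le_iff zero_le_one)
  also have "\<dots> \<le> ln (2 * real n) * real (Suc n)" using le by (simp add: algebra_simps)
  finally have "ln (2 * real (Suc n)) / real (Suc n) \<le> ln (2 * real n) / real n"
    using n by (simp add: divide_le_eq pos_le_divide_eq field_simps)
  then show ?case using step by simp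
qed simp

lemma real_norm_l1: "real (norm_l1 n) = (\<Sum>j\<in>UNIV. real (nat \<bar>n $ j\<bar>))"
proof -
  have "int (norm_l1 n) = (\<Sum>j\<in>UNIV. \<bar>n $ j\<bar>)" by (simp add: norm_l1_def sum_nonneg)
  then have "real_of_int (int (norm_l1 n)) = real_of_int (\<Sum>j\<in>UNIV. \<bar>n $ j\<bar>)" by (rule arg_cong)
  then show ?thesis by simp
qed

lemma norm_l1_pos:
  fixes n :: "int ^ 'n"
  assumes "n \<noteq> 0" shows "norm_l1 n > 0"
proof -
  obtain j where j: "n $ j \<noteq> 0" using assms by (auto simp: vec_eq_iff)
  have "\<bar>n $ j\<bar> \<le> (\<Sum>i\<in>UNIV. \<bar>n $ i\<bar>)" by (rule member_le_sum) auto
  then show ?thesis using j by (simp add: norm_l1_def)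
qed

lemma gen_degree_le: "n \<noteq> 0 \<Longrightarrow> gen_degree \<xi> \<le> norm_l1 n * alg_degree (monomial_char n \<xi>)"
  unfolding gen_degree_def by (rule cINF_lower) auto

lemma gen_degree_greatest:
  fixes \<xi> :: "complex ^ 'n"
  assumes "\<And>n. n \<noteq> 0 \<Longrightarrow> k \<le> norm_l1 n * alg_degree (monomial_char n \<xi>)"
  shows "k \<le> gen_degree \<xi>"
proof -
  have "(axis j 1 :: int ^ 'n) \<noteq> 0" for j by (simp add: axis_eq_0_iff)
  then have "UNIV - {0 :: int ^ 'n} \<noteq> {}" by blast
  then show ?thesis unfolding gen_degree_def using assms by (intro cINF_greatest) auto
qed

lemma gen_degree_pos:
  assumes "\<xi> \<in> alg_torus" shows "gen_degree \<xi> \<ge> 1"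
proof (rule gen_degree_greatest)
  fix n :: "int ^ 'a" assume "n \<noteq> 0"
  then have "norm_l1 n * alg_degree (monomial_char n \<xi>) > 0"
    using norm_l1_pos alg_degree_pos[OF monomial_char_algebraic[OF assms]] by simp
  then show "1 \<le> norm_l1 n * alg_degree (monomial_char n \<xi>)" by linarith
qed

lemma weil_height_vec_nonneg: "\<xi> \<in> alg_torus \<Longrightarrow> weil_height_vec \<xi> \<ge> 0"
  unfolding weil_height_vec_def by (intro sum_nonneg weil_height_nonneg alg_torusD)

lemma height_D_pos:
  assumes "\<xi> \<in> alg_torus" shows "height_D \<xi> > 0"
proof -
  have "ln (2 * real (gen_degree \<xi>)) > 0" using gen_degree_pos[OF assms] by (intro ln_gt_zero) simp
  then show ?thesis unfolding height_D_def
    using weil_height_vec_nonneg[OF assms] gen_degree_pos[OF assms] by (intro add_nonneg_pos divide_pos_pos) auto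
qed

lemma height_D_ge: "\<xi> \<in> alg_torus \<Longrightarrow> weil_height_vec \<xi> \<le> height_D \<xi>"
  unfolding height_D_def using gen_degree_pos[of \<xi>] by simp

text \<open>The generalized degree is made for this step: \<open>D \<le> |n|_1 d\<close> and antitonicity give \<open>log(2d)/d
  \<le> |n|_1 log(2D)/D\<close>, while subadditivity gives \<open>h(\<eta>) \<le> |n|_1 h(\<xi>)\<close>.\<close>
lemma monomial_height_le_height_D:
  fixes \<xi> :: "complex ^ 'n" and n :: "int ^ 'n"
  assumes \<xi>: "\<xi> \<in> alg_torus" and n: "n \<noteq> 0"
  defines "\<eta> \<equiv> monomial_char n \<xi>"
  shows "8 * weil_height \<eta> + 8 * ln (2 * real (alg_degree \<eta>)) / real (alg_degree \<eta>)
    \<le> 24 * real (norm_l1 n) * height_D \<xi>"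
proof -
  define d where "d = alg_degree \<eta>"
  define m where "m = norm_l1 n"
  define D where "D = gen_degree \<xi>"
  have \<eta>: "algebraic \<eta>" unfolding \<eta>_def by (rule monomial_char_algebraic[OF \<xi>])
  have d: "d \<ge> 1" using alg_degree_pos[OF \<eta>] by (simp add: d_def)
  have m: "m \<ge> 1" using norm_l1_pos[OF n] by (simp add: m_def)
  have D: "D \<ge> 1" using gen_degree_pos[OF \<xi>] by (simp add: D_def)
  have "weil_height \<eta> \<le> (\<Sum>j\<in>UNIV. real (nat \<bar>n $ j\<bar>) * weil_height (\<xi> $ j))"
    unfolding \<eta>_def by (rule weil_height_monomial_le[OF \<xi>])
  also have "\<dots> \<le> (\<Sum>j\<in>UNIV. real (nat \<bar>n $ j\<bar>) * weil_height_vec \<xi>)"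
    unfolding weil_height_vec_def
    by (intro sum_mono mult_left_mono member_le_sum weil_height_nonneg alg_torusD[OF \<xi>]) auto
  also have "\<dots> = real m * weil_height_vec \<xi>"
    by (simp add: m_def real_norm_l1 sum_distrib_right)
  finally have h: "weil_height \<eta> \<le> real m * weil_height_vec \<xi>" .
  have "D \<le> m * d" unfolding D_def m_def d_def \<eta>_def by (rule gen_degree_le[OF n])
  then have "ln (2 * real (m * d)) / real (m * d) \<le> ln (2 * real D) / real D"
    using D by (rule ln_double_div_antimono[rotated])
  then have "real m * (ln (2 * real (m * d)) / real (m * d)) \<le> real m * (ln (2 * real D) / real D)"
    by (intro mult_left_mono) auto
  moreover have "real m * (ln (2 * real (m * d)) / real (m * d)) = ln (2 * real (m * d)) / real d"
    using m by simp
  moreover have "ln (2 * real d) / real d \<le> ln (2 * real (m * d)) / real d"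
    using m d by (intro divide_right_mono ln_mono) auto
  ultimately have g: "ln (2 * real d) / real d \<le> real m * (ln (2 * real D) / real D)" by linarith
  have "8 * weil_height \<eta> + 8 * ln (2 * real d) / real d
    \<le> 24 * (real m * weil_height_vec \<xi>) + 8 * (real m * (ln (2 * real D) / real D))"
    using h g weil_height_nonneg[OF \<eta>] by linarith
  also have "\<dots> = 24 * real m * height_D \<xi>"
    unfolding height_D_def D_def[symmetric] by (simp add: algebra_simps)
  finally show ?thesis by (simp add: d_def m_def)
qed

text \<open>The normalized sum \<open>m\<close> satisfies \<open>m^2 \<le> X\<close> and \<open>m \<le> 1\<close>. Since \<open>2\<gamma> \<le> 1\<close>, it follows that \<open>m \<le>
  m^(2\<gamma>) \<le> X^\<gamma>\<close>.\<close>
theorem orbit_character_sum_le: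
  fixes \<xi> :: "complex ^ 'n" and n :: "int ^ 'n"
  assumes \<xi>: "\<xi> \<in> alg_torus" and n: "n \<noteq> 0" and \<gamma>: "0 < \<gamma>" "\<gamma> \<le> 1 / 2"
  shows "cmod (\<Sum>\<alpha>\<in>galois_orbit \<xi>. sgn (monomial_char n \<alpha>)) / real (card (galois_orbit \<xi>))
    \<le> (24 * real (norm_l1 n) * height_D \<xi>) powr \<gamma>"
proof -
  define \<eta> where "\<eta> = monomial_char n \<xi>"
  let ?S = "galois_orbit \<xi>"
  define m where "m = cmod (\<Sum>\<alpha>\<in>?S. sgn (monomial_char n \<alpha>)) / real (card ?S)"
  define X where "X = 24 * real (norm_l1 n) * height_D \<xi>"
  have \<eta>: "algebraic \<eta>" "\<eta> \<noteq> 0"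
    unfolding \<eta>_def using monomial_char_algebraic[OF \<xi>] monomial_char_nonzero[OF \<xi>] by auto
  have cpos: "card ?S > 0" by (rule card_galois_orbit_pos[OF \<xi>])
  have fpos: "fibre_size \<xi> n > 0" using card_orbit_eq[OF \<xi>, of n] cpos by (cases "fibre_size \<xi> n") auto
  have "m = cmod (\<Sum>y\<in>conjugates \<eta>. sgn y) / real (alg_degree \<eta>)"
    unfolding m_def sum_over_orbit[OF \<xi>] card_orbit_eq[OF \<xi>, of n] \<eta>_def[symmetric]
    using fpos by (simp add: norm_mult)
  then have mX: "m\<^sup>2 \<le> X"
    using conjugate_angles_estimate[OF \<eta>] monomial_height_le_height_D[OF \<xi> n] by (simp add: \<eta>_def X_def)
  have "cmod (\<Sum>\<alpha>\<in>?S. sgn (monomial_char n \<alpha>)) \<le> (\<Sum>\<alpha>\<in>?S. cmod (sgn (monomial_char n \<alpha>)))" by (rule norm_sum)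
  also have "\<dots> \<le> (\<Sum>\<alpha>\<in>?S. 1)" by (intro sum_mono) (simp add: norm_sgn)
  finally have m1: "m \<le> 1" using cpos by (simp add: m_def divide_le_eq)
  have m0: "m \<ge> 0" by (simp add: m_def)
  show ?thesis
  proof (cases "m = 0")
    case True
    then show ?thesis unfolding m_def[symmetric] by simp
  next
    case False
    then have mp: "m > 0" using m0 by simp
    have "m = m powr 1" using mp by simp
    also have "\<dots> \<le> m powr (2 * \<gamma>)" using mp m1 \<gamma> by (intro powr_mono') auto
    also have "\<dots> = (m\<^sup>2) powr \<gamma>" using mp by (simp add: powr_powr flip: powr_numeral)
    also have "\<dots> \<le> X powr \<gamma>" using mX \<gamma> by (intro powr_mono2) auto
    finally show ?thesis by (simp add: m_def X_def)
  qed
qed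

section \<open>Characters of the torus\<close>

definition torus_char :: "int ^ 'n \<Rightarrow> real ^ 'n \<Rightarrow> complex" where
  "torus_char n \<theta> = cis (2 * pi * (\<Sum>j\<in>UNIV. of_int (n $ j) * \<theta> $ j))"

lemma torus_char_prod: "torus_char n \<theta> = (\<Prod>j\<in>UNIV. cis (2 * pi * of_int (n $ j) * \<theta> $ j))"
proof -
  have "(\<Prod>j\<in>A. cis (f j)) = cis (\<Sum>j\<in>A. f j)" for A and f :: "'a \<Rightarrow> real"
    by (induction A rule: infinite_finite_induct) (simp_all add: cis_mult)
  then show ?thesis unfolding torus_char_def by (simp add: sum_distrib_left mult.assoc)
qed

lemma torus_char_diff: "torus_char n (\<theta> - \<phi>) = torus_char n \<theta> * torus_char (- n) \<phi>"
  unfolding torus_char_def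
  by (simp add: cis_mult right_diff_distrib sum_subtractf sum_negf)

lemma norm_torus_char [simp]: "cmod (torus_char n \<theta>) = 1" by (simp add: torus_char_def)

lemma torus_char_0 [simp]: "torus_char 0 \<theta> = 1" by (simp add: torus_char_def)

lemma continuous_on_torus_char [continuous_intros]:
  "continuous_on A f \<Longrightarrow> continuous_on A (\<lambda>x. torus_char n (f x))"
  unfolding torus_char_def by (intro continuous_intros)

lemma fourier_coeff_eq: "fourier_coeff f n = torus_integral (\<lambda>\<theta>. f \<theta> * torus_char (- n) \<theta>)"
proof -
  have "exp (- 2 * pi * \<i> * (\<Sum>j\<in>UNIV. of_int (n $ j) * of_real (\<theta> $ j))) = torus_char (- n) \<theta>" for \<theta>
    unfolding torus_char_def cis_conv_exp
    by (rule arg_cong[of _ _ exp]) (simp add: sum_negf mult_ac)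
  then show ?thesis unfolding fourier_coeff_def by simp
qed

lemma sgn_power_int_complex: "sgn (x powi k) = sgn (x :: complex) powi k"
proof -
  have "sgn (x ^ n) = sgn x ^ n" for x :: complex and n
    by (induction n) (simp_all add: sgn_mult)
  then show ?thesis by (simp add: power_int_def sgn_inverse)
qed

lemma sgn_monomial_char:
  fixes \<alpha> :: "complex ^ 'n"
  assumes "\<And>j. \<alpha> $ j \<noteq> 0"
  shows "sgn (monomial_char n \<alpha>) = torus_char n (angle_coords \<alpha>)"
proof -
  have "sgn (\<Prod>j\<in>A. f j) = (\<Prod>j\<in>A. sgn (f j))" for A and f :: "'n \<Rightarrow> complex"
    by (induction A rule: infinite_finite_induct) (simp_all add: sgn_mult)
  then have "sgn (monomial_char n \<alpha>) = (\<Prod>j\<in>UNIV. cis (Arg (\<alpha> $ j)) powi (n $ j))"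
    unfolding monomial_char_def using assms by (simp add: cis_Arg sgn_power_int_complex)
  then show ?thesis unfolding torus_char_prod angle_coords_def by (simp add: cis_power_int mult_ac)
qed

section \<open>Integration over the torus\<close>

lemma set_integrable_cube:
  fixes f :: "real ^ 'n \<Rightarrow> complex"
  assumes "continuous_on UNIV f" shows "set_integrable lborel (cbox 0 1) f"
  unfolding set_integrable_def
  by (rule borel_integrable_compact) (use assms continuous_on_subset in auto)

lemma torus_integral_add:
  assumes "continuous_on UNIV f" "continuous_on UNIV g"
  shows "torus_integral (\<lambda>\<theta>. f \<theta> + g \<theta>) = torus_integral f + torus_integral g"
  unfolding torus_integral_def by (intro set_integral_add set_integrable_cube assms)

lemma torus_integral_cmult: "torus_integral (\<lambda>\<theta>. c * f \<theta>) = c * torus_integral f"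
  unfolding torus_integral_def by simp

lemma torus_integral_sum:
  assumes "\<And>i. i \<in> A \<Longrightarrow> continuous_on UNIV (f i)"
  shows "torus_integral (\<lambda>\<theta>. \<Sum>i\<in>A. f i \<theta>) = (\<Sum>i\<in>A. torus_integral (f i))"
  using assms
proof (induction A rule: infinite_finite_induct)
  case (insert i A)
  then show ?case by (simp add: torus_integral_add continuous_on_sum)
qed (simp_all add: torus_integral_def set_lebesgue_integral_def)

lemma lborel_integral_prod_inner:
  fixes f :: "'a::euclidean_space \<Rightarrow> real \<Rightarrow> complex"
  assumes "\<And>b. b \<in> Basis \<Longrightarrow> integrable lborel (f b)"
  shows "(integral\<^sup>L (lborel) (\<lambda>x. \<Prod>b\<in>Basis. f b (x \<bullet> b))) = (\<Prod>b\<in>Basis. integral\<^sup>L (lborel) (\<lambda>t. f b t))"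
proof -
  interpret product_sigma_finite "\<lambda>b::'a. lborel :: real measure" ..
  have [measurable]: "f b \<in> borel_measurable borel" if "b \<in> Basis" for b
    using borel_measurable_integrable[OF assms[OF that]] by simp
  have "(integral\<^sup>L (lborel) (\<lambda>x. \<Prod>b\<in>Basis. f b (x \<bullet> b)))
    = (integral\<^sup>L (distr (\<Pi>\<^sub>M b\<in>Basis. lborel) borel (\<lambda>g. \<Sum>b\<in>Basis. g b *\<^sub>R b)) (\<lambda>x. \<Prod>b\<in>(Basis::'a set). f b (x \<bullet> b)))"
    by (subst lborel_eq) simp
  also have "\<dots> = (integral\<^sup>L (\<Pi>\<^sub>M b\<in>Basis. lborel) (\<lambda>g. \<Prod>b\<in>(Basis::'a set). f b ((\<Sum>b\<in>Basis. g b *\<^sub>R b) \<bullet> b)))"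
    by (rule integral_distr) measurable
  also have "\<dots> = (integral\<^sup>L (\<Pi>\<^sub>M b\<in>Basis. lborel) (\<lambda>g. \<Prod>b\<in>(Basis::'a set). f b (g b)))"
    by (intro Bochner_Integration.integral_cong refl prod.cong) simp_all
  also have "\<dots> = (\<Prod>b\<in>Basis. integral\<^sup>L (lborel) (\<lambda>t. f b t))"
    by (rule product_integral_prod) (use assms in auto)
  finally show ?thesis .
qed

lemma Basis_real_vec: "(Basis :: (real ^ 'n) set) = range (\<lambda>j. axis j 1)"
  by (auto simp: Basis_vec_def)

lemma torus_integral_prod:
  fixes f :: "'n::finite \<Rightarrow> real \<Rightarrow> complex"
  assumes "\<And>j. continuous_on {0..1} (f j)"
  shows "torus_integral (\<lambda>\<theta> :: real ^ 'n. \<Prod>j\<in>UNIV. f j (\<theta> $ j)) = (\<Prod>j\<in>UNIV. integral {0..1} (f j))"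
proof -
  have inj: "inj (\<lambda>j. axis j (1::real) :: real ^ 'n)" by (auto simp: inj_on_def axis_eq_axis)
  define g where "g b = (\<lambda>t. indicator {0..1} t *\<^sub>R f (inv (\<lambda>j. axis j (1::real) :: real ^ 'n) b) t)" for b
  have g: "g (axis j 1) = (\<lambda>t. indicator {0..1} t *\<^sub>R f j t)" for j
    by (simp add: g_def inv_f_f[OF inj])
  have int: "set_integrable lborel {0..1} (f j)" for j
    using borel_integrable_compact[OF compact_Icc assms] by (simp add: set_integrable_def)
  have ind: "indicator (cbox 0 1) \<theta> = (\<Prod>j\<in>UNIV. indicator {0..1} (\<theta> $ j) :: real)" for \<theta> :: "real ^ 'n"
    by (auto simp: indicator_def mem_box_cart prod_zero_iff split: if_splits)
  have "torus_integral (\<lambda>\<theta> :: real ^ 'n. \<Prod>j\<in>UNIV. f j (\<theta> $ j))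
    = (integral\<^sup>L (lborel) (\<lambda>\<theta>. \<Prod>j\<in>UNIV. g (axis j 1) ((\<theta> :: real ^ 'n) \<bullet> axis j 1)))"
    unfolding torus_integral_def set_lebesgue_integral_def
    by (intro Bochner_Integration.integral_cong refl)
       (simp add: ind g inner_axis scaleR_conv_of_real prod.distrib)
  also have "\<dots> = (integral\<^sup>L (lborel) (\<lambda>\<theta>. \<Prod>b\<in>Basis. g b ((\<theta> :: real ^ 'n) \<bullet> b)))"
    unfolding Basis_real_vec by (subst prod.reindex[OF inj]) simp
  also have "\<dots> = (\<Prod>b\<in>Basis. integral\<^sup>L (lborel) (\<lambda>t. g b t))"
    by (rule lborel_integral_prod_inner) (use int in \<open>auto simp: Basis_real_vec g set_integrable_def\<close>)
  also have "\<dots> = (\<Prod>j\<in>UNIV. integral\<^sup>L (lborel) (\<lambda>t. g (axis j 1) t))"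
    unfolding Basis_real_vec by (subst prod.reindex[OF inj]) simp
  also have "\<dots> = (\<Prod>j\<in>UNIV. integral {0..1} (f j))"
    using set_borel_integral_eq_integral(2)[OF int] by (simp add: g set_lebesgue_integral_def)
  finally show ?thesis .
qed

lemma integral_cis:
  "integral {0..1} (\<lambda>t. cis (2 * pi * of_int k * t)) = (if k = 0 then 1 else 0)"
proof (cases "k = 0")
  case False
  define c where "c = 2 * pi * of_int k"
  have c: "c \<noteq> 0" using False by (simp add: c_def)
  have "((\<lambda>t. cis (c * t)) has_integral (cis (c * 1) / (\<i> * of_real c) - cis (c * 0) / (\<i> * of_real c))) {0..1}"
  proof (rule fundamental_theorem_of_calculus)
    fix t :: real assume "t \<in> {0..1}"
    have "((\<lambda>t. exp (\<i> * of_real c * of_real t) / (\<i> * of_real c)) has_vector_derivative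
        exp (\<i> * of_real c * of_real t)) (at t within {0..1})"
      using c by (auto intro!: derivative_eq_intros has_vector_derivative_real_field simp: field_simps)
    then show "((\<lambda>t. cis (c * t) / (\<i> * of_real c)) has_vector_derivative cis (c * t)) (at t within {0..1})"
      by (simp add: cis_conv_exp mult.assoc)
  qed simp
  moreover have "cis (c * 1) = 1" using cis_multiple_2pi[of "of_int k"] by (simp add: c_def mult.commute mult.left_commute)
  ultimately have "((\<lambda>t. cis (c * t)) has_integral 0) {0..1}" by simp
  then show ?thesis using False by (simp add: c_def integral_unique)
qed simp

lemma torus_integral_char: "torus_integral (torus_char n) = (if n = 0 then 1 else 0)"
proof -
  have "torus_integral (torus_char n) = (\<Prod>j\<in>UNIV. integral {0..1} (\<lambda>t. cis (2 * pi * of_int (n $ j) * t)))"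
    unfolding torus_char_prod[abs_def] by (rule torus_integral_prod) (intro continuous_intros)
  also have "\<dots> = (if n = 0 then 1 else 0)"
    by (auto simp: integral_cis vec_eq_iff prod_zero_iff)
  finally show ?thesis .
qed

section \<open>A positive kernel\<close>

definition vp_const :: "nat \<Rightarrow> real" where
  "vp_const M = 4 ^ M / real ((2 * M) choose M)"

text \<open>The kernel of de la Vallee Poussin, with integral one over the torus. It is nonnegative and
  decays geometrically in \<open>M\<close> away from the lattice points, and its Fourier coefficients are
  quotients of binomial coefficients, hence lie between \<open>0\<close> and \<open>1\<close>.\<close>
definition vp_kernel :: "nat \<Rightarrow> real ^ 'n \<Rightarrow> real" where
  "vp_kernel M \<theta> = (\<Prod>j\<in>UNIV. vp_const M * cos (pi * \<theta> $ j) ^ (2 * M))"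

text \<open>A function \<open>g\<close> selects one term of the binomial expansion in each variable; the term of
  index \<open>g_j\<close> has frequency \<open>g_j - M\<close>.\<close>
definition vp_index :: "nat \<Rightarrow> ('n \<Rightarrow> nat) \<Rightarrow> int ^ 'n" where
  "vp_index M g = (\<chi> j. int (g j) - int M)"

definition vp_weight :: "nat \<Rightarrow> ('n::finite \<Rightarrow> nat) \<Rightarrow> real" where
  "vp_weight M g = (\<Prod>j\<in>UNIV. real ((2 * M) choose g j) / real ((2 * M) choose M))"

text \<open>Binomial expansion of \<open>(e^(\<pi> i t) + e^(-\<pi> i t))^(2M)\<close>.\<close>
lemma vp_kernel_1d:
  "complex_of_real (vp_const M * cos (pi * t) ^ (2 * M))
    = (\<Sum>k\<le>2 * M. of_real (real ((2 * M) choose k) / real ((2 * M) choose M)) * cis (2 * pi * of_int (int k - int M) * t))"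
proof -
  have "complex_of_real (2 * cos (pi * t)) = cis (pi * t) + cis (- (pi * t))"
    by (simp add: complex_eq_iff)
  then have "complex_of_real ((2 * cos (pi * t)) ^ (2 * M)) = (cis (pi * t) + cis (- (pi * t))) ^ (2 * M)"
    by (simp only: of_real_power)
  also have "\<dots> = (\<Sum>k\<le>2 * M. of_nat ((2 * M) choose k) * cis (pi * t) ^ k * cis (- (pi * t)) ^ (2 * M - k))"
    by (rule binomial_ring)
  also have "\<dots> = (\<Sum>k\<le>2 * M. of_nat ((2 * M) choose k) * cis (2 * pi * of_int (int k - int M) * t))"
  proof (rule sum.cong[OF refl])
    fix k assume k: "k \<in> {..2 * M}"
    have "real k * (pi * t) + real (2 * M - k) * (- (pi * t)) = 2 * pi * of_int (int k - int M) * t"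
      using k by (simp add: of_nat_diff algebra_simps)
    then show "of_nat ((2 * M) choose k) * cis (pi * t) ^ k * cis (- (pi * t)) ^ (2 * M - k)
      = of_nat ((2 * M) choose k) * cis (2 * pi * of_int (int k - int M) * t)"
      by (simp only: Complex.DeMoivre mult.assoc[of "of_nat ((2 * M) choose k) :: complex"] cis_mult)
  qed
  finally have eq: "complex_of_real ((2 * cos (pi * t)) ^ (2 * M)) = \<dots>" .
  have "vp_const M * cos (pi * t) ^ (2 * M) = (2 * cos (pi * t)) ^ (2 * M) / real ((2 * M) choose M)"
    by (simp add: vp_const_def power_mult_distrib power_mult)
  then have "complex_of_real (vp_const M * cos (pi * t) ^ (2 * M))
    = complex_of_real ((2 * cos (pi * t)) ^ (2 * M)) / of_real (real ((2 * M) choose M))"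
    by (simp only: of_real_divide)
  also have "\<dots> = (\<Sum>k\<le>2 * M. of_nat ((2 * M) choose k) * cis (2 * pi * of_int (int k - int M) * t) / of_real (real ((2 * M) choose M)))"
    unfolding eq by (rule sum_divide_distrib)
  finally show ?thesis by simp
qed

lemma vp_kernel_expansion:
  fixes \<theta> :: "real ^ 'n"
  shows "complex_of_real (vp_kernel M \<theta>)
    = (\<Sum>g\<in>(\<Pi>\<^sub>E j\<in>UNIV. {..2 * M}). of_real (vp_weight M g) * torus_char (vp_index M g) \<theta>)"
proof -
  have "complex_of_real (vp_kernel M \<theta>) = (\<Prod>j\<in>UNIV. \<Sum>k\<le>2 * M. of_real (real ((2 * M) choose k) / real ((2 * M) choose M))
      * cis (2 * pi * of_int (int k - int M) * \<theta> $ j))"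
    unfolding vp_kernel_def of_real_prod vp_kernel_1d ..
  also have "\<dots> = (\<Sum>g\<in>(\<Pi>\<^sub>E j\<in>(UNIV::'n set). {..2 * M}). \<Prod>j\<in>UNIV. of_real (real ((2 * M) choose g j) / real ((2 * M) choose M))
      * cis (2 * pi * of_int (int (g j) - int M) * \<theta> $ j))"
    by (rule prod_sum_PiE) auto
  also have "\<dots> = (\<Sum>g\<in>(\<Pi>\<^sub>E j\<in>(UNIV::'n set). {..2 * M}). of_real (vp_weight M g) * torus_char (vp_index M g) \<theta>)"
    unfolding prod.distrib torus_char_prod vp_weight_def vp_index_def of_real_prod vec_lambda_beta ..
  finally show ?thesis .
qed

lemma vp_weight_bounds: "0 \<le> vp_weight M g" "vp_weight M g \<le> 1"
proof -
  have "real ((2 * M) choose k) / real ((2 * M) choose M) \<le> 1" for k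
    using binomial_maximum'[of M k] by (simp add: divide_le_eq)
  then show "vp_weight M g \<le> 1" unfolding vp_weight_def by (intro prod_le_1) auto
  show "0 \<le> vp_weight M g" unfolding vp_weight_def by (intro prod_nonneg) auto
qed

lemma vp_index_inj: "inj (vp_index M)"
  by (auto simp: inj_on_def vp_index_def vec_eq_iff fun_eq_iff)

lemma finite_vp_range: "finite (\<Pi>\<^sub>E j\<in>(UNIV::'n::finite set). {..2 * M :: nat})"
  by (intro finite_PiE) auto

lemma vp_weight_0: "vp_index M g = 0 \<Longrightarrow> vp_weight M g = 1"
proof -
  assume "vp_index M g = 0"
  then have "g j = M" for j by (simp add: vp_index_def vec_eq_iff)
  then show ?thesis by (simp add: vp_weight_def)
qed

lemma vp_zero_index: "(\<lambda>j. M) \<in> (\<Pi>\<^sub>E j\<in>(UNIV::'n::finite set). {..2 * M})" "vp_index M (\<lambda>j. M) = 0"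
  by (auto simp: vp_index_def vec_eq_iff)

lemma vp_const_bounds:
  assumes "M > 0" shows "1 \<le> vp_const M" "vp_const M \<le> 2 * real M"
proof -
  have c: "0 < real ((2 * M) choose M)" by simp
  have "4 ^ M / (2 * real M) \<le> real ((2 * M) choose M)" using central_binomial_lower_bound[OF assms] .
  then show "vp_const M \<le> 2 * real M" unfolding vp_const_def using c assms
    by (simp add: field_simps)
  have "(2 * M) choose M \<le> 2 ^ (2 * M)" by (rule binomial_le_pow2)
  then have "real ((2 * M) choose M) \<le> real (4 ^ M)" unfolding power_mult of_nat_le_iff by simp
  then show "1 \<le> vp_const M" unfolding vp_const_def using c by (simp add: le_divide_eq)
qed

lemma vp_kernel_nonneg: "0 \<le> vp_kernel M \<theta>"
  unfolding vp_kernel_def vp_const_def by (intro prod_nonneg) (auto simp: power_mult)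

lemma cos_pi_periodic: "cos (pi * (t + of_int m)) ^ (2 * M) = cos (pi * t) ^ (2 * M)"
proof -
  have "cos (pi * (t + of_int m)) = cos (pi * t) * cos (pi * of_int m)"
    by (simp add: distrib_left cos_add)
  moreover have "cos (pi * of_int m) ^ 2 = (1::real)"
    using sin_npi_int[of m] by (simp add: cos_squared_eq)
  ultimately show ?thesis by (simp add: power_mult power_mult_distrib)
qed

text \<open>Modulo one, \<open>x_j\<close> lies between \<open>\<delta>\<close> and \<open>1/2\<close> in absolute value, where the cosine is
  decreasing; the even powers of the other cosines are at most one.\<close>
lemma vp_kernel_le_away:
  fixes x :: "real ^ 'n"
  assumes M: "M > 0" and \<delta>: "0 < \<delta>" "\<delta> \<le> \<bar>x $ j - of_int (round (x $ j))\<bar>"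
  shows "vp_kernel M x \<le> vp_const M ^ CARD('n) * (cos (pi * \<delta>))\<^sup>2 ^ M"
proof -
  define y where "y = x $ j - of_int (round (x $ j))"
  have y: "\<bar>y\<bar> \<le> 1 / 2" using of_int_round_abs_le[of "x $ j"] by (simp add: y_def abs_minus_commute)
  have "cos (pi * x $ j) ^ (2 * M) = cos (pi * y) ^ (2 * M)"
    using cos_pi_periodic[of y "round (x $ j)" M] by (simp add: y_def)
  also have "\<dots> = cos (pi * \<bar>y\<bar>) ^ (2 * M)" by (cases "y \<ge> 0") (auto simp: abs_if)
  also have "\<dots> \<le> cos (pi * \<delta>) ^ (2 * M)"
  proof (rule power_mono)
    have "pi * \<bar>y\<bar> \<le> pi * (1 / 2)" using y by (intro mult_left_mono) auto
    then show "0 \<le> cos (pi * \<bar>y\<bar>)" by (intro cos_ge_zero) (auto intro: order_trans[of _ 0])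
    have "pi * \<bar>y\<bar> \<le> pi * 1" using y by (intro mult_left_mono) auto
    then show "cos (pi * \<bar>y\<bar>) \<le> cos (pi * \<delta>)"
      using \<delta> by (intro cos_monotone_0_pi_le mult_left_mono) (auto simp: y_def)
  qed
  finally have cj: "cos (pi * x $ j) ^ (2 * M) \<le> cos (pi * \<delta>) ^ (2 * M)" .
  have le1: "cos (pi * x $ i) ^ (2 * M) \<le> 1" for i
  proof -
    have "(cos (pi * x $ i))\<^sup>2 \<le> 1" by (simp add: abs_square_le_1)
    then show ?thesis unfolding power_mult by (rule power_le_one[OF zero_le_power2])
  qed
  have c: "vp_const M \<ge> 1" using vp_const_bounds[OF M] by simp
  have "vp_kernel M x = vp_const M ^ CARD('n) * (\<Prod>i\<in>UNIV. cos (pi * x $ i) ^ (2 * M))"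
    unfolding vp_kernel_def prod.distrib by simp
  also have "(\<Prod>i\<in>UNIV. cos (pi * x $ i) ^ (2 * M))
    = cos (pi * x $ j) ^ (2 * M) * (\<Prod>i\<in>UNIV - {j}. cos (pi * x $ i) ^ (2 * M))"
    by (rule prod.remove) auto
  also have "\<dots> \<le> cos (pi * \<delta>) ^ (2 * M) * 1"
    using cj le1 by (intro mult_mono prod_le_1 prod_nonneg) (auto simp: power_mult)
  finally show ?thesis using c by (simp add: power_mult)
qed

definition vp_smooth :: "nat \<Rightarrow> (real ^ 'n \<Rightarrow> complex) \<Rightarrow> real ^ 'n \<Rightarrow> complex" where
  "vp_smooth M f \<theta> = torus_integral (\<lambda>\<phi>. f \<phi> * of_real (vp_kernel M (\<theta> - \<phi>)))"

lemma vp_smooth_expansion: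
  fixes f :: "real ^ 'n \<Rightarrow> complex"
  assumes f: "continuous_on UNIV f"
  shows "vp_smooth M f \<theta> = (\<Sum>g\<in>(\<Pi>\<^sub>E j\<in>UNIV. {..2 * M}).
     of_real (vp_weight M g) * fourier_coeff f (vp_index M g) * torus_char (vp_index M g) \<theta>)"
proof -
  have "vp_smooth M f \<theta> = torus_integral (\<lambda>\<phi>. \<Sum>g\<in>(\<Pi>\<^sub>E j\<in>UNIV. {..2 * M}).
      (of_real (vp_weight M g) * torus_char (vp_index M g) \<theta>) * (f \<phi> * torus_char (- vp_index M g) \<phi>))"
    unfolding vp_smooth_def vp_kernel_expansion torus_char_diff sum_distrib_left
    by (simp only: mult_ac)
  also have "\<dots> = (\<Sum>g\<in>(\<Pi>\<^sub>E j\<in>UNIV. {..2 * M}).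
      torus_integral (\<lambda>\<phi>. (of_real (vp_weight M g) * torus_char (vp_index M g) \<theta>) * (f \<phi> * torus_char (- vp_index M g) \<phi>)))"
    using f by (intro torus_integral_sum continuous_intros)
  finally show ?thesis unfolding torus_integral_cmult fourier_coeff_eq by (simp only: mult_ac)
qed

lemma fourier_coeff_const: "fourier_coeff (\<lambda>_. c) n = (if n = 0 then c else 0)"
  unfolding fourier_coeff_eq torus_integral_cmult torus_integral_char by simp

lemma vp_smooth_const:
  fixes \<theta> :: "real ^ 'n"
  shows "vp_smooth M (\<lambda>_. c) \<theta> = c"
proof -
  have "vp_smooth M (\<lambda>_. c) \<theta> = (\<Sum>g\<in>(\<Pi>\<^sub>E j\<in>(UNIV::'n set). {..2 * M}). if g = (\<lambda>j. M) then c else 0)"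
    unfolding vp_smooth_expansion[OF continuous_on_const]
  proof (rule sum.cong[OF refl])
    fix g :: "'n \<Rightarrow> nat" assume "g \<in> (\<Pi>\<^sub>E j\<in>UNIV. {..2 * M})"
    have "vp_index M g = 0 \<longleftrightarrow> g = (\<lambda>j. M)"
      using vp_zero_index(2) vp_index_inj by (metis injD)
    then show "of_real (vp_weight M g) * fourier_coeff (\<lambda>_. c) (vp_index M g) * torus_char (vp_index M g) \<theta>
      = (if g = (\<lambda>j. M) then c else 0)"
      by (auto simp: fourier_coeff_const vp_weight_0)
  qed
  also have "\<dots> = c"
    using vp_zero_index(1)[of M, where 'n = 'n] by (subst sum.delta[OF finite_vp_range]) auto
  finally show ?thesis .
qed

lemma norm_torus_integral_le:
  fixes f g :: "real ^ 'n \<Rightarrow> complex"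
  assumes "continuous_on UNIV f" "continuous_on UNIV g" "\<And>\<theta>. \<theta> \<in> cbox 0 1 \<Longrightarrow> cmod (f \<theta>) \<le> Re (g \<theta>)"
  shows "cmod (torus_integral f) \<le> Re (torus_integral g)"
proof -
  have f: "set_integrable lborel (cbox 0 1) f" and g: "set_integrable lborel (cbox 0 1) g"
    using assms by (auto intro: set_integrable_cube)
  have "cmod (torus_integral f) \<le> (integral\<^sup>L (lborel) (\<lambda>\<theta>. cmod (indicator (cbox 0 1) \<theta> *\<^sub>R f \<theta>)))"
    unfolding torus_integral_def set_lebesgue_integral_def by (rule integral_norm_bound)
  also have "\<dots> \<le> (integral\<^sup>L (lborel) (\<lambda>\<theta>. Re (indicator (cbox 0 1) \<theta> *\<^sub>R g \<theta>)))"
    using f g assms(3) unfolding set_integrable_def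
    by (intro integral_mono integrable_norm integrable_Re) (auto simp: indicator_def)
  also have "\<dots> = Re (torus_integral g)"
    using g unfolding torus_integral_def set_lebesgue_integral_def set_integrable_def by (rule integral_Re)
  finally show ?thesis .
qed

lemma continuous_on_vp_kernel [continuous_intros]:
  fixes f :: "'a::t2_space \<Rightarrow> real ^ 'n"
  shows "continuous_on A f \<Longrightarrow> continuous_on A (\<lambda>x. vp_kernel M (f x))"
  unfolding vp_kernel_def by (auto intro!: continuous_intros)

text \<open>The kernel is an approximate identity. Where \<open>\<phi>\<close> is close to \<open>\<theta>\<close> modulo the lattice,
  continuity and periodicity of \<open>f\<close> apply; elsewhere the kernel is at most \<open>(2M)^N q^M\<close> with
  \<open>q < 1\<close>.\<close>
lemma vp_smooth_tendsto:
  fixes f :: "real ^ 'n \<Rightarrow> complex"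
  assumes cont: "continuous_on UNIV f"
    and per: "\<And>(m :: int ^ 'n) \<theta>. f (\<theta> + (\<chi> j. real_of_int (m $ j))) = f \<theta>"
  shows "(\<lambda>M. vp_smooth M f \<theta>) \<longlonglongrightarrow> f \<theta>"
proof -
  have "bounded (f ` cbox 0 1)"
    by (intro compact_imp_bounded compact_continuous_image continuous_on_subset[OF cont]) auto
  then obtain B where B: "B > 0" "\<And>\<phi>. \<phi> \<in> cbox 0 1 \<Longrightarrow> cmod (f \<phi>) \<le> B"
    by (auto simp: bounded_pos)
  define B' where "B' = B + cmod (f \<theta>)"
  have B': "B' > 0" "\<And>\<phi>. \<phi> \<in> cbox 0 1 \<Longrightarrow> cmod (f \<phi> - f \<theta>) \<le> B'"
    using B norm_triangle_ineq4[of "f _" "f \<theta>"] unfolding B'_def by (auto intro!: add_pos_nonneg order_trans[OF norm_triangle_ineq4])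
  show ?thesis
  proof (rule tendstoI)
    fix \<epsilon> :: real assume \<epsilon>: "\<epsilon> > 0"
    define \<epsilon>' where "\<epsilon>' = \<epsilon> / 2"
    have \<epsilon>': "\<epsilon>' > 0" using \<epsilon> by (simp add: \<epsilon>'_def)
    have "\<exists>d>0. \<forall>\<psi>. dist \<psi> \<theta> < d \<longrightarrow> dist (f \<psi>) (f \<theta>) < \<epsilon>'"
      using cont \<epsilon>' unfolding continuous_on_iff by blast
    then obtain d where d: "d > 0" "\<And>\<psi>. dist \<psi> \<theta> < d \<Longrightarrow> dist (f \<psi>) (f \<theta>) < \<epsilon>'" by blast
    \<comment> \<open>If all \<open>N\<close> coordinates are within \<open>\<delta>\<close>, then the Euclidean distance is below \<open>d\<close>; the bound \<open>1 / 4\<close> keeps \<open>\<pi> \<delta>\<close> below \<open>\<pi>\<close>, so that its sine is positive.\<close>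
    define \<delta> where "\<delta> = min (d / (2 * real CARD('n))) (1 / 4)"
    have \<delta>: "0 < \<delta>" "\<delta> \<le> 1 / 4" "real CARD('n) * \<delta> < d"
    proof -
      show "0 < \<delta>" using d by (simp add: \<delta>_def)
      show "\<delta> \<le> 1 / 4" by (simp add: \<delta>_def)
      have "real CARD('n) * \<delta> \<le> real CARD('n) * (d / (2 * real CARD('n)))"
        unfolding \<delta>_def by (intro mult_left_mono) auto
      also have "\<dots> = d / 2" by simp
      finally show "real CARD('n) * \<delta> < d" using d(1) by simp
    qed
    define q where "q = (cos (pi * \<delta>))\<^sup>2"
    have q: "0 \<le> q" "q < 1"
    proof -
      have "0 < sin (pi * \<delta>)" using \<delta> pi_gt_zero by (intro sin_gt_zero) (auto intro: order_le_less_trans[of _ "pi * (1/4)"])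
      then show "q < 1" unfolding q_def cos_squared_eq by simp
    qed (simp add: q_def)
    have close: "cmod (f \<phi> - f \<theta>) < \<epsilon>'" if "\<And>j. \<bar>(\<theta> - \<phi>) $ j - of_int (round ((\<theta> - \<phi>) $ j))\<bar> < \<delta>" for \<phi>
    proof -
      define m :: "int ^ 'n" where "m = (\<chi> j. round ((\<theta> - \<phi>) $ j))"
      define \<psi> where "\<psi> = \<phi> + (\<chi> j. real_of_int (m $ j))"
      have "dist \<psi> \<theta> \<le> (\<Sum>j\<in>UNIV. \<bar>(\<psi> - \<theta>) $ j\<bar>)" unfolding dist_norm by (rule norm_le_l1_cart)
      also have "\<dots> \<le> (\<Sum>j\<in>(UNIV::'n set). \<delta>)"
      proof (rule sum_mono)
        fix j
        have "(\<psi> - \<theta>) $ j = - ((\<theta> - \<phi>) $ j - of_int (round ((\<theta> - \<phi>) $ j)))" by (simp add: \<psi>_def m_def)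
        then show "\<bar>(\<psi> - \<theta>) $ j\<bar> \<le> \<delta>" using that[of j] by (simp only: abs_minus_cancel)
      qed
      also have "\<dots> < d" using \<delta> by simp
      finally have "dist (f \<psi>) (f \<theta>) < \<epsilon>'" by (rule d(2))
      moreover have "f \<psi> = f \<phi>" unfolding \<psi>_def by (rule per)
      ultimately show ?thesis by (simp add: dist_norm)
    qed
    define N where "N = CARD('n)"
    have "\<forall>\<^sub>F M in sequentially. B' * ((2 * real M) ^ N * q ^ M) < \<epsilon>'"
    proof -
      \<comment> \<open>As the \<open>N\<close>-th power of \<open>2 M s^M\<close>, the product tends to zero by the case of exponent one.\<close>
      define s where "s = root N q"
      have N: "N > 0" by (simp add: N_def)
      have s: "s ^ N = q" "0 \<le> s" "s < 1" using q N by (simp_all add: s_def)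
      have "(\<lambda>M. of_nat M * s ^ M) \<longlonglongrightarrow> 0" using s by (intro powser_times_n_limit_0) simp
      then have "(\<lambda>M. B' * (2 * (of_nat M * s ^ M)) ^ N) \<longlonglongrightarrow> B' * (2 * 0) ^ N"
        by (intro tendsto_intros)
      then have "(\<lambda>M. B' * (2 * (of_nat M * s ^ M)) ^ N) \<longlonglongrightarrow> 0" using N by (simp add: power_0_left)
      then have "\<forall>\<^sub>F M in sequentially. B' * (2 * (of_nat M * s ^ M)) ^ N < \<epsilon>'"
        using \<epsilon>' by (rule order_tendstoD)
      moreover have "(2 * (of_nat M * s ^ M)) ^ N = (2 * real M) ^ N * q ^ M" for M
        unfolding s(1)[symmetric] by (simp add: power_mult_distrib mult_ac flip: power_mult)
      ultimately show ?thesis by (simp only:)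
    qed
    moreover have "\<forall>\<^sub>F M in sequentially. M > (0::nat)" by (rule eventually_gt_at_top)
    ultimately show "\<forall>\<^sub>F M in sequentially. dist (vp_smooth M f \<theta>) (f \<theta>) < \<epsilon>"
    proof eventually_elim
      case (elim M)
      define E where "E = B' * ((2 * real M) ^ N * q ^ M)"
      have E0: "E \<ge> 0" using B' q by (simp add: E_def)
      have pw: "cmod (f \<phi> - f \<theta>) * vp_kernel M (\<theta> - \<phi>) \<le> \<epsilon>' * vp_kernel M (\<theta> - \<phi>) + E" if \<phi>: "\<phi> \<in> cbox 0 1" for \<phi>
      proof (cases "\<forall>j. \<bar>(\<theta> - \<phi>) $ j - of_int (round ((\<theta> - \<phi>) $ j))\<bar> < \<delta>")
        case True
        then have "cmod (f \<phi> - f \<theta>) * vp_kernel M (\<theta> - \<phi>) \<le> \<epsilon>' * vp_kernel M (\<theta> - \<phi>)"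
          using close[of \<phi>] vp_kernel_nonneg by (intro mult_right_mono) auto
        then show ?thesis using E0 by linarith
      next
        case False
        then obtain j where "\<delta> \<le> \<bar>(\<theta> - \<phi>) $ j - of_int (round ((\<theta> - \<phi>) $ j))\<bar>" by (auto simp: not_less)
        then have "vp_kernel M (\<theta> - \<phi>) \<le> vp_const M ^ N * q ^ M"
          unfolding N_def q_def using elim(2) \<delta>(1) by (intro vp_kernel_le_away)
        also have "\<dots> \<le> (2 * real M) ^ N * q ^ M"
          using vp_const_bounds[OF elim(2)] q by (intro mult_right_mono power_mono) auto
        finally have "cmod (f \<phi> - f \<theta>) * vp_kernel M (\<theta> - \<phi>) \<le> E"
          unfolding E_def using B'(2)[OF \<phi>] vp_kernel_nonneg B'(1) by (intro mult_mono) auto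
        moreover have "0 \<le> \<epsilon>' * vp_kernel M (\<theta> - \<phi>)" using \<epsilon>' vp_kernel_nonneg[of M "\<theta> - \<phi>"] by simp
        ultimately show ?thesis by linarith
      qed
      have "vp_smooth M f \<theta> - f \<theta> = vp_smooth M f \<theta> + vp_smooth M (\<lambda>_. - f \<theta>) \<theta>"
        by (simp add: vp_smooth_const)
      also have "\<dots> = torus_integral (\<lambda>\<phi>. f \<phi> * of_real (vp_kernel M (\<theta> - \<phi>)) + - f \<theta> * of_real (vp_kernel M (\<theta> - \<phi>)))"
        unfolding vp_smooth_def by (rule torus_integral_add[symmetric]) (intro continuous_intros cont)+
      also have "\<dots> = torus_integral (\<lambda>\<phi>. (f \<phi> - f \<theta>) * of_real (vp_kernel M (\<theta> - \<phi>)))"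
        by (simp add: algebra_simps)
      also have "cmod \<dots> \<le> Re (torus_integral (\<lambda>\<phi>. of_real \<epsilon>' * of_real (vp_kernel M (\<theta> - \<phi>)) + of_real E))"
      proof (rule norm_torus_integral_le)
        show "continuous_on UNIV (\<lambda>\<phi>. (f \<phi> - f \<theta>) * complex_of_real (vp_kernel M (\<theta> - \<phi>)))"
          by (intro continuous_intros cont)
        show "continuous_on UNIV (\<lambda>\<phi>. complex_of_real \<epsilon>' * complex_of_real (vp_kernel M (\<theta> - \<phi>)) + complex_of_real E)"
          by (intro continuous_intros)
      next
        fix \<phi> :: "real ^ 'n" assume "\<phi> \<in> cbox 0 1"
        then show "cmod ((f \<phi> - f \<theta>) * complex_of_real (vp_kernel M (\<theta> - \<phi>)))
          \<le> Re (complex_of_real \<epsilon>' * complex_of_real (vp_kernel M (\<theta> - \<phi>)) + complex_of_real E)"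
          using pw[of \<phi>] vp_kernel_nonneg[of M "\<theta> - \<phi>"] by (simp add: norm_mult)
      qed
      also have "torus_integral (\<lambda>\<phi>. of_real \<epsilon>' * of_real (vp_kernel M (\<theta> - \<phi>)) + of_real E)
        = vp_smooth M (\<lambda>_. of_real \<epsilon>') \<theta> + torus_integral (\<lambda>\<phi>::real^'n. of_real E * torus_char 0 \<phi>)"
        unfolding vp_smooth_def by (subst torus_integral_add) (auto intro!: continuous_intros)
      also have "\<dots> = of_real \<epsilon>' + of_real E"
        unfolding vp_smooth_const torus_integral_cmult torus_integral_char by simp
      finally have "dist (vp_smooth M f \<theta>) (f \<theta>) \<le> \<epsilon>' + E" by (simp add: dist_norm)
      moreover have "E < \<epsilon>'" using elim(1) by (simp only: E_def)
      ultimately show ?case unfolding \<epsilon>'_def by linarith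
    qed
  qed
qed

text \<open>The smoothed functions are trigonometric polynomials whose coefficients are no larger than
  those of \<open>f\<close>, so the error bound holds for each of them; the frequency zero cancels
  against the integral. The bound does not depend on \<open>M\<close> and therefore passes to the limit.\<close>
theorem torus_mean_error_le:
  fixes f :: "real ^ 'n \<Rightarrow> complex" and p :: "'b \<Rightarrow> real ^ 'n" and c :: "int ^ 'n \<Rightarrow> real"
  assumes cont: "continuous_on UNIV f"
    and per: "\<And>(m :: int ^ 'n) \<theta>. f (\<theta> + (\<chi> j. real_of_int (m $ j))) = f \<theta>"
    and S: "finite S" "S \<noteq> {}"
    and char: "\<And>n. n \<noteq> 0 \<Longrightarrow> cmod (\<Sum>a\<in>S. torus_char n (p a)) / real (card S) \<le> c n"
    and T: "\<And>A. finite A \<Longrightarrow> (\<Sum>n\<in>A. cmod (fourier_coeff f n) * c n) \<le> T"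
    and c0: "c 0 \<ge> 0"
  shows "cmod ((\<Sum>a\<in>S. f (p a)) / of_nat (card S) - torus_integral f) \<le> T"
proof -
  have card: "card S > 0" using S by (simp add: card_gt_0_iff)
  let ?G = "\<lambda>M. (\<Pi>\<^sub>E j\<in>(UNIV::'n set). {..2 * M :: nat})"
  define A where "A M = (\<Sum>a\<in>S. vp_smooth M f (p a)) / of_nat (card S) - torus_integral f" for M
  have le: "cmod (A M) \<le> T" for M
  proof -
    define g0 :: "'n \<Rightarrow> nat" where "g0 = (\<lambda>j. M)"
    have g0: "g0 \<in> ?G M" "vp_index M g0 = 0" using vp_zero_index[of M] by (auto simp: g0_def)
    define h where "h g = of_real (vp_weight M g) * fourier_coeff f (vp_index M g)
        * ((\<Sum>a\<in>S. torus_char (vp_index M g) (p a)) / of_nat (card S))" for g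
    have "(\<Sum>a\<in>S. vp_smooth M f (p a)) / of_nat (card S)
      = (\<Sum>a\<in>S. \<Sum>g\<in>?G M. of_real (vp_weight M g) * fourier_coeff f (vp_index M g) * torus_char (vp_index M g) (p a)) / of_nat (card S)"
      by (simp only: vp_smooth_expansion[OF cont])
    also have "\<dots> = (\<Sum>g\<in>?G M. h g)"
      by (subst sum.swap) (simp add: h_def sum_divide_distrib sum_distrib_left)
    also have "\<dots> = h g0 + (\<Sum>g\<in>?G M - {g0}. h g)"
      using g0 finite_vp_range by (intro sum.remove) auto
    also have "h g0 = torus_integral f"
      using card vp_weight_0[OF g0(2)] by (simp add: h_def g0(2) fourier_coeff_eq)
    finally have "A M = (\<Sum>g\<in>?G M - {g0}. h g)" by (simp add: A_def)
    also have "cmod \<dots> \<le> (\<Sum>g\<in>?G M - {g0}. cmod (fourier_coeff f (vp_index M g)) * c (vp_index M g))"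
    proof (rule sum_norm_le)
      fix g assume g: "g \<in> ?G M - {g0}"
      then have "vp_index M g \<noteq> 0" using vp_index_inj[of M] g0(2) by (metis Diff_iff injD insertI1)
      then have ch: "cmod (\<Sum>a\<in>S. torus_char (vp_index M g) (p a)) / real (card S) \<le> c (vp_index M g)" by (rule char)
      have "cmod (h g) = vp_weight M g * (cmod (fourier_coeff f (vp_index M g))
          * (cmod (\<Sum>a\<in>S. torus_char (vp_index M g) (p a)) / real (card S)))"
        using vp_weight_bounds[of M g] by (simp add: h_def norm_mult norm_divide)
      also have "\<dots> \<le> 1 * (cmod (fourier_coeff f (vp_index M g)) * c (vp_index M g))"
        using vp_weight_bounds[of M g] ch by (intro mult_mono mult_left_mono) auto
      finally show "cmod (h g) \<le> cmod (fourier_coeff f (vp_index M g)) * c (vp_index M g)" by simp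
    qed
    also have "\<dots> = (\<Sum>n\<in>vp_index M ` (?G M - {g0}). cmod (fourier_coeff f n) * c n)"
      by (rule sum.reindex_cong[OF inj_on_subset[OF vp_index_inj] refl, symmetric]) auto
    also have "\<dots> \<le> T" by (intro T finite_imageI finite_Diff finite_vp_range)
    finally show ?thesis .
  qed
  have "A \<longlonglongrightarrow> (\<Sum>a\<in>S. f (p a)) / of_nat (card S) - torus_integral f"
    unfolding A_def[abs_def] using card by (intro tendsto_intros vp_smooth_tendsto[OF cont per]) auto
  then have "(\<lambda>M. cmod (A M)) \<longlonglongrightarrow> cmod ((\<Sum>a\<in>S. f (p a)) / of_nat (card S) - torus_integral f)"
    by (rule tendsto_norm)
  then show ?thesis by (rule LIMSEQ_le_const2) (use le in auto)
qed

section \<open>The upper bound\<close>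

text \<open>Concavity of the power, in the form of Young's inequality \<open>x^\<gamma> m^(1-\<gamma>) \<le> \<gamma> x + (1-\<gamma>) m\<close> at
  the mean \<open>m\<close>.\<close>
lemma mean_powr_le_powr_mean:
  fixes x :: "'a \<Rightarrow> real"
  assumes S: "finite S" "S \<noteq> {}" and x: "\<And>i. i \<in> S \<Longrightarrow> x i \<ge> 0" and \<gamma>: "0 < \<gamma>" "\<gamma> \<le> 1"
  shows "(\<Sum>i\<in>S. x i powr \<gamma>) / real (card S) \<le> ((\<Sum>i\<in>S. x i) / real (card S)) powr \<gamma>"
proof -
  define m where "m = (\<Sum>i\<in>S. x i) / real (card S)"
  have c: "real (card S) > 0" using S by (simp add: card_gt_0_iff)
  have m0: "m \<ge> 0" unfolding m_def using x by (intro divide_nonneg_nonneg sum_nonneg) auto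
  show ?thesis
  proof (cases "m = 0")
    case True
    then have "(\<Sum>i\<in>S. x i) = 0" using c by (simp add: m_def)
    then have "\<And>i. i \<in> S \<Longrightarrow> x i = 0" using sum_nonneg_eq_0_iff[OF S(1), of x] x by auto
    then have "(\<Sum>i\<in>S. x i powr \<gamma>) = 0" by simp
    then show ?thesis by simp
  next
    case False
    then have m: "m > 0" using m0 by simp
    have "x i powr \<gamma> * m powr (1 - \<gamma>) \<le> \<gamma> * x i + (1 - \<gamma>) * m" if "i \<in> S" for i
    proof (cases "x i = 0")
      case True
      then show ?thesis using \<gamma> m by simp
    next
      case False
      then show ?thesis using \<gamma> m x[OF that] by (intro Youngs_inequality_0) auto
    qed
    then have "(\<Sum>i\<in>S. x i powr \<gamma> * m powr (1 - \<gamma>)) \<le> (\<Sum>i\<in>S. \<gamma> * x i + (1 - \<gamma>) * m)"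
      by (rule sum_mono)
    also have "\<dots> = \<gamma> * (\<Sum>i\<in>S. x i) + real (card S) * ((1 - \<gamma>) * m)"
      by (simp add: sum.distrib sum_distrib_left)
    also have "(\<Sum>i\<in>S. x i) = real (card S) * m" using c by (simp add: m_def)
    also have "\<gamma> * (real (card S) * m) + real (card S) * ((1 - \<gamma>) * m) = real (card S) * m"
      by (simp add: algebra_simps)
    finally have "(\<Sum>i\<in>S. x i powr \<gamma>) * m powr (1 - \<gamma>) \<le> real (card S) * m"
      by (simp add: sum_distrib_right)
    also have "real (card S) * m = (real (card S) * m powr \<gamma>) * m powr (1 - \<gamma>)"
      using m by (simp add: mult.assoc flip: powr_add)
    finally have "(\<Sum>i\<in>S. x i powr \<gamma>) \<le> real (card S) * m powr \<gamma>"
      using m by (simp add: mult_le_cancel_right)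
    then show ?thesis using c unfolding m_def[symmetric] by (simp add: divide_le_eq mult.commute)
  qed
qed

text \<open>The Euclidean norm is at most the sum of \<open>|log|\<alpha>_j||\<close>, and each coordinate runs uniformly
  through the conjugates of \<open>\<xi>_j\<close>.\<close>
lemma sum_norm_log_coords_le:
  fixes \<xi> :: "complex ^ 'n"
  assumes \<xi>: "\<xi> \<in> alg_torus"
  shows "(\<Sum>\<alpha>\<in>galois_orbit \<xi>. norm (log_coords \<alpha>)) \<le> real (card (galois_orbit \<xi>)) * (2 * weil_height_vec \<xi>)"
proof -
  let ?S = "galois_orbit \<xi>"
  have "(\<Sum>\<alpha>\<in>?S. norm (log_coords \<alpha>)) \<le> (\<Sum>\<alpha>\<in>?S. \<Sum>j\<in>UNIV. \<bar>ln (cmod (\<alpha> $ j))\<bar>)"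
    by (intro sum_mono order_trans[OF norm_le_l1_cart]) (simp add: log_coords_def)
  also have "\<dots> = (\<Sum>j\<in>UNIV. \<Sum>\<alpha>\<in>?S. \<bar>ln (cmod (\<alpha> $ j))\<bar>)" by (rule sum.swap)
  also have "\<dots> \<le> (\<Sum>j\<in>UNIV. real (card ?S) * (2 * weil_height (\<xi> $ j)))"
  proof (rule sum_mono)
    fix j
    have "(\<Sum>\<alpha>\<in>?S. \<bar>ln (cmod (\<alpha> $ j))\<bar>)
      = real (fibre_size \<xi> (axis j 1)) * (\<Sum>y\<in>conjugates (\<xi> $ j). \<bar>ln (cmod y)\<bar>)"
      using sum_over_orbit[OF \<xi>, of "\<lambda>y. \<bar>ln (cmod y)\<bar>" "axis j 1"] by (simp add: monomial_char_axis)
    also have "\<dots> \<le> real (fibre_size \<xi> (axis j 1)) * (2 * (real (alg_degree (\<xi> $ j)) * weil_height (\<xi> $ j)))"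
      using alg_torusD[OF \<xi>, of j] by (intro mult_left_mono sum_abs_ln_conjugates_le) auto
    also have "\<dots> = real (card ?S) * (2 * weil_height (\<xi> $ j))"
      using card_orbit_eq[OF \<xi>, of "axis j 1"] by (simp add: monomial_char_axis)
    finally show "(\<Sum>\<alpha>\<in>?S. \<bar>ln (cmod (\<alpha> $ j))\<bar>) \<le> real (card ?S) * (2 * weil_height (\<xi> $ j))" .
  qed
  also have "\<dots> = real (card ?S) * (2 * weil_height_vec \<xi>)"
    by (simp add: weil_height_vec_def sum_distrib_left)
  finally show ?thesis .
qed

lemma radial_error_le:
  fixes F :: "real ^ 'n \<Rightarrow> real ^ 'n \<Rightarrow> complex" and \<xi> :: "complex ^ 'n"
  assumes \<xi>: "\<xi> \<in> alg_torus" and \<gamma>: "0 < \<gamma>" "\<gamma> \<le> 1" and L: "L \<ge> 0"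
    and holder: "\<And>\<theta> s. s \<noteq> 0 \<Longrightarrow> cmod (F \<theta> s - F \<theta> 0) \<le> L * norm s powr \<gamma>"
  shows "cmod (\<Sum>\<alpha>\<in>galois_orbit \<xi>. F (angle_coords \<alpha>) (log_coords \<alpha>) - F (angle_coords \<alpha>) 0)
      / real (card (galois_orbit \<xi>)) \<le> L * (2 * height_D \<xi>) powr \<gamma>"
proof -
  let ?S = "galois_orbit \<xi>"
  have fin: "finite ?S" and ne: "?S \<noteq> {}" using finite_galois_orbit[OF \<xi>] galois_orbit_self by auto
  have c: "real (card ?S) > 0" using card_galois_orbit_pos[OF \<xi>] by simp
  have "cmod (\<Sum>\<alpha>\<in>?S. F (angle_coords \<alpha>) (log_coords \<alpha>) - F (angle_coords \<alpha>) 0)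
    \<le> (\<Sum>\<alpha>\<in>?S. L * norm (log_coords \<alpha>) powr \<gamma>)"
  proof (rule sum_norm_le)
    fix \<alpha>
    show "cmod (F (angle_coords \<alpha>) (log_coords \<alpha>) - F (angle_coords \<alpha>) 0) \<le> L * norm (log_coords \<alpha>) powr \<gamma>"
      using holder[of "log_coords \<alpha>"] by (cases "log_coords \<alpha> = 0") auto
  qed
  then have "cmod (\<Sum>\<alpha>\<in>?S. F (angle_coords \<alpha>) (log_coords \<alpha>) - F (angle_coords \<alpha>) 0) / real (card ?S)
    \<le> (\<Sum>\<alpha>\<in>?S. L * norm (log_coords \<alpha>) powr \<gamma>) / real (card ?S)"
    by (rule divide_right_mono) simp
  also have "\<dots> = L * ((\<Sum>\<alpha>\<in>?S. norm (log_coords \<alpha>) powr \<gamma>) / real (card ?S))"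
    by (simp add: sum_distrib_left)
  also have "\<dots> \<le> L * ((\<Sum>\<alpha>\<in>?S. norm (log_coords \<alpha>)) / real (card ?S)) powr \<gamma>"
    using L by (intro mult_left_mono mean_powr_le_powr_mean fin ne \<gamma>) auto
  also have "\<dots> \<le> L * (2 * height_D \<xi>) powr \<gamma>"
  proof (intro mult_left_mono powr_mono2)
    have "(\<Sum>\<alpha>\<in>?S. norm (log_coords \<alpha>)) / real (card ?S) \<le> 2 * weil_height_vec \<xi>"
      using sum_norm_log_coords_le[OF \<xi>] c by (simp add: divide_le_eq mult.commute)
    then show "(\<Sum>\<alpha>\<in>?S. norm (log_coords \<alpha>)) / real (card ?S) \<le> 2 * height_D \<xi>"
      using height_D_ge[OF \<xi>] by linarith
  qed (use L \<gamma> in \<open>auto intro!: sum_nonneg divide_nonneg_nonneg\<close>)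
  finally show ?thesis .
qed

text \<open>At the angles of a point \<open>\<alpha>\<close> the character of frequency \<open>n\<close> takes the value
  \<open>\<chi>^n(\<alpha>)/|\<chi>^n(\<alpha>)|\<close>, so the character sums are those estimated over the orbit.\<close>
lemma angular_error_le:
  fixes f :: "real ^ 'n \<Rightarrow> complex" and \<xi> :: "complex ^ 'n"
  assumes \<xi>: "\<xi> \<in> alg_torus" and \<gamma>: "0 < \<gamma>" "\<gamma> \<le> 1 / 2"
    and cont: "continuous_on UNIV f"
    and per: "\<And>(m :: int ^ 'n) \<theta>. f (\<theta> + (\<chi> j. real_of_int (m $ j))) = f \<theta>"
    and X: "\<And>A. finite A \<Longrightarrow> (\<Sum>n\<in>A. cmod (fourier_coeff f n) * real (norm_l1 n) powr \<gamma>) \<le> X"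
  shows "cmod ((\<Sum>\<alpha>\<in>galois_orbit \<xi>. f (angle_coords \<alpha>)) / of_nat (card (galois_orbit \<xi>)) - torus_integral f)
      \<le> 24 powr \<gamma> * X * height_D \<xi> powr \<gamma>"
proof (rule torus_mean_error_le[OF cont per])
  let ?S = "galois_orbit \<xi>"
  let ?H = "height_D \<xi> powr \<gamma>"
  have H: "height_D \<xi> > 0" by (rule height_D_pos[OF \<xi>])
  show "finite ?S" "?S \<noteq> {}" using finite_galois_orbit[OF \<xi>] galois_orbit_self by auto
  show "0 \<le> 24 powr \<gamma> * real (norm_l1 (0 :: int ^ 'n)) powr \<gamma> * ?H" by simp
  show "cmod (\<Sum>\<alpha>\<in>?S. torus_char n (angle_coords \<alpha>)) / real (card ?S)
      \<le> 24 powr \<gamma> * real (norm_l1 n) powr \<gamma> * ?H" if n: "n \<noteq> 0" for n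
  proof -
    have "(\<Sum>\<alpha>\<in>?S. torus_char n (angle_coords \<alpha>)) = (\<Sum>\<alpha>\<in>?S. sgn (monomial_char n \<alpha>))"
      using galois_orbit_alg_torus[OF \<xi>] by (intro sum.cong refl sgn_monomial_char[symmetric]) (auto simp: alg_torusD)
    then show ?thesis using orbit_character_sum_le[OF \<xi> n \<gamma>] H by (simp add: powr_mult)
  qed
  show "(\<Sum>n\<in>A. cmod (fourier_coeff f n) * (24 powr \<gamma> * real (norm_l1 n) powr \<gamma> * ?H)) \<le> 24 powr \<gamma> * X * ?H"
    if "finite A" for A
  proof -
    have "(\<Sum>n\<in>A. cmod (fourier_coeff f n) * (24 powr \<gamma> * real (norm_l1 n) powr \<gamma> * ?H))
      = (24 powr \<gamma> * ?H) * (\<Sum>n\<in>A. cmod (fourier_coeff f n) * real (norm_l1 n) powr \<gamma>)"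
      by (simp add: sum_distrib_left mult_ac)
    also have "\<dots> \<le> (24 powr \<gamma> * ?H) * X" using X[OF that] by (intro mult_left_mono) auto
    finally show ?thesis by (simp add: mult_ac)
  qed
qed

lemma torus_continuousD:
  fixes F :: "real ^ 'n \<Rightarrow> real ^ 'n \<Rightarrow> complex"
  assumes "torus_continuous F"
  shows "continuous_on UNIV (\<lambda>\<theta>. F \<theta> s)" "F (\<theta> + (\<chi> j. real_of_int (m $ j))) s = F \<theta> s"
proof -
  have "continuous_on UNIV (\<lambda>(\<theta>, s). F \<theta> s)" using assms by (simp add: torus_continuous_def)
  then have "continuous_on UNIV (\<lambda>\<theta>. (case (\<theta>, s) of (\<theta>, s) \<Rightarrow> F \<theta> s))"
    by (rule continuous_on_compose2) (auto intro!: continuous_intros)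
  then show "continuous_on UNIV (\<lambda>\<theta>. F \<theta> s)" by simp
  show "F (\<theta> + (\<chi> j. real_of_int (m $ j))) s = F \<theta> s" using assms by (simp add: torus_continuous_def)
qed

text \<open>If the Hoelder constant or the sum over the Fourier coefficients is infinite, the bound is
  infinite because \<open>h_D\<close> is positive. Otherwise the error is the sum of the radial and the
  angular error.\<close>
theorem equi_error_le:
  fixes F :: "real ^ 'n \<Rightarrow> real ^ 'n \<Rightarrow> complex" and \<xi> :: "complex ^ 'n"
  assumes F: "torus_continuous F" and \<xi>: "\<xi> \<in> alg_torus" and \<gamma>: "0 < \<gamma>" "\<gamma> \<le> 1 / 2"
  shows "ennreal (equi_error F \<xi>) \<le> bound_const \<gamma> F * ennreal (height_D \<xi> powr \<gamma>)"
proof -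
  let ?S = "galois_orbit \<xi>" and ?F0 = "\<lambda>\<theta>. F \<theta> 0" and ?H = "height_D \<xi> powr \<gamma>"
  let ?coeff = "\<lambda>n. cmod (fourier_coeff ?F0 n) * real (norm_l1 n) powr \<gamma>"
  let ?X = "\<Sum>\<^sub>\<infinity>n\<in>UNIV. ennreal (?coeff n)"
  have H: "?H > 0" using height_D_pos[OF \<xi>] by simp
  have p: "(2::real) powr \<gamma> > 0" "(24::real) powr \<gamma> > 0" by simp_all
  show ?thesis
  proof (cases "holder_const \<gamma> F = top \<or> ?X = top")
    case True
    then have "bound_const \<gamma> F = top" unfolding bound_const_def using p
      by (auto simp: ennreal_mult_top ennreal_mult_eq_top_iff)
    then show ?thesis using H by (simp add: ennreal_top_mult)
  next
    case False
    obtain L where L: "holder_const \<gamma> F = ennreal L" "L \<ge> 0"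
      using False by (cases "holder_const \<gamma> F" rule: ennreal_cases) auto
    obtain X where X: "?X = ennreal X" "X \<ge> 0"
      using False by (cases ?X rule: ennreal_cases) auto
    have holder: "cmod (F \<theta> s - F \<theta> 0) \<le> L * norm s powr \<gamma>" if "s \<noteq> 0" for \<theta> s
    proof -
      have "ennreal (cmod (F \<theta> s - F \<theta> 0) / norm s powr \<gamma>) \<le> holder_const \<gamma> F"
        unfolding holder_const_def using that by (intro SUP_upper2[of "(\<theta>, s)"]) auto
      then have "cmod (F \<theta> s - F \<theta> 0) / norm s powr \<gamma> \<le> L" using L by simp
      then show ?thesis using that by (simp add: divide_le_eq)
    qed
    have fin: "(\<Sum>n\<in>A. ?coeff n) \<le> X" if "finite A" for A
    proof -
      have "(\<Sum>n\<in>A. ennreal (?coeff n)) \<le> ?X"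
        using that by (subst nonneg_infsum_complete) (auto intro: SUP_upper)
      then have "ennreal (\<Sum>n\<in>A. ?coeff n) \<le> ennreal X" unfolding X(1) by (subst sum_ennreal[symmetric]) auto
      then show ?thesis using X(2) by simp
    qed
    define a where "a = (\<Sum>\<alpha>\<in>?S. F (angle_coords \<alpha>) (log_coords \<alpha>) - F (angle_coords \<alpha>) 0) / of_nat (card ?S)"
    define b where "b = (\<Sum>\<alpha>\<in>?S. F (angle_coords \<alpha>) 0) / of_nat (card ?S) - torus_integral ?F0"
    have "equi_error F \<xi> = cmod (a + b)"
      unfolding equi_error_def a_def b_def by (simp add: sum_subtractf diff_divide_distrib)
    also have "\<dots> \<le> cmod a + cmod b" by (rule norm_triangle_ineq)
    also have "cmod a \<le> L * (2 * height_D \<xi>) powr \<gamma>"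
    proof -
      have "\<gamma> \<le> 1" using \<gamma>(2) by simp
      then have "cmod (\<Sum>\<alpha>\<in>?S. F (angle_coords \<alpha>) (log_coords \<alpha>) - F (angle_coords \<alpha>) 0) / real (card ?S)
          \<le> L * (2 * height_D \<xi>) powr \<gamma>"
        by (rule radial_error_le[OF \<xi> \<gamma>(1) _ L(2)]) (rule holder)
      then show ?thesis by (simp add: a_def norm_divide)
    qed
    also have "(2 * height_D \<xi>) powr \<gamma> = 2 powr \<gamma> * ?H"
      using height_D_pos[OF \<xi>] by (simp add: powr_mult)
    also have "cmod b \<le> 24 powr \<gamma> * X * ?H"
      unfolding b_def by (rule angular_error_le[OF \<xi> \<gamma> torus_continuousD[OF F] fin])
    finally have "equi_error F \<xi> \<le> (2 powr \<gamma> * L + 24 powr \<gamma> * X) * ?H" by (simp add: algebra_simps)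
    then have "ennreal (equi_error F \<xi>) \<le> ennreal ((2 powr \<gamma> * L + 24 powr \<gamma> * X) * ?H)" by (rule ennreal_leI)
    also have "\<dots> = bound_const \<gamma> F * ennreal ?H"
      unfolding bound_const_def L(1) X(1) using L(2) X(2) by (simp add: ennreal_mult)
    finally show ?thesis .
  qed
qed

section \<open>Sharpness\<close>

text \<open>All conjugates of \<open>a^(1/K)\<close> are roots of the monic polynomial \<open>x^K - a\<close>, so the leading
  coefficient is one and all conjugates have the same modulus.\<close>
lemma root_of_nat_facts:
  fixes a K :: nat
  assumes K: "K > 0" and a: "a > 0"
  defines "r \<equiv> root K (real a)"
  shows algebraic_root_of_nat: "algebraic (complex_of_real r)"
    and conjugates_root_of_nat: "\<And>y. y \<in> conjugates (complex_of_real r) \<Longrightarrow> cmod y = r"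
    and weil_height_root_of_nat: "weil_height (complex_of_real r) = ln (real a) / real K"
proof -
  let ?x = "complex_of_real r"
  define p :: "int poly" where "p = monom 1 K + [:- int a:]"
  have r: "r ^ K = real a" "r > 0" using K a by (simp_all add: r_def)
  have r1: "r \<ge> 1" using K a by (simp add: r_def)
  have pe: "poly (cpoly p) y = y ^ K - of_nat a" for y
  proof -
    have "cpoly p = monom 1 K + [:- of_nat a:]"
      unfolding p_def cpoly_add by (simp add: poly_eq_iff coeff_pCons split: nat.splits)
    then show ?thesis by (simp add: poly_monom)
  qed
  have cK: "coeff p K = 1" using K by (cases K) (simp_all add: p_def)
  have degp: "degree p = K"
    unfolding p_def using K by (subst degree_add_eq_left) (auto simp: degree_monom_eq)
  have px: "poly (cpoly p) ?x = 0"
    unfolding pe using r(1) by (simp flip: of_real_power)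
  have "p \<noteq> 0" using cK by auto
  then show x: "algebraic ?x" using px by (intro algebraicI[of "cpoly p"]) auto
  have dvd: "min_int_poly ?x dvd p" using min_int_poly_dvd[OF x px] .
  then obtain v where v: "p = min_int_poly ?x * v" by (auto elim: dvdE)
  show conj: "cmod y = r" if "y \<in> conjugates ?x" for y
  proof -
    have "poly (cpoly p) y = 0" using that by (simp add: conjugates_def v cpoly_mult)
    then have "y ^ K = of_nat a" by (simp add: pe)
    then have "cmod y ^ K = real a" by (metis norm_of_nat norm_power)
    then show ?thesis unfolding r_def using K by (metis norm_ge_zero real_root_pos_unique)
  qed
  have "lead_coeff p = lead_coeff (min_int_poly ?x) * lead_coeff v" unfolding v by (rule lead_coeff_mult)
  then have "lead_coeff (min_int_poly ?x) dvd 1" using cK degp by (metis dvd_triv_left)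
  then have lc: "lead_coeff (min_int_poly ?x) = 1" using min_int_poly_lead_pos[OF x] by simp
  have "real (alg_degree ?x) * weil_height ?x = (\<Sum>y\<in>conjugates ?x. log_plus r)"
    unfolding weil_height_eq[OF x] lc using conj by simp
  also have "\<dots> = real (alg_degree ?x) * ln r"
    using r1 by (simp add: card_conjugates[OF x] log_plus_def)
  finally have "weil_height ?x = ln r" using alg_degree_pos[OF x] by simp
  also have "ln r = ln (real a) / real K" using K a by (simp add: r_def ln_root)
  finally show "weil_height ?x = ln (real a) / real K" .
qed

lemma multiplicity_prod_inj_primes:
  fixes q :: "'n::finite \<Rightarrow> nat"
  assumes "inj q" "\<And>j. prime (q j)"
  shows "multiplicity (q i) (\<Prod>j\<in>UNIV. q j ^ e j) = e i"
proof -
  have "(\<Prod>j\<in>UNIV. q j ^ e j) = (\<Prod>p\<in>range q. p ^ e (inv q p))"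
    by (subst prod.reindex[OF assms(1)]) (simp add: inv_f_f[OF assms(1)])
  then have "multiplicity (q i) (\<Prod>j\<in>UNIV. q j ^ e j) = (if q i \<in> range q then e (inv q (q i)) else 0)"
    using assms(2) by (simp only:) (rule multiplicity_prod_prime_powers, auto)
  then show ?thesis by (simp add: inv_f_f[OF assms(1)])
qed

definition prime_root_point :: "('n \<Rightarrow> nat) \<Rightarrow> nat \<Rightarrow> nat \<Rightarrow> complex ^ 'n" where
  "prime_root_point q k K = (\<chi> j. complex_of_real (root K (real (q j ^ k))))"

lemma prime_root_point_alg_torus:
  assumes "\<And>j. prime (q j)" "K > 0"
  shows "prime_root_point q k K \<in> alg_torus"
proof -
  have pos: "q j ^ k > 0" for j using assms(1)[of j] by (simp add: prime_gt_0_nat)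
  have "root K (real (q j ^ k)) \<noteq> 0" for j using pos[of j] assms(2) by (simp del: of_nat_power)
  then show ?thesis
    unfolding alg_torus_def prime_root_point_def using algebraic_root_of_nat[OF assms(2) pos] by (simp del: of_nat_power) 
qed

lemma norm_orbit_prime_root_point:
  fixes \<alpha> :: "complex ^ 'n"
  assumes q: "\<And>j. prime (q j)" and K: "K > 0" and \<alpha>: "\<alpha> \<in> galois_orbit (prime_root_point q k K)"
  shows "cmod (\<alpha> $ j) = root K (real (q j ^ k))"
proof -
  have pos: "q j ^ k > 0" using q[of j] by (simp add: prime_gt_0_nat)
  have "\<alpha> $ j \<in> conjugates (prime_root_point q k K $ j)"
    by (rule galois_orbit_conjugates[OF prime_root_point_alg_torus[OF q K] \<alpha>])
  then show ?thesis using conjugates_root_of_nat[OF K pos] by (simp add: prime_root_point_def del: of_nat_power)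
qed

text \<open>All conjugates of \<open>\<eta> = \<chi>^n(\<xi>)\<close> have the same modulus \<open>t\<close>, and \<open>t^d\<close> is rational, being the
  ratio of two coefficients. Counting the prime \<open>q_i\<close> with \<open>n_i \<noteq> 0\<close> in the \<open>K\<close>-th power of
  this identity shows that \<open>K\<close> divides \<open>k d n_i\<close>, hence \<open>d n_i\<close>.\<close>
lemma gen_degree_prime_root_point:
  fixes q :: "'n::finite \<Rightarrow> nat"
  assumes q: "inj q" "\<And>j. prime (q j)" and K: "K > 0" and cop: "coprime K k"
  shows "K \<le> gen_degree (prime_root_point q k K)"
proof (rule gen_degree_greatest)
  fix n :: "int ^ 'n" assume n: "n \<noteq> 0"
  define \<xi> where "\<xi> = prime_root_point q k K"
  define \<eta> where "\<eta> = monomial_char n \<xi>"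
  define d where "d = alg_degree \<eta>"
  define r where "r j = root K (real (q j ^ k))" for j
  define t where "t = (\<Prod>j\<in>UNIV. r j powi (n $ j))"
  have \<xi>: "\<xi> \<in> alg_torus" unfolding \<xi>_def by (rule prime_root_point_alg_torus[OF q(2) K])
  have \<eta>: "algebraic \<eta>" "\<eta> \<noteq> 0"
    unfolding \<eta>_def using monomial_char_algebraic[OF \<xi>] monomial_char_nonzero[OF \<xi>] by auto
  have qpos: "q j > 0" for j using q(2)[of j] by (simp add: prime_gt_0_nat)
  have rK: "r j ^ K = real (q j) ^ k" for j using K by (simp add: r_def)
  have conj: "cmod \<beta> = t" if "\<beta> \<in> conjugates \<eta>" for \<beta>
  proof -
    have "\<beta> \<in> monomial_char n ` galois_orbit \<xi>" using that monomial_char_orbit[OF \<xi>, of n] by (simp add: \<eta>_def)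
    then obtain \<alpha> where \<alpha>: "\<alpha> \<in> galois_orbit \<xi>" "\<beta> = monomial_char n \<alpha>" by blast
    have "cmod (\<alpha> $ j) = r j" for j
      using norm_orbit_prime_root_point[OF q(2) K \<alpha>(1)[unfolded \<xi>_def]] by (simp add: r_def)
    then show ?thesis unfolding \<alpha>(2) monomial_char_def t_def by (simp add: norm_power_int flip: prod_norm)
  qed
  define l c where "l = nat (lead_coeff (min_int_poly \<eta>))" and "c = nat \<bar>coeff (min_int_poly \<eta>) 0\<bar>"
  have l: "real l = real_of_int (lead_coeff (min_int_poly \<eta>))" "l > 0"
    using min_int_poly_lead_pos[OF \<eta>(1)] by (simp_all add: l_def)
  have c: "real c = cmod (of_int (coeff (min_int_poly \<eta>) 0))" "c > 0"
    using min_int_poly_const_coeff[OF \<eta>] by (simp_all add: c_def)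
  have "real c = real l * (\<Prod>\<beta>\<in>conjugates \<eta>. cmod \<beta>)"
    unfolding c(1) const_coeff_eq_prod[OF \<eta>(1)] using l by (simp add: norm_mult flip: prod_norm)
  also have "(\<Prod>\<beta>\<in>conjugates \<eta>. cmod \<beta>) = t ^ d"
    using conj by (simp add: d_def card_conjugates[OF \<eta>(1)])
  finally have "real c ^ K = real l ^ K * (t ^ K) ^ d"
    by (simp add: power_mult_distrib mult.commute flip: power_mult)
  \<comment> \<open>\<open>e j\<close> is the exponent of \<open>q j\<close> in \<open>t^(K d)\<close>; its positive and negative parts are kept on opposite sides to stay among the naturals.\<close>
  moreover define e where "e j = int k * int d * n $ j" for j
  have "(t ^ K) ^ d = (\<Prod>j\<in>UNIV. real (q j) powi e j)"
  proof -
    have "((r j powi (n $ j)) ^ K) ^ d = real (q j) powi e j" for j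
    proof -
      have "((r j powi (n $ j)) ^ K) ^ d = (r j powi int K) powi (n $ j * int d)"
        by (simp only: power_int_mult[symmetric] power_int_of_nat[symmetric] mult_ac)
      also have "\<dots> = (real (q j) ^ k) powi (n $ j * int d)" by (simp only: power_int_of_nat rK)
      also have "\<dots> = real (q j) powi e j"
        by (simp only: e_def power_int_mult[symmetric] power_int_of_nat[symmetric] mult_ac)
      finally show ?thesis .
    qed
    then show ?thesis unfolding t_def by (simp add: prod_power_distrib)
  qed
  moreover have "(\<Prod>j\<in>UNIV. real (q j) powi e j) * (\<Prod>j\<in>UNIV. real (q j) ^ nat (- e j)) = (\<Prod>j\<in>UNIV. real (q j) ^ nat (e j))"
  proof -
    have "real (q j) powi e j * real (q j) ^ nat (- e j) = real (q j) ^ nat (e j)" for j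
      using qpos[of j] by (auto simp: power_int_def power_inverse)
    then show ?thesis by (simp flip: prod.distrib)
  qed
  ultimately have "real c ^ K * (\<Prod>j\<in>UNIV. real (q j) ^ nat (- e j)) = real l ^ K * (\<Prod>j\<in>UNIV. real (q j) ^ nat (e j))"
    by (simp only: mult.assoc)
  then have "real (c ^ K * (\<Prod>j\<in>UNIV. q j ^ nat (- e j))) = real (l ^ K * (\<Prod>j\<in>UNIV. q j ^ nat (e j)))"
    by simp
  then have eq: "c ^ K * (\<Prod>j\<in>UNIV. q j ^ nat (- e j)) = l ^ K * (\<Prod>j\<in>UNIV. q j ^ nat (e j))"
    by (simp only: of_nat_eq_iff)
  obtain i where i: "n $ i \<noteq> 0" using n by (auto simp: vec_eq_iff)
  have nz: "(\<Prod>j\<in>UNIV. q j ^ f j) \<noteq> 0" for f using qpos by (simp add: prod_zero_iff)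
  have mult: "multiplicity (q i) (b ^ K * (\<Prod>j\<in>UNIV. q j ^ f j)) = K * multiplicity (q i) b + f i"
    if "b > 0" for b f
    using that q(2)[of i] nz[of f] multiplicity_prod_inj_primes[OF q, of i f]
    by (simp add: prime_elem_multiplicity_mult_distrib prime_elem_multiplicity_power_distrib)
  have "K * multiplicity (q i) c + nat (- e i) = K * multiplicity (q i) l + nat (e i)"
    using mult[OF c(2), of "\<lambda>j. nat (- e j)"] mult[OF l(2), of "\<lambda>j. nat (e j)"] eq by simp
  then have "int K * int (multiplicity (q i) c) + int (nat (- e i)) = int K * int (multiplicity (q i) l) + int (nat (e i))"
    by (metis of_nat_add of_nat_mult)
  then have "e i = int K * (int (multiplicity (q i) c) - int (multiplicity (q i) l))"
    by (cases "e i \<ge> 0") (simp_all add: right_diff_distrib)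
  then have "int K dvd int k * (int d * n $ i)" by (simp add: e_def mult.assoc)
  moreover have "coprime (int K) (int k)" using cop by simp
  ultimately have "int K dvd int d * n $ i" by (simp add: coprime_dvd_mult_right_iff)
  moreover have dpos: "d > 0" using alg_degree_pos[OF \<eta>(1)] by (simp add: d_def)
  ultimately have "int K \<le> \<bar>int d * n $ i\<bar>" using i by (intro zdvd_imp_le) auto
  also have "\<dots> = int d * \<bar>n $ i\<bar>" by (simp add: abs_mult)
  also have "\<dots> \<le> int d * (\<Sum>j\<in>UNIV. \<bar>n $ j\<bar>)" by (intro mult_left_mono member_le_sum) auto
  also have "(\<Sum>j\<in>UNIV. \<bar>n $ j\<bar>) = int (norm_l1 n)" by (simp add: norm_l1_def sum_nonneg)
  finally have "int K \<le> int (norm_l1 n * d)" by (simp add: mult.commute)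
  then show "K \<le> norm_l1 n * alg_degree (monomial_char n (prime_root_point q k K))"
    unfolding d_def \<eta>_def \<xi>_def by (simp only: of_nat_le_iff)
qed

text \<open>\<open>K = k^2 + 1\<close> is coprime to \<open>k\<close>, so the generalized degree is at least \<open>K\<close>. The heights have
  order \<open>k/K\<close>, which tends to zero but still dominates \<open>log(2K)/K\<close>; hence \<open>h_D\<close> is
  comparable to \<open>|s|\<close>.\<close>
lemma prime_root_point_height_D_le:
  fixes q :: "'n::finite \<Rightarrow> nat" and s :: "real ^ 'n"
  assumes q: "inj q" "\<And>j. prime (q j)" and k: "k \<ge> 1"
  defines "\<xi> \<equiv> prime_root_point q k (k\<^sup>2 + 1)"
  defines "s \<equiv> \<chi> j. real k * ln (real (q j)) / real (k\<^sup>2 + 1)"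
  shows "height_D \<xi> \<le> (real CARD('n) + 2) * norm s"
    and "\<And>\<alpha>. \<alpha> \<in> galois_orbit \<xi> \<Longrightarrow> log_coords \<alpha> = s"
    and "norm s \<le> (\<Sum>j\<in>UNIV. ln (real (q j))) * (1 / real k)"
proof -
  define K where "K = k\<^sup>2 + 1"
  have K: "K > 0" "K \<ge> 1" by (simp_all add: K_def)
  have \<xi>: "\<xi> \<in> alg_torus" unfolding \<xi>_def by (rule prime_root_point_alg_torus[OF q(2)]) simp
  have q2: "q j \<ge> 2" for j using q(2)[of j] by (rule prime_ge_2_nat)
  have qk: "q j ^ k > 0" for j using q2[of j] by simp
  have s: "s $ j = real k * ln (real (q j)) / real K" for j by (simp add: s_def K_def)
  have s0: "s $ j \<ge> 0" for j unfolding s using q2[of j] by (intro divide_nonneg_nonneg mult_nonneg_nonneg ln_ge_zero) auto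
  have lnroot: "ln (root K (real (q j ^ k))) = s $ j" for j
    using K q2[of j] by (simp add: s ln_root ln_realpow)
  show "log_coords \<alpha> = s" if "\<alpha> \<in> galois_orbit \<xi>" for \<alpha>
  proof -
    have "cmod (\<alpha> $ j) = root K (real (q j ^ k))" for j
      by (rule norm_orbit_prime_root_point[OF q(2) K(1)]) (use that in \<open>simp add: \<xi>_def K_def\<close>)
    then show ?thesis unfolding vec_eq_iff log_coords_def using lnroot by simp
  qed
  have sn: "s $ j \<le> norm s" for j using component_le_norm_cart[of s j] s0[of j] by simp
  have "weil_height_vec \<xi> = (\<Sum>j\<in>UNIV. s $ j)"
    unfolding weil_height_vec_def \<xi>_def prime_root_point_def
    using weil_height_root_of_nat[OF K(1) qk] q2 by (simp add: s K_def ln_realpow del: of_nat_power) (simp add: ln_realpow)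
  also have "\<dots> \<le> (\<Sum>j\<in>(UNIV::'n set). norm s)" by (intro sum_mono sn)
  finally have h: "weil_height_vec \<xi> \<le> real CARD('n) * norm s" by simp
  have "coprime K k"
  proof -
    have "coprime (1 + k * k) k" by (rule coprimeI) (metis dvd_add_left_iff dvd_mult2)
    then show ?thesis by (simp add: K_def power2_eq_square)
  qed
  then have D: "K \<le> gen_degree \<xi>" unfolding \<xi>_def K_def[symmetric]
    by (rule gen_degree_prime_root_point[OF q K(1)])
  have "ln (2 * real (gen_degree \<xi>)) / real (gen_degree \<xi>) \<le> ln (2 * real K) / real K"
    by (rule ln_double_div_antimono[OF K(2) D])
  moreover have "ln (2 * real K) \<le> 2 * real k"
  proof -
    have "2 * real K \<le> 2\<^sup>2 * (real k)\<^sup>2"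
    proof -
      have "1 \<le> (real k)\<^sup>2" using k by simp
      then show ?thesis by (simp add: K_def)
    qed
    then have "ln (2 * real K) \<le> ln ((2 * real k)\<^sup>2)" using K by (intro ln_mono) (auto simp: power_mult_distrib)
    also have "\<dots> = 2 * ln (2 * real k)" using k by (subst ln_realpow) auto
    also have "ln (2 * real k) = ln 2 + ln (real k)" using k by (simp add: ln_mult)
    also have "ln (real k) \<le> real k - 1" using k by (intro ln_le_minus_one) auto
    also have "ln (2::real) \<le> 1" using ln_le_minus_one[of "2::real"] by simp
    finally show ?thesis by simp
  qed
  ultimately have "ln (2 * real (gen_degree \<xi>)) / real (gen_degree \<xi>) \<le> 2 * real k / real K"
    by (meson divide_right_mono of_nat_0_le_iff order_trans)
  moreover have "real k / real K \<le> 2 * norm s"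
  proof -
    fix j0 :: 'n
    have "1 / 2 \<le> ln (2::real)" using ln2_ge_two_thirds by simp
    also have "\<dots> \<le> ln (real (q j0))" using q2[of j0] by (intro ln_mono) auto
    finally have "real k * (1 / 2) / real K \<le> real k * ln (real (q j0)) / real K"
      by (intro divide_right_mono mult_left_mono) auto
    then show ?thesis using sn[of j0] unfolding s by simp
  qed
  ultimately have "ln (2 * real (gen_degree \<xi>)) / (3 * real (gen_degree \<xi>)) \<le> 2 * norm s"
  proof -
    assume a: "ln (2 * real (gen_degree \<xi>)) / real (gen_degree \<xi>) \<le> 2 * real k / real K"
      and b: "real k / real K \<le> 2 * norm s"
    have "ln (2 * real (gen_degree \<xi>)) / (3 * real (gen_degree \<xi>))
      = (ln (2 * real (gen_degree \<xi>)) / real (gen_degree \<xi>)) / 3" by simp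
    also have "\<dots> \<le> (2 * (real k / real K)) / 3" using a by (intro divide_right_mono) auto
    also have "\<dots> \<le> (2 * (2 * norm s)) / 3" using b by (intro divide_right_mono mult_left_mono) auto
    also have "\<dots> \<le> 2 * norm s" using norm_ge_zero[of s] by linarith
    finally show ?thesis .
  qed
  then show "height_D \<xi> \<le> (real CARD('n) + 2) * norm s"
    using h unfolding height_D_def by (simp add: distrib_right)
  have "norm s \<le> (\<Sum>j\<in>UNIV. \<bar>s $ j\<bar>)" by (rule norm_le_l1_cart)
  also have "\<dots> \<le> (\<Sum>j\<in>UNIV. ln (real (q j)) * (1 / real k))"
  proof (rule sum_mono)
    fix j
    have "real k / real K \<le> real k / (real k * real k)"
      using k K by (intro divide_left_mono) (auto simp: K_def power2_eq_square intro!: mult_pos_pos add_pos_nonneg)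
    also have "\<dots> = 1 / real k" using k by simp
    finally have "ln (real (q j)) * (real k / real K) \<le> ln (real (q j)) * (1 / real k)"
      using q2[of j] by (intro mult_left_mono ln_ge_zero) auto
    then show "\<bar>s $ j\<bar> \<le> ln (real (q j)) * (1 / real k)" using s0[of j] by (simp add: s mult.commute)
  qed
  finally show "norm s \<le> (\<Sum>j\<in>UNIV. ln (real (q j))) * (1 / real k)"
    unfolding sum_distrib_right .
qed

lemma ex_inj_primes: "\<exists>q :: 'n::finite \<Rightarrow> nat. inj q \<and> (\<forall>j. prime (q j))"
proof -
  obtain B :: "nat set" where B: "finite B" "card B = CARD('n)" "B \<subseteq> {p. prime p}"
    using infinite_arbitrarily_large[OF primes_infinite] by blast
  obtain q :: "'n \<Rightarrow> nat" where "bij_betw q UNIV B"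
    using finite_same_card_bij[of "UNIV :: 'n set" B] B by auto
  then show ?thesis using B(3) unfolding bij_betw_def by (intro exI[of _ q]) auto
qed

text \<open>\<open>F(\<theta>,s) = A|s|^\<gamma>\<close> vanishes on the polycircle and all points of the Galois orbit of \<open>\<xi>_k\<close>
  have the same logarithmic coordinates \<open>s_k\<close>. The error is therefore exactly \<open>A|s_k|^\<gamma>\<close>,
  and \<open>A\<close> is chosen to make up for the factor in \<open>h_D(\<xi>_k) \<le> (N+2)|s_k|\<close>.\<close>
theorem equi_error_exponent_sharp:
  assumes \<gamma>: "0 < \<gamma>"
  shows "\<exists>(F :: real ^ 'n \<Rightarrow> real ^ 'n \<Rightarrow> complex) (\<xi> :: nat \<Rightarrow> complex ^ 'n).
        torus_continuous F \<and> bound_const \<gamma> F < \<infinity> \<and>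
        (\<forall>k\<ge>1. \<xi> k \<in> alg_torus) \<and>
        (\<lambda>k. height_D (\<xi> k)) \<longlonglongrightarrow> 0 \<and>
        (\<forall>k\<ge>1. equi_error F (\<xi> k) \<ge> height_D (\<xi> k) powr \<gamma>)"
proof -
  obtain q :: "'n \<Rightarrow> nat" where q: "inj q" "\<And>j. prime (q j)" using ex_inj_primes by blast
  \<comment> \<open>\<open>N + 2\<close> bounds \<open>h_D\<close> by \<open>|s|\<close>: each of the \<open>N\<close> heights is at most \<open>|s|\<close>, and the logarithmic term at most \<open>2 |s|\<close>.\<close>
  define A where "A = (real CARD('n) + 2) powr \<gamma>"
  define F :: "real ^ 'n \<Rightarrow> real ^ 'n \<Rightarrow> complex" where "F \<theta> s = of_real (A * norm s powr \<gamma>)" for \<theta> s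
  define \<xi> :: "nat \<Rightarrow> complex ^ 'n" where "\<xi> k = prime_root_point q k (k\<^sup>2 + 1)" for k
  define s :: "nat \<Rightarrow> real ^ 'n" where "s k = (\<chi> j. real k * ln (real (q j)) / real (k\<^sup>2 + 1))" for k
  have A: "A \<ge> 0" by (simp add: A_def)
  have F0: "F \<theta> 0 = 0" for \<theta> using \<gamma> by (simp add: F_def)
  have cont: "torus_continuous F"
    unfolding torus_continuous_def F_def case_prod_unfold using \<gamma>
    by (intro conjI allI continuous_intros continuous_on_powr') auto
  have "holder_const \<gamma> F \<le> ennreal A"
    unfolding holder_const_def
  proof (rule SUP_least)
    fix p :: "(real ^ 'n) \<times> (real ^ 'n)" assume "p \<in> UNIV \<times> (UNIV - {0})"
    then obtain \<theta> s where p: "p = (\<theta>, s)" "s \<noteq> 0" by auto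
    have "cmod (F \<theta> s - F \<theta> 0) / norm s powr \<gamma> = A"
      using A p(2) unfolding F0 by (simp add: F_def norm_mult)
    then show "(case p of (\<theta>, s) \<Rightarrow> ennreal (cmod (F \<theta> s - F \<theta> 0) / norm s powr \<gamma>)) \<le> ennreal A"
      by (simp add: p(1))
  qed
  moreover have "fourier_coeff (\<lambda>\<theta>. F \<theta> 0) n = 0" for n
    unfolding F0 using fourier_coeff_const[of 0 n] by simp
  ultimately have "bound_const \<gamma> F \<le> ennreal (2 powr \<gamma>) * ennreal A"
    unfolding bound_const_def by (simp add: mult_left_mono)
  also have "\<dots> < \<infinity>" by (simp add: ennreal_mult_less_top)
  finally have bc: "bound_const \<gamma> F < \<infinity>" .
  have tor: "\<xi> k \<in> alg_torus" for k
    unfolding \<xi>_def by (rule prime_root_point_alg_torus[OF q(2)]) simp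
  note est = prime_root_point_height_D_le[OF q, folded \<xi>_def s_def]
  define C where "C = (real CARD('n) + 2) * (\<Sum>j\<in>UNIV. ln (real (q j)))"
  have "(\<lambda>k. C * (1 / real k)) \<longlonglongrightarrow> C * 0"
    by (intro tendsto_intros lim_1_over_n)
  then have lim: "(\<lambda>k. C * (1 / real k)) \<longlonglongrightarrow> 0" by simp
  have ht: "(\<lambda>k. height_D (\<xi> k)) \<longlonglongrightarrow> 0"
  proof (rule tendsto_sandwich[OF _ _ tendsto_const lim])
    show "\<forall>\<^sub>F k in sequentially. 0 \<le> height_D (\<xi> k)"
      using height_D_pos[OF tor] by (intro always_eventually allI less_imp_le)
    show "\<forall>\<^sub>F k in sequentially. height_D (\<xi> k) \<le> C * (1 / real k)"
      using eventually_ge_at_top[of 1]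
    proof eventually_elim
      case (elim k)
      have "height_D (\<xi> k) \<le> (real CARD('n) + 2) * norm (s k)" by (rule est(1)[OF elim])
      also have "\<dots> \<le> (real CARD('n) + 2) * ((\<Sum>j\<in>UNIV. ln (real (q j))) * (1 / real k))"
        by (intro mult_left_mono est(3)[OF elim]) auto
      finally show ?case by (simp add: C_def)
    qed
  qed
  have err: "equi_error F (\<xi> k) \<ge> height_D (\<xi> k) powr \<gamma>" if k: "k \<ge> 1" for k
  proof -
    have c: "card (galois_orbit (\<xi> k)) > 0" by (rule card_galois_orbit_pos[OF tor])
    have "(\<Sum>\<alpha>\<in>galois_orbit (\<xi> k). F (angle_coords \<alpha>) (log_coords \<alpha>))
      = of_nat (card (galois_orbit (\<xi> k))) * of_real (A * norm (s k) powr \<gamma>)"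
      using est(2)[OF k] by (simp add: F_def)
    moreover have "torus_integral (\<lambda>\<theta>. F \<theta> 0) = 0"
      unfolding F0 by (simp add: torus_integral_def)
    ultimately have "equi_error F (\<xi> k) = A * norm (s k) powr \<gamma>"
      unfolding equi_error_def using c A by (simp add: norm_mult)
    also have "\<dots> = ((real CARD('n) + 2) * norm (s k)) powr \<gamma>"
      by (simp add: A_def powr_mult)
    finally show ?thesis
      using est(1)[OF k] height_D_pos[OF tor, of k] \<gamma> by (simp add: powr_mono2)
  qed
  show ?thesis using cont bc tor ht err by blast
qed

theorem corollary6:
  fixes \<gamma> :: real
  assumes "0 < \<gamma>" and "\<gamma> \<le> 1 / 2"
  shows
    "(\<forall>(F :: real ^ 'n \<Rightarrow> real ^ 'n \<Rightarrow> complex) (\<xi> :: complex ^ 'n).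
        torus_continuous F \<and> \<xi> \<in> alg_torus \<longrightarrow>
        ennreal (equi_error F \<xi>) \<le> bound_const \<gamma> F * ennreal (height_D \<xi> powr \<gamma>)) \<and>
     (\<exists>(F :: real ^ 'n \<Rightarrow> real ^ 'n \<Rightarrow> complex) (\<xi> :: nat \<Rightarrow> complex ^ 'n).
        torus_continuous F \<and> bound_const \<gamma> F < \<infinity> \<and>
        (\<forall>k\<ge>1. \<xi> k \<in> alg_torus) \<and>
        (\<lambda>k. height_D (\<xi> k)) \<longlonglongrightarrow> 0 \<and>
        (\<forall>k\<ge>1. equi_error F (\<xi> k) \<ge> height_D (\<xi> k) powr \<gamma>))"
  using equi_error_le[OF _ _ assms] equi_error_exponent_sharp[OF assms(1)] by blast

end
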